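(* Let $c>0$ be real, $s\in\mathbb{C}$ with $\mathrm{Re}(s)>0$, $\gamma=(\gamma_1,\dots,\gamma_{\ell+1})\in\mathbb{R}^{\ell+1}$ and $\epsilon\in\mathcal{P}=\{0,1\}^{\ell+1}$. The Hecke-Baxter operator, defined as convolution with the one-parameter family of functions on $GL_{\ell+1}(\mathbb{R})$ $$\widehat{Q}_s(g)=\Delta_W(g)\,(c\pi^{-1})^{\frac{\ell(\ell+1)}{4}}\,|\det g|^{s+\frac{\ell}{2}}\,e^{-c\,\mathrm{Tr}(g^{\top}g)},\qquad \Delta_W(g)=\sum_{\epsilon'\in\mathcal{P}}d_{|\epsilon'|}\,(v_{\epsilon'},\pi_W(g)\,v_{\epsilon'}),$$ acts on the $\epsilon$-spherical vector $$\phi_\epsilon(g)=(v_\epsilon,\pi_W(k)\,v_\epsilon)\,\chi^B_\gamma(a),\qquad \chi^B_\gamma(a)=\prod_{j=1}^{\ell+1}a_j^{\imath\gamma_j+\rho_j},\qquad g=kan\in O_{\ell+1}AN,$$ via multiplication by the Archimedean $L$-factor: for every $\tilde g\in GL_{\ell+1}(\mathbb{R})$, $$(\widehat Q_s*\phi_\epsilon)(\tilde g)=\int_{GL_{\ell+1}(\mathbb{R})}d\mu(g)\,\widehat{Q}_s(g)\,\phi_\epsilon(g^{-1}\tilde g)=L(s|\epsilon,\gamma)\,\phi_\epsilon(\tilde g),$$ $$L(s|\epsilon,\gamma)=\prod_{j=1}^{\ell+1}c^{-\frac{s+\epsilon_j-\imath\gamma_j}{2}}\,\Gamma\Big(\f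rac{s+\epsilon_j-\imath\gamma_j}{2}\Big).$$
   Context: Notation. $\imath=\sqrt{-1}$. $O_{\ell+1}\subset GL_{\ell+1}(\mathbb{R})$ is the orthogonal group, $A$ the group of diagonal matrices $a=\mathrm{diag}(a_1,\dots,a_{\ell+1})$ with strictly positive entries, $N$ the group of lower-triangular unipotent matrices. Every $g\in GL_{\ell+1}(\mathbb{R})$ has a unique Iwasawa decomposition $g=kan$ with $k\in O_{\ell+1}$, $a\in A$, $n\in N$. Put $\rho_j=\frac{\ell}{2}+1-j$ and $a^{2\rho}=\prod_j a_j^{2\rho_j}$. For $\epsilon\in\mathcal{P}=\{0,1\}^{\ell+1}$ let $|\epsilon|=\sum_i\epsilon_i$. Let $W=\bigoplus_{k=0}^{\ell+1}W_k$, $W_k=\wedge^k\mathbb{C}^{\ell+1}$, with $\pi_W$ the natural representation of $GL_{\ell+1}(\mathbb{R})$ on $W$, and $d_k=\dim W_k=\binom{\ell+1}{k}$. Let $e_1,\dots,e_{\ell+1}$ be the standard orthonormal basis of $\mathbb{C}^{\ell+1}$. The vector $v_\epsilon\in W_{|\epsilon|}$ is the wedge product, in increasing order of index, of the $e_i$ with $\epsilon_i=1$, normalized so that $\{v_\epsilon\}_{\epsilon\in\mathcal{P}}$ is an orthonormal basis of $W$ for the inner product $(\cdot,\cdot)$. Thus $(v_\epsilon,\pi_W(g)v_\epsilon)$ is the principal minor of $g$ with rows and columns $\{i:\epsilon_i=1\}$ (equal to $1$ if $\epsilon=0$). The vector $\phi_\epsilon$ lies in the principal series representation of functions on $GL_{\ell+1}(\mathbb{R})$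 satisfying $\phi(gb)=\phi(g)\prod_j\mathrm{sign}(b_{jj})^{\epsilon_j}|b_{jj}|^{\imath\gamma_j+\rho_j}$ for all lower-triangular invertible $b$, on which $GL_{\ell+1}(\mathbb{R})$ acts by $(\pi(g)\phi)(\tilde g)=\phi(g^{-1}\tilde g)$. $d\mu(g)=|\det g|^{-(\ell+1)}\prod_{i,j=1}^{\ell+1}dg_{ij}$ is the Haar measure on $GL_{\ell+1}(\mathbb{R})$; under the Iwasawa decomposition $g=kan$ it is written as $d\mu(g)=a^{-2\rho}\,dk\,da\,dn$ with $da=\prod_i\frac{da_i}{a_i}$, $dn=\prod_{i>j}dn_{ij}$, and $dk$ the Haar measure on $O_{\ell+1}$ normalized by $\int_{O_{\ell+1}}dk=1$.
   Formalization: The Haar measure is rescaled to ∏_{j=1}^{ℓ+1} Γ(j/2)π^{-j/2}·|det g|^{-(ℓ+1)}∏dg_ij (dk of total mass 2^{ℓ+1}); with the stated Lebesgue scale the identity is off by ∏π^{j/2}/Γ(j/2), and with ∫dk=1 by 2^{-(ℓ+1)}. *)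

theory Defs
  imports "HOL-Analysis.Analysis"
begin

text \<open>Matrices have type \<open>real^'n^'n\<close> with a finite linearly ordered index type \<open>'n\<close>,
  \<open>CARD('n) = \<ell> + 1\<close>; an element \<open>j :: 'n\<close> stands for its position in \<open>{1, \<dots>, \<ell> + 1}\<close>.\<close>

type_synonym 'n rmat = "real ^ 'n ^ 'n"
type_synonym 'n rvec = "real ^ 'n"
type_synonym 'n cvec = "complex ^ 'n"

definition ell :: "'n::finite itself \<Rightarrow> nat" where
  "ell _ = CARD('n) - 1"

definition position :: "'n::{finite,linorder} \<Rightarrow> nat" where
  "position j = card {i. i \<le> j}"

definition rho :: "'n::{finite,linorder} \<Rightarrow> real" where
  "rho j = real (ell TYPE('n)) / 2 + 1 - real (position j)"

subsection \<open>The exterior algebra\<close>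

text \<open>\<open>W\<close> is modelled on coordinates indexed by subsets of the index set.\<close>

type_synonym 'n ext = "complex ^ ('n set)"

text \<open>The sign is that of the shuffle sorting \<open>S\<close> followed by \<open>U - S\<close>.\<close>

definition wedge :: "('n::{finite,linorder}) ext \<Rightarrow> 'n ext \<Rightarrow> 'n ext" (infixr "\<and>\<^sub>W" 70) where
  "x \<and>\<^sub>W y =
     (\<chi> U. \<Sum>S\<in>Pow U. (-1) ^ card {(i, j). i \<in> S \<and> j \<in> U - S \<and> j < i} * x $ S * y $ (U - S))"

definition ext_one :: "('n::{finite,linorder}) ext" where
  "ext_one = axis {} 1"

definition ext_vec :: "('n::{finite,linorder}) cvec \<Rightarrow> 'n ext" where
  "ext_vec x = (\<Sum>i\<in>UNIV. x $ i *s axis {i} 1)"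

definition wedge_list :: "(('n::{finite,linorder}) cvec) list \<Rightarrow> 'n ext" where
  "wedge_list xs = foldr (\<lambda>x w. ext_vec x \<and>\<^sub>W w) xs ext_one"

definition ext_inner :: "('n::{finite,linorder}) ext \<Rightarrow> 'n ext \<Rightarrow> complex" where
  "ext_inner x y = (\<Sum>S\<in>UNIV. cnj (x $ S) * y $ S)"

definition sign_vectors :: "('n \<Rightarrow> nat) set" where
  "sign_vectors = UNIV \<rightarrow> {0, 1}"

definition support_list :: "('n::{finite,linorder} \<Rightarrow> nat) \<Rightarrow> 'n list" where
  "support_list \<epsilon> = sorted_list_of_set {i. \<epsilon> i = 1}"

definition basis_vec :: "('n::{finite,linorder} \<Rightarrow> nat) \<Rightarrow> 'n ext" where
  "basis_vec \<epsilon> = wedge_list (map (\<lambda>i. axis i 1) (support_list \<epsilon>))"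

lemma ext_vec_axis: "ext_vec (axis i 1) = axis {i} 1"
proof -
  have "ext_vec (axis i 1) = (\<Sum>j\<in>UNIV. if j = i then axis {i} 1 else 0)"
    unfolding ext_vec_def by (rule sum.cong) (auto simp: axis_def vec_eq_iff)
  then show ?thesis by simp
qed

lemma wedge_axis_less:
  assumes "\<And>t. t \<in> T \<Longrightarrow> i < t"
  shows "axis {i} 1 \<and>\<^sub>W axis T 1 = axis (insert i T) 1"
unfolding vec_eq_iff
proof
  fix U
  have iT: "i \<notin> T" using assms by blast
  have "(axis {i} 1 \<and>\<^sub>W axis T 1) $ U =
      (\<Sum>S\<in>Pow U. if S = {i} then (-1) ^ card {(k, j). k \<in> {i} \<and> j \<in> U - {i} \<and> j < k} *
        (axis T 1 $ (U - {i})) else 0)"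
    unfolding wedge_def vec_lambda_beta
    by (rule sum.cong[OF refl]) (simp only: axis_def vec_lambda_beta, simp)
  also have "\<dots> = (if i \<in> U then (-1) ^ card {(k, j). k \<in> {i} \<and> j \<in> U - {i} \<and> j < k} *
        (axis T 1 $ (U - {i})) else 0)"
    by (subst sum.delta) auto
  also have "\<dots> = axis (insert i T) 1 $ U"
  proof (cases "i \<in> U \<and> U - {i} = T")
    case True
    then have "{(k, j). k \<in> {i} \<and> j \<in> U - {i} \<and> j < k} = {}"
      using assms by force
    then have "card {(k, j). k \<in> {i} \<and> j \<in> U - {i} \<and> j < k} = 0"
      by (simp only: card.empty)
    moreover have "U = insert i T" using True by blast
    ultimately show ?thesis using True by (simp only: axis_def vec_lambda_beta power_0) simp
  next
    case False
    then have "U \<noteq> insert i T" using iT by auto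
    then show ?thesis using False by (auto simp: axis_def)
  qed
  finally show "(axis {i} 1 \<and>\<^sub>W axis T 1) $ U = axis (insert i T) 1 $ U" .
qed

text \<open>The \<open>v\<^sub>\<epsilon>\<close> are the coordinate vectors, so they are orthonormal for \<open>ext_inner\<close>.\<close>

lemma basis_vec_eq_axis: "basis_vec \<epsilon> = axis {i. \<epsilon> i = 1} 1"
proof -
  have "wedge_list (map (\<lambda>i. axis i 1) xs) = axis (set xs) 1" if "sorted_wrt (<) xs" for xs :: "'a list"
    using that
  proof (induction xs)
    case Nil
    show ?case by (simp add: wedge_list_def ext_one_def)
  next
    case (Cons i xs)
    then show ?case
      using wedge_axis_less[of "set xs" i] by (simp add: wedge_list_def ext_vec_axis)
  qed
  then show ?thesis
    by (simp add: basis_vec_def support_list_def)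
qed

text \<open>The linear map sending each \<open>e\<^bsub>i\<^sub>1\<^esub> \<and> \<dots> \<and> e\<^bsub>i\<^sub>k\<^esub>\<close> to \<open>g e\<^bsub>i\<^sub>1\<^esub> \<and> \<dots> \<and> g e\<^bsub>i\<^sub>k\<^esub>\<close>.\<close>

definition piW :: "('n::{finite,linorder}) rmat \<Rightarrow> 'n ext \<Rightarrow> 'n ext" where
  "piW g w = (\<Sum>\<epsilon>\<in>sign_vectors. ext_inner (basis_vec \<epsilon>) w *s
     wedge_list (map (\<lambda>i. \<chi> j. complex_of_real (g $ j $ i)) (support_list \<epsilon>)))"

definition Delta_W :: "('n::{finite,linorder}) rmat \<Rightarrow> complex" where
  "Delta_W g = (\<Sum>\<epsilon>\<in>sign_vectors.
     of_nat (CARD('n) choose (\<Sum>i\<in>UNIV. \<epsilon> i)) * ext_inner (basis_vec \<epsilon>) (piW g (basis_vec \<epsilon>)))"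

subsection \<open>Iwasawa decomposition and the spherical vectors\<close>

definition posdiag :: "(('n::finite) rmat) set" where
  "posdiag = {a. (\<forall>i. 0 < a $ i $ i) \<and> (\<forall>i j. i \<noteq> j \<longrightarrow> a $ i $ j = 0)}"

definition lower_unipotent :: "(('n::{finite,linorder}) rmat) set" where
  "lower_unipotent = {n. (\<forall>i. n $ i $ i = 1) \<and> (\<forall>i j. i < j \<longrightarrow> n $ i $ j = 0)}"

definition iwasawa ::
  "('n::{finite,linorder}) rmat \<Rightarrow> ('n rmat) \<times> ('n rmat) \<times> ('n rmat)" where
  "iwasawa g = (THE p. case p of (k, a, n) \<Rightarrow>
     orthogonal_matrix k \<and> a \<in> posdiag \<and> n \<in> lower_unipotent \<and> g = k ** a ** n)"

definition chi_B :: "('n::{finite,linorder}) rvec \<Rightarrow> 'n rmat \<Rightarrow> complex" where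
  "chi_B \<gamma> a = (\<Prod>j\<in>UNIV. of_real (a $ j $ j) powr (\<i> * of_real (\<gamma> $ j) + of_real (rho j)))"

definition spherical_vec ::
  "(('n::{finite,linorder}) \<Rightarrow> nat) \<Rightarrow> 'n rvec \<Rightarrow> 'n rmat \<Rightarrow> complex" where
  "spherical_vec \<epsilon> \<gamma> g = (case iwasawa g of (k, a, n) \<Rightarrow>
     ext_inner (basis_vec \<epsilon>) (piW k (basis_vec \<epsilon>)) * chi_B \<gamma> a)"

subsection \<open>Haar measure and the Hecke-Baxter operator\<close>

definition GL :: "(('n::finite) rmat) set" where
  "GL = {g. invertible g}"

text \<open>The measure \<open>\<bar>det g\<bar>\<^bsup>-(\<ell>+1)\<^esup> \<Prod> dg\<^sub>i\<^sub>j\<close> on the general linear group.\<close>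

definition haar_lebesgue :: "(('n::finite) rmat) measure" where
  "haar_lebesgue = density (restrict_space lborel GL) (\<lambda>g. ennreal (1 / \<bar>det g\<bar> ^ CARD('n)))"

text \<open>
  Scale of the Haar measure.  In Iwasawa coordinates \<open>haar_lebesgue\<close> is \<open>a\<^bsup>-2\<rho>\<^esup> dk da dn\<close>
  with \<open>dk\<close> of total mass \<open>\<Prod>\<^bsub>j=1\<^esub>\<^bsup>\<ell>+1\<^esup> 2 \<pi>\<^bsup>j/2\<^esup> / \<Gamma>(j/2)\<close> (the product of the areas of the
  unit spheres of dimension \<open>0, \<dots>, \<ell>\<close>).  The factor below rescales that mass to \<open>2\<^bsup>\<ell>+1\<^esup>\<close>.
  Equivalently, \<open>dk\<close> has mass \<open>1\<close> and the entries of \<open>a\<close> range over all nonzero reals,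
  with \<open>da = \<Prod> da\<^sub>i / \<bar>a\<^sub>i\<bar>\<close>.  This is the only scale for which the eigenvalue of the
  Hecke-Baxter operator is the L-factor without an extra constant: \<open>haar_lebesgue\<close> itself
  gives \<open>\<Prod>\<^bsub>j=1\<^esub>\<^bsup>\<ell>+1\<^esup> \<pi>\<^bsup>j/2\<^esup> / \<Gamma>(j/2)\<close> times the L-factor (the constant is \<open>1\<close> for \<open>\<ell> = 0\<close>),
  and \<open>a\<^bsup>-2\<rho>\<^esup> dk da dn\<close> with \<open>dk\<close> of mass \<open>1\<close> and \<open>a > 0\<close> gives \<open>2\<^bsup>-(\<ell>+1)\<^esup>\<close> times it.\<close>

definition haar_GL :: "(('n::finite) rmat) measure" where
  "haar_GL = scale_measure
     (ennreal (\<Prod>j = 1..CARD('n). Gamma (real j / 2) / pi powr (real j / 2))) haar_lebesgue"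

definition convolution_integrand ::
  "(('n::finite) rmat \<Rightarrow> complex) \<Rightarrow> ('n rmat \<Rightarrow> complex) \<Rightarrow>
     'n rmat \<Rightarrow> 'n rmat \<Rightarrow> complex" where
  "convolution_integrand Q \<phi> h g = Q g * \<phi> (matrix_inv g ** h)"

definition convolution ::
  "(('n::finite) rmat \<Rightarrow> complex) \<Rightarrow> ('n rmat \<Rightarrow> complex) \<Rightarrow> 'n rmat \<Rightarrow> complex" where
  "convolution Q \<phi> h = (LINT g|haar_GL. convolution_integrand Q \<phi> h g)"

definition Q_hat :: "real \<Rightarrow> complex \<Rightarrow> ('n::{finite,linorder}) rmat \<Rightarrow> complex" where
  "Q_hat c s g =
     Delta_W g *
     of_real ((c / pi) powr (real (ell TYPE('n) * (ell TYPE('n) + 1)) / 4)) *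
     of_real \<bar>det g\<bar> powr (s + of_nat (ell TYPE('n)) / 2) *
     of_real (exp (- c * trace (transpose g ** g)))"

definition L_factor :: "real \<Rightarrow> complex \<Rightarrow> ('n::finite \<Rightarrow> nat) \<Rightarrow> 'n rvec \<Rightarrow> complex" where
  "L_factor c s \<epsilon> \<gamma> = (\<Prod>j\<in>UNIV.
     of_real c powr (- ((s + of_nat (\<epsilon> j) - \<i> * of_real (\<gamma> $ j)) / 2)) *
     Gamma ((s + of_nat (\<epsilon> j) - \<i> * of_real (\<gamma> $ j)) / 2))"

end

theory Submission
  imports Defs
begin

text \<open>
  By the Iwasawa decomposition and left invariance one may take \<open>g\<close> in the form \<open>k ** g\<close>, where
  \<open>h = k b\<close> with \<open>k\<close> orthogonal and \<open>b\<close> lower triangular. Gram-Schmidt on the rows gives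
  \<open>g = L q\<close> with \<open>L\<close> lower triangular and \<open>q\<close> orthogonal, and \<open>\<phi>\<^sub>\<epsilon> (g\<inverse> b)\<close> becomes a principal
  minor of \<open>q\<^sup>T\<close> times a product of powers of the \<open>L\<^sub>j\<^sub>j\<close>. The integrand is averaged over the
  measure preserving maps \<open>g \<mapsto> d g w\<close> with \<open>d\<close> a diagonal sign matrix and \<open>w\<close> a signed
  permutation matrix. The exterior powers are irreducible and pairwise inequivalent already for
  signed permutations, so Schur orthogonality turns the average over \<open>w\<close> into a minor of \<open>k d L d\<close>,
  and the average over \<open>d\<close> leaves the minor of \<open>k\<close> times \<open>\<Prod> L\<^sub>j\<^sub>j\<^bsup>\<epsilon>\<^sub>j\<^esup>\<close>. Finally, for a Gaussian matrix the
  \<open>L\<^sub>j\<^sub>j\<^sup>2\<close> are independent and gamma distributed, so the remaining integral is a product of values of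
  \<open>\<Gamma>\<close>; no Haar measure on the orthogonal group is needed.
\<close>

section \<open>Exterior powers as matrices of minors\<close>

text \<open>\<open>Delta_W\<close> weights the trace of each exterior power by its dimension. Schur
  orthogonality divides by exactly this dimension, so with these weights the averaged pairing with a
  diagonal matrix coefficient reproduces that coefficient with a factor that does not depend on the
  degree. \<open>Delta_W\<close> itself is not invariant under orthogonal matrices on one side,
  which is why the average is needed before the residual norms can be separated.

  Rows rather than columns are orthogonalized because g = L q turns g^{-1} b into q^T (L^{-1} b),
  which is already in Iwasawa form.

  Write r_j for the diagonal entries of L and m_j for the number of indices i with j \<le> i. The
  determinant, the Haar density and the spherical vector contribute powers of r_j with total
  exponent z_j, where z_j + m_j = s - \<i> \<gamma>_j. For a Gaussian matrix c r_j^2 has shape m_j /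
  2, so the moment of order z_j + \<epsilon>_j contains \<Gamma>((s + \<epsilon>_j - \<i>
  \<gamma>_j) / 2), and Re s > 0 makes it converge. The normalizing values \<Gamma>(m_j / 2) are
  cancelled by the scale of \<open>haar_GL\<close>.\<close>

definition col_vec :: "'n::finite rmat \<Rightarrow> 'n \<Rightarrow> 'n cvec" where
  "col_vec g i = (\<chi> j. complex_of_real (g $ j $ i))"

definition wedge_cols :: "('n::{finite,linorder}) rmat \<Rightarrow> 'n set \<Rightarrow> 'n ext" where
  "wedge_cols g S = wedge_list (map (col_vec g) (sorted_list_of_set S))"

text \<open>The matrix entry of the exterior power of \<open>g\<close> with row set \<open>I\<close>
  and column set \<open>J\<close>. Reading it as a coordinate of a wedge product avoids submatrices
  with index types of their own.\<close>

definition minor :: "('n::{finite,linorder}) rmat \<Rightarrow> 'n set \<Rightarrow> 'n set \<Rightarrow> complex" where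
  "minor g I J = wedge_cols g J $ I"

lemma bij_sign_vectors: "bij_betw (\<lambda>\<epsilon>. {i. \<epsilon> i = 1}) (sign_vectors :: ('n \<Rightarrow> nat) set) UNIV"
proof (rule bij_betwI[where g = "\<lambda>S i. if i \<in> S then 1 else 0"])
  show "(\<lambda>i. if i \<in> {i. \<epsilon> i = 1} then 1 else 0) = \<epsilon>" if "\<epsilon> \<in> sign_vectors" for \<epsilon> :: "'n \<Rightarrow> nat"
    using that by (auto simp: sign_vectors_def fun_eq_iff Pi_iff)
qed (auto simp: sign_vectors_def)

lemma ext_inner_axis: "ext_inner (axis S 1) w = w $ S"
proof -
  have "ext_inner (axis S 1) w = (\<Sum>T\<in>UNIV. if T = S then w $ T else 0)"
    unfolding ext_inner_def by (rule sum.cong) (auto simp: axis_def)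
  then show ?thesis by simp
qed

lemma piW_eq: "piW g w = (\<Sum>S\<in>UNIV. w $ S *s wedge_cols g S)"
  unfolding piW_def
  using sum.reindex_bij_betw[OF bij_sign_vectors, of "\<lambda>S. w $ S *s wedge_cols g S"]
  by (simp add: basis_vec_eq_axis ext_inner_axis wedge_cols_def support_list_def col_vec_def[abs_def])

lemma piW_nth: "piW g w $ I = (\<Sum>J\<in>UNIV. minor g I J * w $ J)"
  by (simp add: piW_eq minor_def mult.commute)

lemma piW_axis: "piW g (axis S 1) = wedge_cols g S"
proof -
  have "piW g (axis S 1) = (\<Sum>T\<in>UNIV. if T = S then wedge_cols g T else 0)"
    unfolding piW_eq by (rule sum.cong) (auto simp: axis_def)
  then show ?thesis by simp
qed

lemma ext_inner_piW_basis_vec: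
  "ext_inner (basis_vec \<epsilon>) (piW g (basis_vec \<epsilon>)) = minor g {i. \<epsilon> i = 1} {i. \<epsilon> i = 1}"
  by (simp add: basis_vec_eq_axis ext_inner_axis piW_axis minor_def)

lemma Delta_W_eq:
  fixes g :: "('n::{finite,linorder}) rmat"
  shows "Delta_W g = (\<Sum>J\<in>UNIV. of_nat (CARD('n) choose card J) * minor g J J)"
proof -
  have "(\<Sum>i\<in>UNIV. \<epsilon> i) = card {i. \<epsilon> i = 1}" if "\<epsilon> \<in> sign_vectors" for \<epsilon> :: "'n \<Rightarrow> nat"
  proof -
    have "(\<Sum>i\<in>UNIV. \<epsilon> i) = (\<Sum>i\<in>UNIV. if \<epsilon> i = 1 then 1 else 0)"
      using that by (intro sum.cong) (auto simp: sign_vectors_def Pi_iff)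
    then show ?thesis by (simp add: sum.If_cases)
  qed
  then have "Delta_W g = (\<Sum>\<epsilon>\<in>sign_vectors. of_nat (CARD('n) choose card {i. \<epsilon> i = 1}) *
      minor g {i. \<epsilon> i = 1} {i. \<epsilon> i = 1})"
    unfolding Delta_W_def ext_inner_piW_basis_vec by (intro sum.cong) auto
  then show ?thesis
    using sum.reindex_bij_betw[OF bij_sign_vectors,
        of "\<lambda>J. of_nat (CARD('n) choose card J) * minor g J J"] by simp
qed

section \<open>Wedging with a single vector: expansion and anticommutativity\<close>

lemma ext_vec_nth: "ext_vec x $ {i} = x $ i"
proof -
  have "ext_vec x $ {i} = (\<Sum>j\<in>UNIV. if j = i then x $ j else 0)"
    unfolding ext_vec_def by (simp add: axis_def if_distrib cong: if_cong) 
  then show ?thesis by simp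
qed

lemma ext_vec_nth_eq_0: "ext_vec x $ S = 0" if "\<nexists>i. S = {i}"
  using that unfolding ext_vec_def by (simp add: axis_def)

text \<open>A vector has coordinates only at singletons, so the shuffle sum collapses to one index
  \<open>i\<close>, whose sign counts the elements of \<open>U\<close> below it. Applied to columns
  this is the Laplace expansion.\<close>

lemma ext_vec_wedge:
  "(ext_vec x \<and>\<^sub>W w) $ U = (\<Sum>i\<in>U. (-1) ^ card {j \<in> U. j < i} * x $ i * w $ (U - {i}))"
proof -
  let ?f = "\<lambda>S. (-1) ^ card {(i, j). i \<in> S \<and> j \<in> U - S \<and> j < i} * ext_vec x $ S * w $ (U - S)"
  have card: "card {(k, j). k \<in> {i} \<and> j \<in> U - {i} \<and> j < k} = card {j \<in> U. j < i}" for i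
    by (rule bij_betw_same_card[where f = snd]) (auto simp: bij_betw_def inj_on_def image_iff)
  have "(ext_vec x \<and>\<^sub>W w) $ U = sum ?f (Pow U)"
    by (simp add: wedge_def)
  also have "\<dots> = sum ?f ((\<lambda>i. {i}) ` U)"
    by (rule sum.mono_neutral_right) (auto intro: ext_vec_nth_eq_0)
  also have "\<dots> = (\<Sum>i\<in>U. ?f {i})"
    by (subst sum.reindex) (auto simp: inj_on_def)
  also have "\<dots> = (\<Sum>i\<in>U. (-1) ^ card {j \<in> U. j < i} * x $ i * w $ (U - {i}))"
    by (simp only: card ext_vec_nth)
  finally show ?thesis .
qed

lemma ext_vec_wedge_anticomm:
  fixes w :: "('n::{finite,linorder}) ext"
  shows "ext_vec x \<and>\<^sub>W ext_vec y \<and>\<^sub>W w = - (ext_vec y \<and>\<^sub>W ext_vec x \<and>\<^sub>W w)"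
proof (subst vec_eq_iff, rule allI)
  fix U :: "'n set"
  define a :: "'n \<Rightarrow> nat" where "a i = card {j \<in> U. j < i}" for i
  \<comment> \<open>The sign for removing \<open>i\<close> from \<open>U\<close> and then
    \<open>j\<close> from the rest. Removing \<open>i\<close> shifts the position of
    \<open>j\<close> only when i < j, which makes \<open>s\<close> antisymmetric; the value 0 on the
    diagonal lets both sums run over all of \<open>U\<close>.\<close>
  define s :: "'n \<Rightarrow> 'n \<Rightarrow> complex" where
    "s i j = (if i = j then 0 else (-1) ^ (a i + a j) * (if i < j then -1 else 1))" for i j
  have less: "(-1) ^ a i * (-1) ^ card {k \<in> U - {i}. k < j} = s i j"
    if "i \<in> U" "j \<in> U - {i}" for i j
  proof (cases "i < j")
    case True
    have "{k \<in> U. k < j} = insert i {k \<in> U - {i}. k < j}"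
      using that True by auto
    then have "a j = Suc (card {k \<in> U - {i}. k < j})"
      unfolding a_def by simp
    then show ?thesis using that True by (auto simp: s_def power_add)
  next
    case False
    then have "{k \<in> U - {i}. k < j} = {k \<in> U. k < j}" by auto
    then show ?thesis using that False by (auto simp: s_def a_def power_add)
  qed
  have expand: "(ext_vec x \<and>\<^sub>W ext_vec y \<and>\<^sub>W w) $ U =
      (\<Sum>i\<in>U. \<Sum>j\<in>U. s i j * x $ i * y $ j * w $ (U - {i, j}))" for x y
  proof -
    have "(ext_vec x \<and>\<^sub>W ext_vec y \<and>\<^sub>W w) $ U = (\<Sum>i\<in>U. \<Sum>j\<in>U - {i}.
        (-1) ^ a i * (-1) ^ card {k \<in> U - {i}. k < j} * (x $ i * y $ j * w $ (U - {i} - {j})))"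
      by (simp add: ext_vec_wedge a_def sum_distrib_left mult_ac)
    also have "\<dots> = (\<Sum>i\<in>U. \<Sum>j\<in>U - {i}. s i j * (x $ i * y $ j * w $ (U - {i, j})))"
    proof (intro sum.cong refl)
      fix i j assume "i \<in> U" "j \<in> U - {i}"
      moreover have "U - {i} - {j} = U - {i, j}" by auto
      ultimately show "(-1) ^ a i * (-1) ^ card {k \<in> U - {i}. k < j} * (x $ i * y $ j * w $ (U - {i} - {j}))
          = s i j * (x $ i * y $ j * w $ (U - {i, j}))"
        by (simp only: less)
    qed
    also have "\<dots> = (\<Sum>i\<in>U. \<Sum>j\<in>U. s i j * (x $ i * y $ j * w $ (U - {i, j})))"
      by (intro sum.cong refl sum.mono_neutral_left) (auto simp: s_def)
    finally show ?thesis by (simp add: mult.assoc)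
  qed
  have anti: "s i j = - s j i" for i j
    by (auto simp: s_def add.commute)
  have "(ext_vec x \<and>\<^sub>W ext_vec y \<and>\<^sub>W w) $ U =
      (\<Sum>j\<in>U. \<Sum>i\<in>U. s i j * x $ i * y $ j * w $ (U - {i, j}))"
    unfolding expand by (rule sum.swap)
  also have "\<dots> = - (\<Sum>j\<in>U. \<Sum>i\<in>U. s j i * y $ j * x $ i * w $ (U - {j, i}))"
    unfolding sum_negf[symmetric]
    by (intro sum.cong refl) (subst anti, simp add: insert_commute mult_ac)
  finally show "(ext_vec x \<and>\<^sub>W ext_vec y \<and>\<^sub>W w) $ U = (- (ext_vec y \<and>\<^sub>W ext_vec x \<and>\<^sub>W w)) $ U"
    by (simp add: expand)
qed

lemma ext_vec_wedge_self: "ext_vec x \<and>\<^sub>W ext_vec x \<and>\<^sub>W w = 0"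
  using ext_vec_wedge_anticomm[of x x w] by (simp add: vec_eq_iff)

lemma wedge_sum_right:
  fixes u :: "('n::{finite,linorder}) ext"
  shows "u \<and>\<^sub>W (\<Sum>k\<in>A. c k *s f k) = (\<Sum>k\<in>A. c k *s (u \<and>\<^sub>W f k))"
proof (subst vec_eq_iff, rule allI)
  fix U :: "'n set"
  let ?\<sigma> = "\<lambda>S. (-1) ^ card {(i, j). i \<in> S \<and> j \<in> U - S \<and> j < i}"
  have "(u \<and>\<^sub>W (\<Sum>k\<in>A. c k *s f k)) $ U =
      (\<Sum>S\<in>Pow U. \<Sum>k\<in>A. c k * (?\<sigma> S * u $ S * f k $ (U - S)))"
    unfolding wedge_def vec_lambda_beta sum_component vector_smult_component sum_distrib_left
    by (simp only: mult_ac)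
  also have "\<dots> = (\<Sum>k\<in>A. c k *s (u \<and>\<^sub>W f k)) $ U"
    unfolding wedge_def vec_lambda_beta sum_component vector_smult_component sum_distrib_left
    by (rule sum.swap)
  finally show "(u \<and>\<^sub>W (\<Sum>k\<in>A. c k *s f k)) $ U = (\<Sum>k\<in>A. c k *s (u \<and>\<^sub>W f k)) $ U" .
qed

lemma wedge_ext_vec_sum_left:
  fixes w :: "('n::{finite,linorder}) ext"
  shows "ext_vec (\<Sum>k\<in>A. c k *s x k) \<and>\<^sub>W w = (\<Sum>k\<in>A. c k *s (ext_vec (x k) \<and>\<^sub>W w))"
proof (subst vec_eq_iff, rule allI)
  fix U :: "'n set"
  let ?\<sigma> = "\<lambda>i. (-1) ^ card {j \<in> U. j < i}"
  have "(ext_vec (\<Sum>k\<in>A. c k *s x k) \<and>\<^sub>W w) $ U =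
      (\<Sum>i\<in>U. \<Sum>k\<in>A. c k * (?\<sigma> i * x k $ i * w $ (U - {i})))"
    unfolding ext_vec_wedge sum_component vector_smult_component sum_distrib_left sum_distrib_right
    by (simp only: mult_ac)
  also have "\<dots> = (\<Sum>k\<in>A. c k *s (ext_vec (x k) \<and>\<^sub>W w)) $ U"
    unfolding ext_vec_wedge sum_component vector_smult_component sum_distrib_left
    by (rule sum.swap)
  finally show "(ext_vec (\<Sum>k\<in>A. c k *s x k) \<and>\<^sub>W w) $ U =
      (\<Sum>k\<in>A. c k *s (ext_vec (x k) \<and>\<^sub>W w)) $ U" .
qed

lemma wedge_smult_right: "u \<and>\<^sub>W c *s w = c *s (u \<and>\<^sub>W w)"
  using wedge_sum_right[of u "\<lambda>_. c" "\<lambda>_. w" "{()}"] by simp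

lemma ext_vec_smult_wedge: "ext_vec (c *s x) \<and>\<^sub>W w = c *s (ext_vec x \<and>\<^sub>W w)"
  using wedge_ext_vec_sum_left[of "\<lambda>_. c" "\<lambda>_. x" "{()}"] by simp

lemma piW_sum:
  fixes g :: "('n::{finite,linorder}) rmat"
  shows "piW g (\<Sum>k\<in>A. c k *s f k) = (\<Sum>k\<in>A. c k *s piW g (f k))"
proof (subst vec_eq_iff, rule allI)
  fix I
  have "piW g (\<Sum>k\<in>A. c k *s f k) $ I = (\<Sum>J\<in>UNIV. \<Sum>k\<in>A. c k * (minor g I J * f k $ J))"
    unfolding piW_nth sum_component vector_smult_component sum_distrib_left
    by (simp only: mult_ac)
  also have "\<dots> = (\<Sum>k\<in>A. c k *s piW g (f k)) $ I"
    unfolding piW_nth sum_component vector_smult_component sum_distrib_left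
    by (rule sum.swap)
  finally show "piW g (\<Sum>k\<in>A. c k *s f k) $ I = (\<Sum>k\<in>A. c k *s piW g (f k)) $ I" .
qed

section \<open>Functoriality of the exterior power and the Cauchy-Binet formula\<close>

lemma axis_expansion: "w = (\<Sum>S\<in>UNIV. w $ S *s axis S (1::complex))"
  using basis_expansion[of w] by simp

text \<open>An index below all others heads the sorted list. This is the recursion behind every
  induction that adds a new minimum to an index set.\<close>

lemma wedge_cols_insert:
  assumes "\<And>t. t \<in> T \<Longrightarrow> b < t"
  shows "wedge_cols g (insert b T) = ext_vec (col_vec g b) \<and>\<^sub>W wedge_cols g T"
proof -
  have "b \<notin> T"
    using assms by blast
  then have "sorted_list_of_set (insert b T) = insort b (sorted_list_of_set T)"
    by simp
  also have "\<dots> = b # sorted_list_of_set T"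
    using assms by (intro insort_is_Cons) (auto intro: less_imp_le)
  finally have "sorted_list_of_set (insert b T) = b # sorted_list_of_set T" .
  then show ?thesis by (simp add: wedge_cols_def wedge_list_def)
qed

lemma wedge_cols_empty: "wedge_cols g {} = axis {} 1"
  by (simp add: wedge_cols_def wedge_list_def ext_one_def)

lemma ext_vec_axis_wedge_axis:
  "(ext_vec (axis i 1) \<and>\<^sub>W axis T 1) $ U =
    (if i \<notin> T \<and> U = insert i T then (-1) ^ card {j \<in> T. j < i} else 0)"
proof (cases "i \<notin> T \<and> U = insert i T")
  case True
  have "(ext_vec (axis i 1) \<and>\<^sub>W axis T 1) $ U =
      (\<Sum>k\<in>U. if k = i then (-1) ^ card {j \<in> U. j < i} else 0)"
    unfolding ext_vec_wedge using True by (intro sum.cong) (auto simp: axis_def)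
  also have "\<dots> = (-1) ^ card {j \<in> T. j < i}"
    using True by (simp, intro arg_cong[where f = "\<lambda>m. (-1) ^ card m"]) auto
  finally show ?thesis using True by simp
next
  case False
  have "(ext_vec (axis i 1) \<and>\<^sub>W axis T 1) $ U = (\<Sum>k\<in>U. 0)"
    unfolding ext_vec_wedge using False by (intro sum.cong) (auto simp: axis_def)
  then show ?thesis using False by auto
qed

text \<open>\<open>piW\<close> is given on wedges of basis vectors in increasing order, so
  compatibility with the wedge product is immediate only when the new factor precedes everything in
  the support of \<open>u\<close>.\<close>

lemma piW_wedge_below:
  assumes "\<And>U t. u $ U \<noteq> 0 \<Longrightarrow> t \<in> U \<Longrightarrow> b < t"
  shows "piW g (ext_vec (axis b 1) \<and>\<^sub>W u) = ext_vec (col_vec g b) \<and>\<^sub>W piW g u"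
proof -
  have eq: "u $ U *s piW g (ext_vec (axis b 1) \<and>\<^sub>W axis U 1) = u $ U *s (ext_vec (col_vec g b) \<and>\<^sub>W wedge_cols g U)" for U
  proof (cases "u $ U = 0")
    case False
    then have U: "\<And>t. t \<in> U \<Longrightarrow> b < t" using assms by blast
    then show ?thesis
      by (simp add: ext_vec_axis wedge_axis_less piW_axis wedge_cols_insert)
  qed simp
  have "piW g (ext_vec (axis b 1) \<and>\<^sub>W u) = (\<Sum>U\<in>UNIV. u $ U *s piW g (ext_vec (axis b 1) \<and>\<^sub>W axis U 1))"
    by (subst axis_expansion[of u]) (simp only: wedge_sum_right piW_sum)
  also have "\<dots> = ext_vec (col_vec g b) \<and>\<^sub>W piW g u"
    by (simp only: eq piW_eq[of g u] wedge_sum_right)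
  finally show ?thesis .
qed

text \<open>Removes the ordering restriction. Compared with the least element \<open>b\<close> of
  the set, a smaller \<open>i\<close> can be prepended, an equal one makes both sides vanish, and a
  larger one is moved past \<open>b\<close> at the cost of a sign, after which the induction
  hypothesis applies.\<close>

lemma piW_ext_vec_axis_wedge_axis:
  "piW g (ext_vec (axis i 1) \<and>\<^sub>W axis T 1) = ext_vec (col_vec g i) \<and>\<^sub>W wedge_cols g T"
using finite[of T] proof (induction T arbitrary: i rule: finite_linorder_min_induct)
  case empty
  have "piW g (ext_vec (axis i 1) \<and>\<^sub>W axis {} 1) = ext_vec (col_vec g i) \<and>\<^sub>W piW g (axis {} 1)"
    by (rule piW_wedge_below) (auto simp: axis_def split: if_splits)
  then show ?case by (simp add: piW_axis)
next
  case (insert b T)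
  have bT: "axis (insert b T) 1 = ext_vec (axis b 1) \<and>\<^sub>W axis T 1"
    using insert by (simp add: ext_vec_axis wedge_axis_less)
  have colT: "wedge_cols g (insert b T) = ext_vec (col_vec g b) \<and>\<^sub>W wedge_cols g T"
    using insert by (simp add: wedge_cols_insert)
  consider "i < b" | "i = b" | "b < i" by force
  then show ?case
  proof cases
    case 1
    then show ?thesis using insert
      by (subst piW_wedge_below) (auto simp: axis_def piW_axis[unfolded axis_def] split: if_splits)
  next
    case 2
    have "piW g (0::'a ext) = 0"
      by (simp add: piW_eq)
    then show ?thesis using 2 by (simp add: bT colT ext_vec_wedge_self)
  next
    case 3
    have neg: "piW g (- u) = - piW g u" for u
      by (simp add: piW_eq vec_eq_iff sum_negf)
    have "piW g (ext_vec (axis i 1) \<and>\<^sub>W axis (insert b T) 1) =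
        - piW g (ext_vec (axis b 1) \<and>\<^sub>W ext_vec (axis i 1) \<and>\<^sub>W axis T 1)"
      unfolding bT by (subst ext_vec_wedge_anticomm) (rule neg)
    also have "\<dots> = - (ext_vec (col_vec g b) \<and>\<^sub>W piW g (ext_vec (axis i 1) \<and>\<^sub>W axis T 1))"
      using insert 3 by (subst piW_wedge_below) (auto simp: ext_vec_axis_wedge_axis split: if_splits)
    also have "\<dots> = - (ext_vec (col_vec g b) \<and>\<^sub>W ext_vec (col_vec g i) \<and>\<^sub>W wedge_cols g T)"
      by (simp add: insert)
    also have "\<dots> = ext_vec (col_vec g i) \<and>\<^sub>W wedge_cols g (insert b T)"
      unfolding colT by (subst ext_vec_wedge_anticomm) simp
    finally show ?thesis .
  qed
qed

lemma piW_ext_vec_wedge: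
  "piW g (ext_vec x \<and>\<^sub>W w) = ext_vec (\<Sum>i\<in>UNIV. x $ i *s col_vec g i) \<and>\<^sub>W piW g w"
proof -
  have "piW g (ext_vec x \<and>\<^sub>W w) = piW g (ext_vec (\<Sum>i\<in>UNIV. x $ i *s axis i 1) \<and>\<^sub>W (\<Sum>S\<in>UNIV. w $ S *s axis S 1))"
    using basis_expansion[of x] axis_expansion[of w] by simp
  also have "\<dots> = (\<Sum>S\<in>UNIV. w $ S *s (\<Sum>i\<in>UNIV. x $ i *s (ext_vec (col_vec g i) \<and>\<^sub>W wedge_cols g S)))"
    unfolding wedge_sum_right wedge_ext_vec_sum_left piW_sum piW_ext_vec_axis_wedge_axis ..
  also have "\<dots> = ext_vec (\<Sum>i\<in>UNIV. x $ i *s col_vec g i) \<and>\<^sub>W piW g w"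
    unfolding piW_eq wedge_sum_right wedge_ext_vec_sum_left ..
  finally show ?thesis .
qed

lemma col_vec_mult: "col_vec (g ** h) b = (\<Sum>i\<in>UNIV. col_vec h b $ i *s col_vec g i)"
  by (simp add: col_vec_def matrix_matrix_mult_def vec_eq_iff mult.commute)

lemma wedge_cols_mult: "wedge_cols (g ** h) S = piW g (wedge_cols h S)"
using finite[of S] proof (induction S rule: finite_linorder_min_induct)
  case empty
  then show ?case by (simp add: wedge_cols_empty piW_axis)
next
  case (insert b S)
  then show ?case
    by (simp add: wedge_cols_insert piW_ext_vec_wedge col_vec_mult)
qed

text \<open>Cauchy-Binet, as the coordinate form of the functoriality in
  \<open>wedge_cols_mult\<close>.\<close>

lemma minor_mult: "minor (g ** h) I J = (\<Sum>K\<in>UNIV. minor g I K * minor h K J)"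
  unfolding minor_def[of "g ** h"] wedge_cols_mult piW_nth by (simp add: minor_def)

lemma wedge_cols_nth_card: "wedge_cols g S $ U \<noteq> 0 \<Longrightarrow> card U = card S"
using finite[of S] proof (induction S arbitrary: U rule: finite_linorder_min_induct)
  case empty
  then show ?case by (auto simp: wedge_cols_empty axis_def split: if_splits)
next
  case (insert b S)
  then have "(\<Sum>i\<in>U. (-1) ^ card {j \<in> U. j < i} * col_vec g b $ i * wedge_cols g S $ (U - {i})) \<noteq> 0"
    by (simp add: wedge_cols_insert ext_vec_wedge)
  then obtain i where "i \<in> U" "wedge_cols g S $ (U - {i}) \<noteq> 0"
    by (metis (no_types, lifting) mult_zero_right sum.neutral)
  moreover have "b \<notin> S" using insert by auto
  ultimately show ?case using insert by (metis card_Suc_Diff1 card_insert_disjoint finite)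
qed

lemma minor_eq_0: "card I \<noteq> card J \<Longrightarrow> minor g I J = 0"
  using wedge_cols_nth_card[of g J I] by (auto simp: minor_def)

section \<open>Minors of diagonal and permutation matrices\<close>

definition diag_mat :: "('n::finite \<Rightarrow> real) \<Rightarrow> 'n rmat" where
  "diag_mat d = (\<chi> i j. if i = j then d i else 0)"

definition perm_mat :: "('n::finite \<Rightarrow> 'n) \<Rightarrow> 'n rmat" where
  "perm_mat \<sigma> = (\<chi> i j. if i = \<sigma> j then 1 else 0)"

lemma wedge_cols_diag: "wedge_cols (diag_mat d) S = (\<Prod>i\<in>S. of_real (d i)) *s axis S 1"
using finite[of S] proof (induction S rule: finite_linorder_min_induct)
  case empty
  then show ?case by (simp add: wedge_cols_empty)
next
  case (insert b S)
  have "col_vec (diag_mat d) b = of_real (d b) *s axis b 1"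
    by (auto simp: col_vec_def diag_mat_def axis_def vec_eq_iff)
  moreover have "b \<notin> S" using insert by auto
  moreover have "ext_vec (axis b 1) \<and>\<^sub>W axis S 1 = axis (insert b S) 1"
    using insert by (simp add: ext_vec_axis wedge_axis_less)
  ultimately show ?case using insert
    by (simp add: wedge_cols_insert ext_vec_smult_wedge wedge_smult_right vector_smult_assoc mult.commute)
qed

lemma minor_diag_mult: "minor (diag_mat d ** g) I J = (\<Prod>i\<in>I. of_real (d i)) * minor g I J"
proof -
  have "minor (diag_mat d ** g) I J = (\<Sum>K\<in>UNIV. if K = I then (\<Prod>i\<in>I. of_real (d i)) * minor g I J else 0)"
    unfolding minor_mult by (rule sum.cong) (auto simp: minor_def wedge_cols_diag axis_def)
  then show ?thesis by simp
qed

lemma minor_mult_diag: "minor (g ** diag_mat d) I J = minor g I J * (\<Prod>i\<in>J. of_real (d i))"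
proof -
  have "minor (g ** diag_mat d) I J = (\<Sum>K\<in>UNIV. if K = J then minor g I J * (\<Prod>i\<in>J. of_real (d i)) else 0)"
    unfolding minor_mult by (rule sum.cong) (auto simp: minor_def wedge_cols_diag axis_def)
  then show ?thesis by simp
qed

lemma minor_one: "minor (mat 1) I J = (if I = J then 1 else 0)"
proof -
  have "(mat 1 :: 'a rmat) = diag_mat (\<lambda>_. 1)"
    by (simp add: mat_def diag_mat_def)
  then show ?thesis by (simp add: minor_def wedge_cols_diag axis_def)
qed

text \<open>Permuting basis vectors permutes their wedges up to sign, so the exterior power is a
  signed permutation matrix on index sets. The signs \<eta> need not be computed, because they only
  ever enter squared.\<close>

lemma minor_perm_mat:
  assumes "inj \<sigma>"
  obtains \<eta> where "\<And>J. \<eta> J = 1 \<or> \<eta> J = -1"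
    "\<And>I J. minor (perm_mat \<sigma>) I J = (if I = \<sigma> ` J then \<eta> J else 0)"
proof -
  have "\<exists>\<eta>. (\<eta> = 1 \<or> \<eta> = -1) \<and> wedge_cols (perm_mat \<sigma>) J = \<eta> *s axis (\<sigma> ` J) 1" for J
  using finite[of J] proof (induction J rule: finite_linorder_min_induct)
    case empty
    then show ?case by (auto simp: wedge_cols_empty)
  next
    case (insert b J)
    then obtain \<eta> where \<eta>: "\<eta> = 1 \<or> \<eta> = -1" "wedge_cols (perm_mat \<sigma>) J = \<eta> *s axis (\<sigma> ` J) 1"
      by auto
    define e :: complex where "e = (-1) ^ card {j \<in> \<sigma> ` J. j < \<sigma> b}"
    have e: "e = 1 \<or> e = -1"
      by (simp add: e_def minus_one_power_iff)
    have "col_vec (perm_mat \<sigma>) b = axis (\<sigma> b) 1"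
      by (auto simp: col_vec_def perm_mat_def axis_def vec_eq_iff)
    moreover have "\<sigma> b \<notin> \<sigma> ` J" using insert assms by (auto dest: injD)
    then have "ext_vec (axis (\<sigma> b) 1) \<and>\<^sub>W axis (\<sigma> ` J) 1 = e *s axis (\<sigma> ` insert b J) 1"
      unfolding vec_eq_iff ext_vec_axis_wedge_axis by (auto simp: e_def axis_def)
    ultimately have "wedge_cols (perm_mat \<sigma>) (insert b J) = (\<eta> * e) *s axis (\<sigma> ` insert b J) 1"
      using insert \<eta>
      by (simp add: wedge_cols_insert wedge_smult_right vector_smult_assoc)
    then show ?case using e \<eta>(1) by (intro exI[of _ "\<eta> * e"]) auto
  qed
  then obtain \<eta> where "\<And>J. (\<eta> J = 1 \<or> \<eta> J = -1) \<and> wedge_cols (perm_mat \<sigma>) J = \<eta> J *s axis (\<sigma> ` J) 1"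
    by metis
  then show ?thesis by (intro that[of \<eta>]) (auto simp: minor_def axis_def)
qed

section \<open>Averaging over signed permutations\<close>

lemma minor_lower_triangular:
  fixes L :: "('n::{finite,linorder}) rmat"
  assumes "\<And>i j. i < j \<Longrightarrow> L $ i $ j = 0"
  shows "minor L I I = (\<Prod>i\<in>I. of_real (L $ i $ i))"
proof -
  \<comment> \<open>The columns of \<open>L\<close> vanish above the diagonal, so every row index of
    a nonzero coordinate lies above some column index.\<close>
  have supp: "\<exists>s\<in>S. s \<le> u" if "wedge_cols L S $ U \<noteq> 0" "u \<in> U" for S U and u :: 'n
    using finite[of S] that
  proof (induction S arbitrary: U rule: finite_linorder_min_induct)
    case empty
    then show ?case by (auto simp: wedge_cols_empty axis_def split: if_splits)
  next
    case (insert b S)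
    then have "(\<Sum>i\<in>U. (-1) ^ card {j \<in> U. j < i} * col_vec L b $ i * wedge_cols L S $ (U - {i})) \<noteq> 0"
      by (simp add: wedge_cols_insert ext_vec_wedge)
    then obtain i where i: "i \<in> U" "col_vec L b $ i \<noteq> 0" "wedge_cols L S $ (U - {i}) \<noteq> 0"
      by (metis (no_types, lifting) mult_zero_left mult_zero_right sum.neutral)
    then have "b \<le> i"
      using assms[of i b] by (force simp: col_vec_def)
    then show ?case
      using insert i by (cases "u = i") auto
  qed
  show ?thesis
    using finite[of I]
  proof (induction I rule: finite_linorder_min_induct)
    case empty
    then show ?case by (simp add: minor_def wedge_cols_empty)
  next
    case (insert b S)
    have b: "b \<notin> S" using insert by auto
    have empty: "{j. (j = b \<or> j \<in> S) \<and> j < b} = {}"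
      using insert by auto
    \<comment> \<open>In the expansion along column \<open>b\<close> only the row \<open>b\<close>
      survives: any other choice leaves \<open>b\<close> among the rows, while all columns in
      \<open>S\<close> have larger index.\<close>
    have "wedge_cols L S $ (insert b S - {i}) = 0" if "i \<in> S" for i
    proof (rule ccontr)
      assume "wedge_cols L S $ (insert b S - {i}) \<noteq> 0"
      moreover have "b \<in> insert b S - {i}" using that b by auto
      ultimately obtain s where "s \<in> S" "s \<le> b" using supp by blast
      then show False using insert by fastforce
    qed
    then have "(\<Sum>i\<in>S. (-1) ^ card {j \<in> insert b S. j < i} * col_vec L b $ i *
        wedge_cols L S $ (insert b S - {i})) = 0"
      by (intro sum.neutral) auto
    then have "minor L (insert b S) (insert b S) = col_vec L b $ b * minor L S S"
      using insert b by (simp add: minor_def wedge_cols_insert ext_vec_wedge empty)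
    then show ?case using insert b by (simp add: col_vec_def)
  qed
qed

text \<open>A crude bound from the Laplace expansion. Polynomial growth is all that is needed
  against a Gaussian.\<close>

lemma norm_minor_le:
  fixes g :: "('n::{finite,linorder}) rmat"
  assumes "\<And>i j. \<bar>g $ i $ j\<bar> \<le> B"
  shows "norm (minor g I J) \<le> (real CARD('n) * B) ^ card J"
proof -
  have B: "0 \<le> B" using assms[of undefined undefined] by linarith
  show ?thesis
    unfolding minor_def using finite[of J]
  proof (induction J arbitrary: I rule: finite_linorder_min_induct)
    case empty
    then show ?case by (simp add: wedge_cols_empty axis_def)
  next
    case (insert b S)
    have "norm (wedge_cols g (insert b S) $ I) \<le>
        (\<Sum>i\<in>I. norm ((-1) ^ card {j \<in> I. j < i} * col_vec g b $ i * wedge_cols g S $ (I - {i})))"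
      using insert by (simp add: wedge_cols_insert ext_vec_wedge norm_sum)
    also have "\<dots> \<le> (\<Sum>i\<in>I. B * (real CARD('n) * B) ^ card S)"
      using insert assms B
      by (intro sum_mono) (auto simp: norm_mult norm_power col_vec_def intro!: mult_mono)
    also have "\<dots> \<le> real CARD('n) * (B * (real CARD('n) * B) ^ card S)"
      using B by (simp, intro mult_right_mono) (auto intro: card_mono)
    also have "\<dots> = (real CARD('n) * B) ^ card (insert b S)"
      using insert by (subst card_insert_disjoint) auto
    finally show ?case .
  qed
qed

lemma continuous_on_minor: "continuous_on S (\<lambda>g. minor g I J)"
  for S :: "('n::{finite,linorder}) rmat set"
  unfolding minor_def using finite[of J]
proof (induction J arbitrary: I rule: finite_linorder_min_induct)
  case empty
  then show ?case by (simp add: wedge_cols_empty)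
next
  case (insert b J)
  have "continuous_on S (\<lambda>g. \<Sum>i\<in>I. (-1) ^ card {j \<in> I. j < i} * col_vec g b $ i * wedge_cols g J $ (I - {i}))"
    unfolding col_vec_def vec_lambda_beta by (intro continuous_intros insert)
  then show ?case using insert by (simp add: wedge_cols_insert ext_vec_wedge)
qed

lemma borel_measurable_minor [measurable]: "(\<lambda>g. minor g I J) \<in> borel_measurable borel"
  by (intro borel_measurable_continuous_onI continuous_on_minor)

lemma continuous_on_Delta_W: "continuous_on S (Delta_W :: ('n::{finite,linorder}) rmat \<Rightarrow> complex)"
  unfolding Delta_W_eq[abs_def] by (intro continuous_intros continuous_on_minor)

lemma borel_measurable_Delta_W [measurable]: "Delta_W \<in> borel_measurable borel"
  by (intro borel_measurable_continuous_onI continuous_on_Delta_W)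

section \<open>Orthogonality relations for sign changes and permutations\<close>

definition signs :: "('n \<Rightarrow> real) set" where
  "signs = UNIV \<rightarrow>\<^sub>E {1, -1}"

lemma finite_signs [simp]: "finite (signs :: ('n::finite \<Rightarrow> real) set)"
  unfolding signs_def by (intro finite_PiE) auto

lemma card_signs: "card (signs :: ('n::finite \<Rightarrow> real) set) = 2 ^ CARD('n)"
  by (simp add: signs_def card_PiE numeral_2_eq_2)

text \<open>Products over subsets are the characters of the group of sign vectors, and distinct
  characters are orthogonal.\<close>

lemma sum_signs:
  fixes K P :: "'n::finite set"
  shows "(\<Sum>d\<in>signs. (\<Prod>i\<in>K. of_real (d i)) * (\<Prod>i\<in>P. of_real (d i))) =
    (if K = P then 2 ^ CARD('n) else 0 :: complex)"
proof -
  define f :: "'n \<Rightarrow> real \<Rightarrow> complex" where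
    "f i x = (if i \<in> K then of_real x else 1) * (if i \<in> P then of_real x else 1)" for i x
  have "(\<Sum>d\<in>signs. (\<Prod>i\<in>K. of_real (d i)) * (\<Prod>i\<in>P. of_real (d i))) = (\<Sum>d\<in>signs. \<Prod>i\<in>UNIV. f i (d i))"
    unfolding f_def prod.distrib by (simp add: prod.If_cases)
  also have "\<dots> = (\<Prod>i\<in>UNIV. \<Sum>x\<in>{1, -1}. f i x)"
    unfolding signs_def by (subst prod_sum_PiE) auto
  also have "\<dots> = (\<Prod>i\<in>UNIV. if i \<in> K \<longleftrightarrow> i \<in> P then 2 else 0)"
    by (intro prod.cong) (auto simp: f_def)
  also have "\<dots> = (if K = P then 2 ^ CARD('n) else 0)"
    by (auto simp: prod_zero_iff)
  finally show ?thesis .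
qed

text \<open>Composition with a bijection that carries one target set to another is injective, so all
  targets of the same size are hit equally often. There are as many targets as the binomial
  coefficient says, and together they account for all permutations.\<close>

lemma card_bij_image_eq:
  fixes I K :: "'n::finite set"
  assumes "card I = card K"
  shows "card {\<sigma>. bij \<sigma> \<and> \<sigma> ` I = K} * (CARD('n) choose card I) = fact CARD('n)"
proof -
  define N :: "'n set \<Rightarrow> nat" where "N K = card {\<sigma>. bij \<sigma> \<and> \<sigma> ` I = K}" for K
  have le: "N K1 \<le> N K2" if "card K1 = card K2" for K1 K2 :: "'n set"
  proof -
    have "card (- K1) = card (- K2)"
      using that by (simp add: Compl_eq_Diff_UNIV card_Diff_subset)
    with that obtain f1 f2 where f: "bij_betw f1 K1 K2" "bij_betw f2 (- K1) (- K2)"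
      by (metis finite finite_same_card_bij)
    define \<tau> where "\<tau> x = (if x \<in> K1 then f1 x else f2 x)" for x
    have "bij_betw \<tau> K1 K2 \<longleftrightarrow> bij_betw f1 K1 K2"
      by (rule bij_betw_cong) (simp add: \<tau>_def)
    moreover have "bij_betw \<tau> (- K1) (- K2) \<longleftrightarrow> bij_betw f2 (- K1) (- K2)"
      by (rule bij_betw_cong) (simp add: \<tau>_def)
    ultimately have "bij_betw \<tau> K1 K2" "bij_betw \<tau> (- K1) (- K2)"
      using f by blast+
    then have \<tau>: "bij \<tau>" "\<tau> ` K1 = K2"
      using bij_betw_combine[of \<tau> K1 K2 "- K1" "- K2"] by (auto simp: bij_betw_def Compl_partition)
    show ?thesis
      unfolding N_def
    proof (rule card_inj_on_le[where f = "\<lambda>\<sigma>. \<tau> \<circ> \<sigma>"])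
      show "inj_on (\<lambda>\<sigma>. \<tau> \<circ> \<sigma>) {\<sigma>. bij \<sigma> \<and> \<sigma> ` I = K1}"
        using \<tau>(1) by (auto simp: inj_on_def fun_eq_iff dest: bij_is_inj[THEN injD])
    qed (use \<tau> in \<open>auto simp: image_comp[symmetric] intro: bij_comp\<close>)
  qed
  have eq: "N K' = N K" if "card K' = card K" for K'
    using le[of K K'] le[of K' K] that by simp
  have "fact CARD('n) = card {\<sigma>. \<sigma> permutes (UNIV :: 'n set)}"
    by (subst card_permutations) auto
  also have "{\<sigma>. \<sigma> permutes (UNIV :: 'n set)} = (\<Union>K'\<in>{K'. card K' = card K}. {\<sigma>. bij \<sigma> \<and> \<sigma> ` I = K'})"
    using assms by (auto simp: permutes_univ bij_iff card_image[OF inj_on_subset[OF bij_is_inj]])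
  also have "card \<dots> = (\<Sum>K'\<in>{K'. card K' = card K}. N K')"
    unfolding N_def by (rule card_UN_disjoint) auto
  also have "\<dots> = card {K' :: 'n set. card K' = card K} * N K"
    by (subst sum.cong[OF refl eq]) auto
  also have "card {K' :: 'n set. card K' = card K} = CARD('n) choose card I"
    unfolding assms using n_subsets[of "UNIV :: 'n set" "card K"] by simp
  finally show ?thesis by (simp add: N_def mult.commute)
qed

lemma transpose_diag_mat [simp]: "transpose (diag_mat d) = diag_mat d"
  by (auto simp: diag_mat_def transpose_def vec_eq_iff)

lemma transpose_perm_mat_mult: "inj \<sigma> \<Longrightarrow> transpose (perm_mat \<sigma>) ** perm_mat \<sigma> = mat 1"
proof -
  assume "inj \<sigma>"
  have "(\<Sum>k\<in>UNIV. perm_mat \<sigma> $ k $ i * perm_mat \<sigma> $ k $ j) = (if i = j then 1 else 0)" for i j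
  proof -
    have "(\<Sum>k\<in>UNIV. perm_mat \<sigma> $ k $ i * perm_mat \<sigma> $ k $ j) =
        (\<Sum>k\<in>UNIV. if k = \<sigma> i then (if i = j then 1 else 0) else 0)"
      using \<open>inj \<sigma>\<close> by (intro sum.cong) (auto simp: perm_mat_def dest: injD)
    then show ?thesis by simp
  qed
  then show ?thesis
    by (simp add: matrix_matrix_mult_def transpose_def vec_eq_iff mat_def)
qed

text \<open>The transpose of a permutation matrix is its inverse, and the same is true of the signed
  permutation matrix formed by its minors. The transposition rule for arbitrary minors is thereby
  avoided.\<close>

lemma minor_transpose_perm_mat:
  assumes "bij \<sigma>"
  shows "minor (transpose (perm_mat \<sigma>)) I K = minor (perm_mat \<sigma>) K I"
proof -
  obtain \<eta> where \<eta>: "\<And>J. \<eta> J = 1 \<or> \<eta> J = -1"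
    "\<And>I J. minor (perm_mat \<sigma>) I J = (if I = \<sigma> ` J then \<eta> J else 0)"
    using minor_perm_mat[OF bij_is_inj[OF assms]] by blast
  have inj: "\<sigma> ` A = \<sigma> ` B \<longleftrightarrow> A = B" for A B
    using bij_is_inj[OF assms] by (rule inj_image_eq_iff)
  obtain J where J: "K = \<sigma> ` J"
    using bij_is_surj[OF assms] by (metis subset_UNIV subset_imageE)
  have "(if I = J then 1 else 0) = minor (transpose (perm_mat \<sigma>) ** perm_mat \<sigma>) I J"
    by (simp add: transpose_perm_mat_mult bij_is_inj[OF assms] minor_one)
  also have "\<dots> = (\<Sum>M\<in>UNIV. if M = K then minor (transpose (perm_mat \<sigma>)) I K * \<eta> J else 0)"
    unfolding minor_mult J by (rule sum.cong) (auto simp: \<eta>(2))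
  finally show ?thesis
    using \<eta>(1)[of J] by (auto simp: \<eta>(2) J inj minus_equation_iff[of _ 1] split: if_splits)
qed

text \<open>Schur orthogonality restricted to a fixed row set \<open>K\<close>: both factors are
  nonzero only if \<sigma> maps \<open>J\<close> and \<open>I\<close> to \<open>K\<close>, which
  forces J = I, and then the signs cancel. The binomial coefficient is the dimension of the exterior
  power and completes the count to a factorial.\<close>

lemma sum_minor_perm_mat:
  fixes I J K :: "('n::{finite,linorder}) set"
  shows "of_nat (CARD('n) choose card I) *
      (\<Sum>\<sigma> | bij \<sigma>. minor (perm_mat \<sigma>) K J * minor (perm_mat \<sigma>) K I) =
    (if J = I \<and> card K = card I then fact CARD('n) else 0)"
proof -
  have "minor (perm_mat \<sigma>) K J * minor (perm_mat \<sigma>) K I = (if \<sigma> ` I = K then (if J = I then 1 else 0) else 0)"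
    if bij: "bij \<sigma>" for \<sigma>
  proof -
    obtain \<eta> where \<eta>: "\<And>J. \<eta> J = 1 \<or> \<eta> J = -1"
      "\<And>I J. minor (perm_mat \<sigma>) I J = (if I = \<sigma> ` J then \<eta> J else 0)"
      using minor_perm_mat[OF bij_is_inj[OF bij]] by blast
    show ?thesis
      using \<eta>(1)[of I] by (auto simp: \<eta>(2) inj_image_eq_iff[OF bij_is_inj[OF bij]])
  qed
  then have "(\<Sum>\<sigma> | bij \<sigma>. minor (perm_mat \<sigma>) K J * minor (perm_mat \<sigma>) K I) =
      (\<Sum>\<sigma> | bij \<sigma>. if \<sigma> ` I = K then (if J = I then 1 else 0) else 0)"
    by (intro sum.cong) auto
  also have "\<dots> = of_nat (card {\<sigma>. bij \<sigma> \<and> \<sigma> ` I = K}) * (if J = I then 1 else 0)"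
    by (subst sum.If_cases) (auto simp: Int_def)
  finally have eq: "(\<Sum>\<sigma> | bij \<sigma>. minor (perm_mat \<sigma>) K J * minor (perm_mat \<sigma>) K I) =
    of_nat (card {\<sigma>. bij \<sigma> \<and> \<sigma> ` I = K}) * (if J = I then 1 else 0)" .
  show ?thesis
  proof (cases "card K = card I")
    case True
    then have "of_nat (card {\<sigma>. bij \<sigma> \<and> \<sigma> ` I = K}) * of_nat (CARD('n) choose card I) = (fact CARD('n) :: complex)"
      using card_bij_image_eq[of I K] by (simp flip: of_nat_mult)
    then show ?thesis using True unfolding eq by (simp add: mult.commute)
  next
    case False
    then have "{\<sigma>. bij \<sigma> \<and> \<sigma> ` I = K} = {}"
      by (auto simp: card_image[OF inj_on_subset[OF bij_is_inj]])
    then show ?thesis using False by (simp only: eq) simp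
  qed
qed

text \<open>The sum over signs forces the two intermediate index sets to agree, the sum over
  permutations forces J = I, and what remains is the Cauchy-Binet sum for \<open>A ** C\<close>. The
  coefficients of \<open>Delta_W\<close> are precisely those that make the constant independent of
  \<open>I\<close>.\<close>

lemma sum_signed_perm_Delta_W:
  fixes A C :: "('n::{finite,linorder}) rmat"
  shows "(\<Sum>d\<in>signs. \<Sum>\<sigma> | bij \<sigma>. Delta_W (A ** (diag_mat d ** perm_mat \<sigma>)) *
      minor (transpose (diag_mat d ** perm_mat \<sigma>) ** C) I I) =
    2 ^ CARD('n) * fact CARD('n) * minor (A ** C) I I"
proof -
  let ?c = "\<lambda>J :: 'n set. of_nat (CARD('n) choose card J) :: complex"
  let ?d = "\<lambda>d K. \<Prod>i\<in>K. complex_of_real (d i)"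
  let ?p = "\<lambda>\<sigma>. minor (perm_mat \<sigma>)"
  have Delta: "Delta_W (A ** (diag_mat d ** perm_mat \<sigma>)) =
      (\<Sum>J\<in>UNIV. \<Sum>K\<in>UNIV. ?c J * minor A J K * ?d d K * ?p \<sigma> K J)" for d \<sigma>
    by (simp add: Delta_W_eq minor_mult[of A] minor_diag_mult sum_distrib_left mult.assoc)
  have min: "minor (transpose (diag_mat d ** perm_mat \<sigma>) ** C) I I =
      (\<Sum>P\<in>UNIV. ?d d P * ?p \<sigma> P I * minor C P I)" if "bij \<sigma>" for d \<sigma>
  proof -
    have "transpose (diag_mat d ** perm_mat \<sigma>) ** C = transpose (perm_mat \<sigma>) ** (diag_mat d ** C)"
      by (simp add: matrix_transpose_mul matrix_mul_assoc)
    then show ?thesis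
      by (simp add: minor_mult[of "transpose (perm_mat \<sigma>)"] minor_diag_mult
          minor_transpose_perm_mat that mult_ac)
  qed
  have "(\<Sum>d\<in>signs. \<Sum>\<sigma> | bij \<sigma>. Delta_W (A ** (diag_mat d ** perm_mat \<sigma>)) *
      minor (transpose (diag_mat d ** perm_mat \<sigma>) ** C) I I) =
    (\<Sum>d\<in>signs. \<Sum>\<sigma> | bij \<sigma>. \<Sum>J\<in>UNIV. \<Sum>K\<in>UNIV. \<Sum>P\<in>UNIV.
      (?c J * minor A J K * minor C P I) * ((?d d K * ?d d P) * (?p \<sigma> K J * ?p \<sigma> P I)))"
    by (intro sum.cong refl)
      (simp add: Delta min sum_distrib_left sum_distrib_right mult_ac)
  also have "\<dots> = (\<Sum>J\<in>UNIV. \<Sum>K\<in>UNIV. \<Sum>P\<in>UNIV. \<Sum>d\<in>signs. \<Sum>\<sigma> | bij \<sigma>.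
      (?c J * minor A J K * minor C P I) * ((?d d K * ?d d P) * (?p \<sigma> K J * ?p \<sigma> P I)))"
    by (simp only: sum.swap[of _ "{\<sigma>. bij \<sigma>}" UNIV] sum.swap[of _ signs UNIV])
  also have "\<dots> = (\<Sum>J\<in>UNIV. \<Sum>K\<in>UNIV. \<Sum>P\<in>UNIV.
      (?c J * minor A J K * minor C P I) * ((if K = P then 2 ^ CARD('n) else 0) *
        (\<Sum>\<sigma> | bij \<sigma>. ?p \<sigma> K J * ?p \<sigma> P I)))"
    by (intro sum.cong refl) (simp only: sum_signs[symmetric] sum_distrib_left[symmetric] sum_distrib_right[symmetric])
  also have "\<dots> = (\<Sum>J\<in>UNIV. \<Sum>K\<in>UNIV. \<Sum>P\<in>UNIV. if P = K then
      2 ^ CARD('n) * (minor A J K * minor C K I) * (?c J * (\<Sum>\<sigma> | bij \<sigma>. ?p \<sigma> K J * ?p \<sigma> K I)) else 0)"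
    by (intro sum.cong refl) auto
  also have "\<dots> = (\<Sum>J\<in>UNIV. \<Sum>K\<in>UNIV.
      2 ^ CARD('n) * (minor A J K * minor C K I) * (?c J * (\<Sum>\<sigma> | bij \<sigma>. ?p \<sigma> K J * ?p \<sigma> K I)))"
    by simp
  also have "\<dots> = (\<Sum>J\<in>UNIV. \<Sum>K\<in>UNIV. if J = I then
      2 ^ CARD('n) * fact CARD('n) * (minor A I K * minor C K I) else 0)"
  proof (intro sum.cong refl)
    fix J K
    have "?c J * (\<Sum>\<sigma> | bij \<sigma>. ?p \<sigma> K J * ?p \<sigma> K I) = (if J = I \<and> card K = card I then fact CARD('n) else 0)"
      using sum_minor_perm_mat[of J K I] by (auto simp: mult.commute)
    then show "2 ^ CARD('n) * (minor A J K * minor C K I) * (?c J * (\<Sum>\<sigma> | bij \<sigma>. ?p \<sigma> K J * ?p \<sigma> K I)) =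
        (if J = I then 2 ^ CARD('n) * fact CARD('n) * (minor A I K * minor C K I) else 0)"
      \<comment> \<open>Row sets of the wrong size, excluded by the orthogonality relation,
        contribute nothing on the other side either.\<close>
      using minor_eq_0[of K I C] by auto
  qed
  also have "\<dots> = 2 ^ CARD('n) * fact CARD('n) * minor (A ** C) I I"
    by (subst sum.swap) (simp add: minor_mult sum_distrib_left)
  finally show ?thesis .
qed

text \<open>Conjugation by signs multiplies the minor of \<open>L\<close> with rows \<open>K\<close>
  and columns \<open>I\<close> by the product of two characters, so the sum keeps only K =
  I.\<close>

lemma sum_signs_minor_conj:
  fixes k L :: "('n::{finite,linorder}) rmat"
  shows "(\<Sum>d\<in>signs. minor (k ** diag_mat d ** L ** diag_mat d) I I) = 2 ^ CARD('n) * (minor k I I * minor L I I)"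
proof -
  let ?d = "\<lambda>d K. \<Prod>i\<in>K. complex_of_real (d i)"
  have "(\<Sum>d\<in>signs. minor (k ** diag_mat d ** L ** diag_mat d) I I) =
      (\<Sum>d\<in>signs. \<Sum>K\<in>UNIV. (minor k I K * minor L K I) * (?d d K * ?d d I))"
    by (intro sum.cong refl)
      (simp add: minor_mult_diag minor_mult[of _ L] sum_distrib_left sum_distrib_right mult_ac)
  also have "\<dots> = (\<Sum>K\<in>UNIV. (minor k I K * minor L K I) * (if K = I then 2 ^ CARD('n) else 0))"
    by (subst sum.swap) (simp only: sum_signs[symmetric] sum_distrib_left)
  also have "\<dots> = (\<Sum>K\<in>UNIV. if K = I then 2 ^ CARD('n) * (minor k I I * minor L I I) else 0)"
    by (intro sum.cong) auto
  finally show ?thesis by simp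
qed

text \<open>The inner average multiplies the matrix inside \<open>Delta_W\<close> by the one inside
  the minor, and \<open>q\<close> meets its transpose there. The orthogonal part disappears and the
  outer average acts on \<open>L\<close> alone.\<close>

lemma sum_Delta_W_minor:
  fixes k L q :: "('n::{finite,linorder}) rmat"
  assumes "orthogonal_matrix q"
  shows "(\<Sum>d\<in>signs. \<Sum>d'\<in>signs. \<Sum>\<sigma> | bij \<sigma>.
      Delta_W (k ** (diag_mat d ** (L ** q) ** (diag_mat d' ** perm_mat \<sigma>))) *
      minor (transpose (diag_mat d ** q ** (diag_mat d' ** perm_mat \<sigma>))) I I) =
    (2 ^ CARD('n)) ^ 2 * fact CARD('n) * (minor k I I * minor L I I)"
proof -
  have q: "q ** transpose q = mat 1"
    using assms by (simp add: orthogonal_matrix_def)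
  have "(\<Sum>d'\<in>signs. \<Sum>\<sigma> | bij \<sigma>.
      Delta_W (k ** (diag_mat d ** (L ** q) ** (diag_mat d' ** perm_mat \<sigma>))) *
      minor (transpose (diag_mat d ** q ** (diag_mat d' ** perm_mat \<sigma>))) I I) =
    2 ^ CARD('n) * fact CARD('n) * minor (k ** diag_mat d ** L ** diag_mat d) I I" for d
  proof -
    have "k ** diag_mat d ** (L ** q) ** (transpose q ** diag_mat d) =
        k ** diag_mat d ** L ** (q ** transpose q) ** diag_mat d"
      by (simp only: matrix_mul_assoc)
    then show ?thesis
      using sum_signed_perm_Delta_W[of "k ** diag_mat d ** (L ** q)" "transpose q ** diag_mat d" I]
      by (simp add: q matrix_transpose_mul matrix_mul_assoc)
  qed
  then show ?thesis
    by (simp add: sum_distrib_left[symmetric] sum_signs_minor_conj power2_eq_square)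
qed

section \<open>Gram-Schmidt orthogonalization of the rows\<close>

lemma card_less_mono: "k < j \<Longrightarrow> card {i. i < k} < card {i. i < j}"
  for j k :: "'n::{finite,linorder}"
  by (rule psubset_card_mono) auto

text \<open>For linearly dependent rows the residual \<open>u\<close> may vanish, and then \<open>gs g j = 0\<close> because
  \<open>inverse 0 = 0\<close>.\<close>

function gs :: "('n::{finite,linorder}) rmat \<Rightarrow> 'n \<Rightarrow> 'n rvec" where
  "gs g j = (let u = g $ j - (\<Sum>k | k < j. (g $ j \<bullet> gs g k) *\<^sub>R gs g k) in u /\<^sub>R norm u)"
  by auto
termination
  by (relation "Wellfounded.measure (\<lambda>(g, j). card {k. k < j})") (simp_all add: card_less_mono)

declare gs.simps [simp del]

definition gs_residual :: "('n::{finite,linorder}) rmat \<Rightarrow> 'n \<Rightarrow> 'n rvec" where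
  "gs_residual g j = g $ j - (\<Sum>k | k < j. (g $ j \<bullet> gs g k) *\<^sub>R gs g k)"

lemma gs_eq: "gs g j = gs_residual g j /\<^sub>R norm (gs_residual g j)"
  by (subst gs.simps) (simp add: gs_residual_def Let_def)

lemma finite_linorder_less_induct [case_names less]:
  fixes j :: "'n::{finite,linorder}"
  assumes "\<And>j. (\<And>k. k < j \<Longrightarrow> P k) \<Longrightarrow> P j"
  shows "P j"
proof (induction "card {k. k < j}" arbitrary: j rule: less_induct)
  case less
  show ?case
    by (rule assms) (rule less, rule card_less_mono)
qed

text \<open>Later rows do not influence the construction at \<open>j\<close>. This is what permits
  integrating a matrix row by row.\<close>

lemma gs_cong:
  assumes "\<And>k. k \<le> j \<Longrightarrow> g $ k = g' $ k"
  shows "gs g j = gs g' j"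
  using assms
proof (induction j rule: finite_linorder_less_induct)
  case (less j)
  then have "gs_residual g j = gs_residual g' j"
    unfolding gs_residual_def by (intro arg_cong2[where f = "(-)"] sum.cong) auto
  then show ?case by (simp add: gs_eq)
qed

lemma gs_residual_cong:
  assumes "\<And>k. k \<le> j \<Longrightarrow> g $ k = g' $ k"
  shows "gs_residual g j = gs_residual g' j"
  unfolding gs_residual_def
  using assms gs_cong[of _ g g'] by (intro arg_cong2[where f = "(-)"] sum.cong) auto

lemma borel_measurable_gs [measurable]: "(\<lambda>g. gs g j) \<in> borel_measurable borel"
proof (induction j rule: finite_linorder_less_induct)
  case (less j)
  have [measurable]: "(\<lambda>g. g $ j) \<in> borel_measurable borel"
    by (intro borel_measurable_continuous_onI continuous_intros)
  have [measurable]: "(\<lambda>g. \<Sum>k | k < j. (g $ j \<bullet> gs g k) *\<^sub>R gs g k) \<in> borel_measurable borel"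
    using less by (intro borel_measurable_sum borel_measurable_scaleR borel_measurable_inner) auto
  have [measurable]: "(\<lambda>g. gs_residual g j) \<in> borel_measurable borel"
    unfolding gs_residual_def by measurable
  show ?case
    by (subst gs_eq) measurable
qed

lemma borel_measurable_gs_residual [measurable]: "(\<lambda>g. gs_residual g j) \<in> borel_measurable borel"
proof -
  have [measurable]: "(\<lambda>g. g $ j) \<in> borel_measurable borel"
    by (intro borel_measurable_continuous_onI continuous_intros)
  show ?thesis unfolding gs_residual_def by measurable
qed

lemma norm_gs: "gs_residual g j \<noteq> 0 \<Longrightarrow> norm (gs g j) = 1"
  by (simp add: gs_eq)

lemma gs_eq_0: "gs_residual g j = 0 \<Longrightarrow> gs g j = 0"
  by (simp add: gs_eq)

lemma inner_gs_self: "gs g j \<bullet> gs g j = (if gs_residual g j = 0 then 0 else 1)"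
  using norm_gs[of g j] by (auto simp: gs_eq_0 dot_square_norm)

lemma inner_gs_less: "k < j \<Longrightarrow> gs g j \<bullet> gs g k = 0"
proof (induction j arbitrary: k rule: finite_linorder_less_induct)
  case (less j)
  have eq: "(\<Sum>i | i < j. (g $ j \<bullet> gs g i) * (gs g i \<bullet> gs g k)) =
      (\<Sum>i | i < j. if i = k then g $ j \<bullet> gs g k else 0)"
  proof (intro sum.cong refl)
    fix i assume "i \<in> {i. i < j}"
    then have i: "i < j" by simp
    consider "i < k" | "i = k" | "k < i" by force
    then show "(g $ j \<bullet> gs g i) * (gs g i \<bullet> gs g k) = (if i = k then g $ j \<bullet> gs g k else 0)"
    proof cases
      case 1 then show ?thesis using less.IH[of k i] less.prems by (simp add: inner_commute)
    next
      \<comment> \<open>If the residual at \<open>k\<close> vanishes, the self inner product is 0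
        instead of 1, but then \<open>gs g k = 0\<close> and the right-hand side is 0 as
        well.\<close>
      case 2 then show ?thesis by (auto simp: inner_gs_self gs_eq_0)
    next
      case 3 then show ?thesis using less.IH[of i k] i by simp
    qed
  qed
  have "gs_residual g j \<bullet> gs g k = 0"
    using less.prems by (simp add: gs_residual_def inner_diff_left inner_sum_left eq)
  then show ?case by (subst gs_eq) simp
qed

lemma inner_gs: "gs g j \<bullet> gs g k = (if j = k \<and> gs_residual g j \<noteq> 0 then 1 else 0)"
  using inner_gs_less[of k j g] inner_gs_less[of j k g]
  by (cases j k rule: linorder_cases) (auto simp: inner_gs_self inner_commute)

lemma row_eq_gs: "g $ j = (\<Sum>k | k < j. (g $ j \<bullet> gs g k) *\<^sub>R gs g k) + norm (gs_residual g j) *\<^sub>R gs g j"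
proof -
  have "norm (gs_residual g j) *\<^sub>R gs g j = gs_residual g j"
    by (cases "gs_residual g j = 0") (simp_all add: gs_eq)
  then show ?thesis by (simp add: gs_residual_def)
qed

lemma row_inner_gs:
  assumes "i \<le> j"
  shows "g $ i \<bullet> gs g j = (if i = j then norm (gs_residual g i) else 0)"
proof -
  have "g $ i \<bullet> gs g j = (\<Sum>k | k < i. (g $ i \<bullet> gs g k) * (gs g k \<bullet> gs g j)) + norm (gs_residual g i) * (gs g i \<bullet> gs g j)"
    by (subst row_eq_gs) (simp only: inner_add_left inner_sum_left inner_scaleR_left)
  moreover have "(\<Sum>k | k < i. (g $ i \<bullet> gs g k) * (gs g k \<bullet> gs g j)) = 0"
    using assms by (intro sum.neutral) (auto simp: inner_gs)
  ultimately show ?thesis by (auto simp: inner_gs)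
qed

definition gs_q :: "('n::{finite,linorder}) rmat \<Rightarrow> 'n rmat" where
  "gs_q g = (\<chi> j. gs g j)"

definition gs_l :: "('n::{finite,linorder}) rmat \<Rightarrow> 'n rmat" where
  "gs_l g = (\<chi> i j. g $ i \<bullet> gs g j)"

lemma gs_l_above: "i < j \<Longrightarrow> gs_l g $ i $ j = 0"
  by (simp add: gs_l_def row_inner_gs)

lemma gs_l_diag: "gs_l g $ i $ i = norm (gs_residual g i)"
  by (simp add: gs_l_def row_inner_gs)

text \<open>Valid for singular \<open>g\<close> too: a row with vanishing residual is already a
  combination of the earlier vectors.\<close>

lemma gs_l_mult_gs_q: "gs_l g ** gs_q g = g"
proof -
  have "(\<Sum>k\<in>UNIV. gs_l g $ i $ k *\<^sub>R gs g k) = g $ i" for i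
  proof -
    have "(\<Sum>k\<in>UNIV. gs_l g $ i $ k *\<^sub>R gs g k) = (\<Sum>k\<in>insert i {k. k < i}. gs_l g $ i $ k *\<^sub>R gs g k)"
      by (rule sum.mono_neutral_right) (auto simp: gs_l_above)
    also have "\<dots> = (\<Sum>k | k < i. (g $ i \<bullet> gs g k) *\<^sub>R gs g k) + norm (gs_residual g i) *\<^sub>R gs g i"
      by (simp add: gs_l_diag) (simp add: gs_l_def)
    also have "\<dots> = g $ i"
      by (rule row_eq_gs[symmetric])
    finally show ?thesis .
  qed
  then have "(\<Sum>k\<in>UNIV. gs_l g $ i $ k *\<^sub>R gs g k) $ j = g $ i $ j" for i j
    by simp
  then show ?thesis
    by (simp add: matrix_matrix_mult_def gs_q_def vec_eq_iff)
qed

lemma orthogonal_gs_q: "(\<And>i. gs_residual g i \<noteq> 0) \<Longrightarrow> orthogonal_matrix (gs_q g)"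
  unfolding orthogonal_matrix_orthonormal_rows
  by (simp add: gs_q_def row_def norm_gs orthogonal_def inner_gs)

text \<open>The group AN: a positive diagonal matrix times a lower unipotent one.\<close>

definition lower_pos :: "('n::{finite,linorder}) rmat set" where
  "lower_pos = {b. (\<forall>i. 0 < b $ i $ i) \<and> (\<forall>i j. i < j \<longrightarrow> b $ i $ j = 0)}"

lemma det_lower_triangular:
  fixes b :: "('n::{finite,linorder}) rmat"
  assumes lower: "\<And>i j. i < j \<Longrightarrow> b $ i $ j = 0"
  shows "det b = (\<Prod>i\<in>UNIV. b $ i $ i)"
proof -
  have "of_int (sign p) * (\<Prod>i\<in>UNIV. b $ i $ p i) = 0" if p: "p permutes UNIV" "p \<noteq> id" for p
  proof -
    \<comment> \<open>A permutation with p i \<le> i everywhere fixes the indices one after the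
      other, hence is the identity; so any other one picks an entry above the diagonal.\<close>
    have "\<exists>i. i < p i"
    proof (rule ccontr)
      assume "\<nexists>i. i < p i"
      then have le: "p i \<le> i" for i by (simp add: not_less)
      have "p i = i" for i
      proof (induction i rule: finite_linorder_less_induct)
        case (less i)
        then show ?case
          using le[of i] permutes_inj[OF p(1), THEN injD, of "p i" i] by (cases "p i = i") auto
      qed
      then show False using p(2) by (simp add: fun_eq_iff)
    qed
    then show ?thesis using lower by (auto simp: prod_zero_iff)
  qed
  then have "det b = (\<Sum>p\<in>{id}. of_int (sign p) * (\<Prod>i\<in>UNIV. b $ i $ p i))"
    unfolding det_def by (intro sum.mono_neutral_right) (auto simp: permutes_id)
  then show ?thesis by (simp add: sign_id)
qed

lemma det_gs_l: "det (gs_l g) = (\<Prod>i\<in>UNIV. norm (gs_residual g i))"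
  by (subst det_lower_triangular) (simp_all add: gs_l_above gs_l_diag)

lemma invertible_iff_gs_residual: "invertible g \<longleftrightarrow> (\<forall>i. gs_residual g i \<noteq> 0)"
proof
  assume "invertible g"
  then have "det (gs_l g) \<noteq> 0"
    by (metis det_mul gs_l_mult_gs_q invertible_det_nz mult_zero_left)
  then show "\<forall>i. gs_residual g i \<noteq> 0"
    by (simp add: det_gs_l prod_zero_iff)
next
  assume *: "\<forall>i. gs_residual g i \<noteq> 0"
  then have "det (gs_l g) \<noteq> 0" "invertible (gs_q g)"
    using orthogonal_gs_q[of g]
    by (auto simp: det_gs_l prod_zero_iff invertible_def orthogonal_matrix_def)
  then show "invertible g"
    by (metis gs_l_mult_gs_q invertible_det_nz invertible_mult)
qed

lemma gs_l_lower_pos: "invertible g \<Longrightarrow> gs_l g \<in> lower_pos"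
  by (simp add: lower_pos_def gs_l_above gs_l_diag invertible_iff_gs_residual)

lemma orthogonal_gs_q': "invertible g \<Longrightarrow> orthogonal_matrix (gs_q g)"
  by (simp add: orthogonal_gs_q invertible_iff_gs_residual)

lemma abs_det_eq_gs_residual:
  assumes "invertible g"
  shows "\<bar>det g\<bar> = (\<Prod>i\<in>UNIV. norm (gs_residual g i))"
proof -
  have "\<bar>det (gs_q g)\<bar> = 1"
    using det_orthogonal_matrix[OF orthogonal_gs_q'[OF assms]] by auto
  moreover have "\<bar>det g\<bar> = \<bar>det (gs_l g)\<bar> * \<bar>det (gs_q g)\<bar>"
    by (metis abs_mult det_mul gs_l_mult_gs_q)
  ultimately show ?thesis
    by (simp add: det_gs_l abs_prod)
qed

text \<open>Gram-Schmidt uses inner products only, which \<open>w\<close> preserves. The sign of a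
  previous row occurs twice in each projection and cancels, while the sign of the current row passes
  through because residuals are divided by their norm. Invertibility is not assumed, so the average
  can be formed at every matrix.\<close>

lemma gs_transform:
  fixes g w :: "('n::{finite,linorder}) rmat"
  assumes d: "\<And>i. d i = 1 \<or> d i = -1" and w: "orthogonal_matrix w"
  shows "gs (diag_mat d ** g ** w) j = d j *\<^sub>R (gs g j v* w)"
    and "gs_residual (diag_mat d ** g ** w) j = d j *\<^sub>R (gs_residual g j v* w)"
proof -
  have inner: "(x v* w) \<bullet> (y v* w) = x \<bullet> y" for x y
  proof -
    have "orthogonal_matrix (transpose w)"
      using w by (simp add: orthogonal_matrix_transpose)
    then have "orthogonal_transformation ((*v) (transpose w))"
      by (simp add: orthogonal_transformation_matrix)
    then show ?thesis
      by (simp add: orthogonal_transformation_def)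
  qed
  then have norm: "norm (x v* w) = norm x" for x
    by (simp add: norm_eq_sqrt_inner)
  have lin: "linear (\<lambda>x. x v* w)"
    by (rule linearI)
      (simp_all add: vector_matrix_mult_def vec_eq_iff sum.distrib algebra_simps sum_distrib_left)
  have "(M ** w) $ i = M $ i v* w" for M :: "'n rmat" and i
    by (simp add: vec_eq_iff matrix_matrix_mult_def vector_matrix_mult_def mult.commute)
  moreover have "(diag_mat d ** g) $ i = d i *\<^sub>R g $ i" for i
    by (simp add: vec_eq_iff matrix_matrix_mult_def diag_mat_def if_distrib[of "\<lambda>x. x * _"] cong: if_cong)
  ultimately have row: "(diag_mat d ** g ** w) $ i = d i *\<^sub>R (g $ i v* w)" for i
    by (simp add: linear_scale[OF lin])
  have d2: "d i * d i = 1" "\<bar>d i\<bar> = 1" for i using d[of i] by auto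
  have residual: "gs_residual (diag_mat d ** g ** w) j = d j *\<^sub>R (gs_residual g j v* w)"
    if "\<And>k. k < j \<Longrightarrow> gs (diag_mat d ** g ** w) k = d k *\<^sub>R (gs g k v* w)" for j
  proof -
    have "(\<Sum>k | k < j. ((diag_mat d ** g ** w) $ j \<bullet> gs (diag_mat d ** g ** w) k) *\<^sub>R gs (diag_mat d ** g ** w) k) =
        (\<Sum>k | k < j. (d j * (g $ j \<bullet> gs g k)) *\<^sub>R (gs g k v* w))"
    proof (intro sum.cong refl)
      fix k assume "k \<in> {k. k < j}"
      then have "((diag_mat d ** g ** w) $ j \<bullet> gs (diag_mat d ** g ** w) k) *\<^sub>R gs (diag_mat d ** g ** w) k =
          (d k * d k * (d j * (g $ j \<bullet> gs g k))) *\<^sub>R (gs g k v* w)"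
        using that[of k] by (simp add: row inner mult_ac)
      then show "((diag_mat d ** g ** w) $ j \<bullet> gs (diag_mat d ** g ** w) k) *\<^sub>R gs (diag_mat d ** g ** w) k =
          (d j * (g $ j \<bullet> gs g k)) *\<^sub>R (gs g k v* w)"
        by (simp add: d2)
    qed
    also have "\<dots> = d j *\<^sub>R ((\<Sum>k | k < j. (g $ j \<bullet> gs g k) *\<^sub>R gs g k) v* w)"
      by (simp add: linear_sum[OF lin] linear_scale[OF lin] scaleR_sum_right)
    finally show ?thesis
      by (simp add: gs_residual_def row linear_diff[OF lin] scaleR_diff_right)
  qed
  have step: "gs (diag_mat d ** g ** w) j = d j *\<^sub>R (gs g j v* w)"
    if "gs_residual (diag_mat d ** g ** w) j = d j *\<^sub>R (gs_residual g j v* w)" for j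
    by (simp add: gs_eq that norm d2 linear_scale[OF lin])
  show gs: "gs (diag_mat d ** g ** w) j = d j *\<^sub>R (gs g j v* w)" for j
    by (induction j rule: finite_linorder_less_induct) (rule step, rule residual)
  show "gs_residual (diag_mat d ** g ** w) j = d j *\<^sub>R (gs_residual g j v* w)"
    by (rule residual) (rule gs)
qed

section \<open>Lebesgue measure and Gaussian integrals\<close>

lemma nn_integral_lborel_translate:
  fixes f :: "'a::euclidean_space \<Rightarrow> ennreal"
  assumes [measurable]: "f \<in> borel_measurable borel"
  shows "(\<integral>\<^sup>+x. f (a + x) \<partial>lborel) = (\<integral>\<^sup>+x. f x \<partial>lborel)"
  by (subst (2) lborel_distr_plus[of a, symmetric]) (simp add: nn_integral_distr)

lemma nn_integral_lborel_reflect: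
  fixes f :: "'a::euclidean_space \<Rightarrow> ennreal"
  assumes [measurable]: "f \<in> borel_measurable borel"
  shows "(\<integral>\<^sup>+x. f (a - x) \<partial>lborel) = (\<integral>\<^sup>+x. f x \<partial>lborel)"
proof -
  have "lborel = distr lborel borel (\<lambda>x. a - x)"
    using lborel_affine[of "-1" a] by (simp add: density_1)
  then have "(\<integral>\<^sup>+x. f x \<partial>lborel) = integral\<^sup>N (distr lborel borel (\<lambda>x. a - x)) f"
    by simp
  then show ?thesis by (simp add: nn_integral_distr)
qed

text \<open>With \<open>B\<close> the unit ball, Fubini applied to the indicator of \<open>f x \<in> A \<and> f x + y \<in> B\<close> and
  translation invariance give \<open>|f\<inverse> A| |B| = |f\<inverse> B| |A| = |B| |A|\<close>.\<close>

lemma lborel_distr_orthogonal_transformation: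
  fixes f :: "'a::euclidean_space \<Rightarrow> 'a"
  assumes f: "orthogonal_transformation f"
  shows "distr lborel borel f = lborel"
proof (rule measure_eqI)
  fix A :: "'a set" assume "A \<in> sets (distr lborel borel f)"
  then have A [measurable]: "A \<in> sets borel" by simp
  have lin: "linear f" using f by (rule orthogonal_transformation_linear)
  have [measurable]: "f \<in> borel_measurable borel"
    using lin by (intro borel_measurable_continuous_onI linear_continuous_on)
      (simp add: linear_conv_bounded_linear)
  define B :: "'a set" where "B = cball 0 1"
  have [measurable]: "B \<in> sets borel" by (simp add: B_def)
  define \<mu> where "\<mu> S = emeasure lborel (f -` S)" for S
  have \<mu>: "(\<integral>\<^sup>+x. indicator S (f x) \<partial>lborel) = \<mu> S" if [measurable]: "S \<in> sets borel" for S
  proof -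
    have [measurable]: "f -` S \<in> sets borel"
      using measurable_sets[of f borel borel S] by simp
    have "(\<integral>\<^sup>+x. indicator S (f x) \<partial>lborel) = (\<integral>\<^sup>+x. indicator (f -` S) x \<partial>lborel)"
      by (intro nn_integral_cong) (auto split: split_indicator)
    then show ?thesis by (simp add: \<mu>_def)
  qed
  have "\<mu> A * emeasure lborel B = (\<integral>\<^sup>+x. indicator A (f x) * emeasure lborel B \<partial>lborel)"
    by (simp add: nn_integral_multc \<mu>)
  also have "\<dots> = (\<integral>\<^sup>+x. \<integral>\<^sup>+y. indicator A (f x) * indicator B (f x + y) \<partial>lborel \<partial>lborel)"
    by (simp add: nn_integral_cmult nn_integral_lborel_translate)
  also have "\<dots> = (\<integral>\<^sup>+y. \<integral>\<^sup>+x. indicator A (f x) * indicator B (f x + y) \<partial>lborel \<partial>lborel)"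
    by (rule lborel_pair.Fubini') simp
  also have "\<dots> = (\<integral>\<^sup>+y. \<integral>\<^sup>+x. indicator A (f x - y) * indicator B (f x) \<partial>lborel \<partial>lborel)"
  proof (rule nn_integral_cong)
    fix y
    obtain z where z: "f z = y"
      using orthogonal_transformation_surj[OF f] by (metis surjD)
    have "f (- z + x) = f x - y" for x
      using lin z by (simp add: linear_diff)
    then show "(\<integral>\<^sup>+x. indicator A (f x) * indicator B (f x + y) \<partial>lborel) =
        (\<integral>\<^sup>+x. indicator A (f x - y) * indicator B (f x) \<partial>lborel)"
      using nn_integral_lborel_translate[of "\<lambda>x. indicator A (f x) * indicator B (f x + y)" "- z"]
      by simp
  qed
  also have "\<dots> = (\<integral>\<^sup>+x. \<integral>\<^sup>+y. indicator A (f x - y) * indicator B (f x) \<partial>lborel \<partial>lborel)"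
    by (rule lborel_pair.Fubini') simp
  also have "\<dots> = (\<integral>\<^sup>+x. emeasure lborel A * indicator B (f x) \<partial>lborel)"
    by (simp add: nn_integral_multc nn_integral_lborel_reflect)
  also have "\<dots> = emeasure lborel A * \<mu> B"
    by (simp add: nn_integral_cmult \<mu>)
  also have "f -` B = B"
    using f by (auto simp: B_def orthogonal_transformation_norm)
  then have "\<mu> B = emeasure lborel B" by (simp add: \<mu>_def)
  finally have "\<mu> A * emeasure lborel B = emeasure lborel A * emeasure lborel B" .
  moreover have "unit_ball_vol (real DIM('a)) \<noteq> 0"
    using unit_ball_vol_pos[of "real DIM('a)"] by linarith
  then have "emeasure lborel B \<noteq> 0" "emeasure lborel B \<noteq> \<infinity>"
    by (simp_all add: B_def emeasure_cball)
  ultimately have "\<mu> A = emeasure lborel A"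
    by (simp add: mult.commute[of _ "emeasure lborel B"] ennreal_mult_cancel_left)
  then show "emeasure (distr lborel borel f) A = emeasure lborel A"
    by (simp add: emeasure_distr \<mu>_def)
qed simp

section \<open>Gamma laws of Gaussian sums of squares\<close>

definition gamma_density :: "real \<Rightarrow> real \<Rightarrow> real" where
  "gamma_density a t = (if t > 0 then t powr (a - 1) * exp (- t) / Gamma a else 0)"

lemma borel_measurable_gamma_density [measurable]: "gamma_density a \<in> borel_measurable borel"
  unfolding gamma_density_def[abs_def] by measurable

lemma gamma_density_nonneg: "a > 0 \<Longrightarrow> gamma_density a t \<ge> 0"
  by (simp add: gamma_density_def Gamma_real_pos less_imp_le)

lemma nn_integral_gamma_density:
  assumes "a > 0"
  shows "(\<integral>\<^sup>+t. ennreal (gamma_density a t) \<partial>lborel) = 1"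
proof -
  have "((\<lambda>t. t powr (a - 1) / exp t / Gamma a) has_integral (Gamma a / Gamma a)) {0..}"
    by (intro has_integral_divide Gamma_integral_real assms)
  then have "(\<integral>\<^sup>+t. ennreal (t powr (a - 1) / exp t / Gamma a) * indicator {0..} t \<partial>lborel) = ennreal (Gamma a / Gamma a)"
    using assms by (intro nn_integral_has_integral_lebesgue') (auto simp: Gamma_real_pos less_imp_le)
  moreover have "ennreal (t powr (a - 1) / exp t / Gamma a) * indicator {0..} t = ennreal (gamma_density a t)" for t
    by (auto simp: gamma_density_def exp_minus divide_simps split: split_indicator)
  moreover have "Gamma a \<noteq> 0"
    using Gamma_real_pos[OF assms] by linarith
  ultimately show ?thesis
    by simp
qed

text \<open>Distribution functions are compared in place of polar coordinates. The preimage of a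
  half-line up to r > 0 is a ball of radius sqrt r, of volume pi^a / \<Gamma>(a + 1) * r^a, and the
  stated density is the derivative of this volume.\<close>

lemma distr_sum_squares:
  fixes J :: "'i set"
  assumes J: "finite J" "J \<noteq> {}"
  defines "a \<equiv> real (card J) / 2"
  shows "distr (Pi\<^sub>M J (\<lambda>_. lborel)) borel (\<lambda>x. \<Sum>i\<in>J. (x i)\<^sup>2) =
    density lborel (\<lambda>t. ennreal (if t > 0 then pi powr a / Gamma a * t powr (a - 1) else 0))"
    (is "?N = ?D")
proof -
  have a: "a > 0" using J by (simp add: a_def card_gt_0_iff)
  interpret product_sigma_finite "\<lambda>_::'i. lborel :: real measure" ..
  have [measurable]: "(\<lambda>x. \<Sum>i\<in>J. (x i)\<^sup>2) \<in> borel_measurable (Pi\<^sub>M J (\<lambda>_. lborel :: real measure))"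
    by measurable
  have N: "emeasure ?N {..r} = emeasure ?D {..r} \<and> emeasure ?N {..r} \<noteq> \<infinity>" for r
  proof (cases "r > 0")
    case True
    have "emeasure ?N {..r} = emeasure (Pi\<^sub>M J (\<lambda>_. lborel))
        ({x. sqrt (\<Sum>i\<in>J. (x i)\<^sup>2) \<le> sqrt r} \<inter> space (Pi\<^sub>M J (\<lambda>_. lborel)))"
      by (simp add: emeasure_distr vimage_def)
    also have "\<dots> = ennreal (unit_ball_vol (real (card J)) * sqrt r ^ card J)"
      using J True by (intro emeasure_cball_aux) auto
    also have "unit_ball_vol (real (card J)) * sqrt r ^ card J = pi powr a / Gamma a * (r powr a / a)"
    proof -
      have "sqrt r ^ card J = r powr a"
        using True by (simp add: a_def powr_half_sqrt[symmetric] powr_realpow[symmetric] powr_powr)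
      moreover have "Gamma (a + 1) = a * Gamma a"
        using a by (intro Gamma_plus1) (auto simp: nonpos_Ints_def)
      moreover have "unit_ball_vol (real (card J)) = pi powr a / Gamma (a + 1)"
        by (simp only: unit_ball_vol_def a_def)
      ultimately show ?thesis by (simp only:) simp
    qed
    finally have lhs: "emeasure ?N {..r} = ennreal (pi powr a / Gamma a * (r powr a / a))" .
    have "((\<lambda>t. pi powr a / Gamma a * t powr (a - 1)) has_integral
        (pi powr a / Gamma a * (r powr (a - 1 + 1) / (a - 1 + 1)))) {0..r}"
      using a True by (intro has_integral_mult_right has_integral_powr_from_0) auto
    then have "(\<integral>\<^sup>+t. ennreal (pi powr a / Gamma a * t powr (a - 1)) * indicator {0..r} t \<partial>lborel) =
        ennreal (pi powr a / Gamma a * (r powr a / a))"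
      using a by (intro nn_integral_has_integral_lebesgue') (auto simp: Gamma_real_pos less_imp_le)
    moreover have "emeasure ?D {..r} =
        (\<integral>\<^sup>+t. ennreal (pi powr a / Gamma a * t powr (a - 1)) * indicator {0..r} t \<partial>lborel)"
      by (simp add: emeasure_density, intro nn_integral_cong) (auto split: split_indicator)
    ultimately show ?thesis using lhs by simp
  next
    case False
    have "emeasure ?N {..r} = emeasure (Pi\<^sub>M J (\<lambda>_. lborel))
        ({x. (\<Sum>i\<in>J. (x i)\<^sup>2) \<le> r} \<inter> space (Pi\<^sub>M J (\<lambda>_. lborel)))"
      by (simp add: emeasure_distr vimage_def)
    \<comment> \<open>For r \<le> 0 the preimage contains at most the origin, which is a null set
      because \<open>J\<close> is nonempty.\<close>
    also have "\<dots> \<le> emeasure (Pi\<^sub>M J (\<lambda>_. lborel)) (Pi\<^sub>E J (\<lambda>_. {0 :: real}))"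
    proof (rule emeasure_mono)
      show "{x. (\<Sum>i\<in>J. (x i)\<^sup>2) \<le> r} \<inter> space (Pi\<^sub>M J (\<lambda>_. lborel)) \<subseteq> Pi\<^sub>E J (\<lambda>_. {0})"
      proof
        fix x :: "'i \<Rightarrow> real"
        assume x: "x \<in> {x. (\<Sum>i\<in>J. (x i)\<^sup>2) \<le> r} \<inter> space (Pi\<^sub>M J (\<lambda>_. lborel))"
        then have "(\<Sum>i\<in>J. (x i)\<^sup>2) = 0"
          using False by (intro antisym sum_nonneg) auto
        then have "\<forall>i\<in>J. x i = 0"
          using J by (simp add: sum_nonneg_eq_0_iff)
        then show "x \<in> Pi\<^sub>E J (\<lambda>_. {0})"
          unfolding PiE_iff using x by (auto simp: space_PiM PiE_def)
      qed
      show "Pi\<^sub>E J (\<lambda>_. {0}) \<in> sets (Pi\<^sub>M J (\<lambda>_. lborel :: real measure))"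
        using J by (intro sets_PiM_I_finite) auto
    qed
    also have "\<dots> = 0"
      using J by (subst emeasure_PiM) auto
    finally have "emeasure ?N {..r} = 0" by simp
    moreover have "emeasure ?D {..r} = (\<integral>\<^sup>+t.
        ennreal (if t > 0 then pi powr a / Gamma a * t powr (a - 1) else 0) * indicator {..r} t \<partial>lborel)"
      by (rule emeasure_density) auto
    moreover have "\<dots> = (\<integral>\<^sup>+t. 0 \<partial>(lborel :: real measure))"
      using False by (intro nn_integral_cong) (auto split: split_indicator)
    ultimately show ?thesis by simp
  qed
  show ?thesis
  proof (rule measure_eqI_generator_eq)
    show "Int_stable (range (\<lambda>r::real. {..r}))"
      by (auto simp: Int_stable_def)
    show "sets ?N = sigma_sets UNIV (range (\<lambda>r::real. {..r}))"
      by (simp add: borel_eq_atMost)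
    show "sets ?D = sigma_sets UNIV (range (\<lambda>r::real. {..r}))"
      by (simp add: borel_eq_atMost)
    show "range (\<lambda>n::nat. {..real n}) \<subseteq> range (\<lambda>r::real. {..r})"
      by auto
    show "(\<Union>n::nat. {..real n}) = UNIV"
      using real_arch_simple by auto
    show "emeasure ?N {..real n} \<noteq> \<infinity>" for n
      using N[of "real n"] by blast
    show "emeasure ?N X = emeasure ?D X" if "X \<in> range (\<lambda>r::real. {..r})" for X
      using N that by blast
  qed auto
qed

text \<open>Push forward along the sum of squares and substitute t / c for t: the power density
  times the exponential becomes a multiple of the gamma law of shape \<open>a\<close>.\<close>

lemma nn_integral_gaussian_sum_squares:
  fixes J :: "'i set" and F :: "real \<Rightarrow> ennreal"
  assumes J: "finite J" "J \<noteq> {}" and c: "c > 0" and [measurable]: "F \<in> borel_measurable borel"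
  defines "a \<equiv> real (card J) / 2"
  shows "(\<integral>\<^sup>+x. F (c * (\<Sum>i\<in>J. (x i)\<^sup>2)) * ennreal (exp (- c * (\<Sum>i\<in>J. (x i)\<^sup>2))) \<partial>Pi\<^sub>M J (\<lambda>_. lborel)) =
    ennreal ((pi / c) powr a) * (\<integral>\<^sup>+t. F t * ennreal (gamma_density a t) \<partial>lborel)"
proof -
  have a: "a > 0" using J by (simp add: a_def card_gt_0_iff)
  define p where "p t = (if t > 0 then pi powr a / Gamma a * t powr (a - 1) else 0)" for t :: real
  have [measurable]: "p \<in> borel_measurable borel"
    unfolding p_def[abs_def] by measurable
  have p: "p t \<ge> 0" for t
    using a by (simp add: p_def Gamma_real_pos less_imp_le)
  have [measurable]: "(\<lambda>x. \<Sum>i\<in>J. (x i)\<^sup>2) \<in> borel_measurable (Pi\<^sub>M J (\<lambda>_. lborel :: real measure))"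
    by measurable
  have "(\<integral>\<^sup>+x. F (c * (\<Sum>i\<in>J. (x i)\<^sup>2)) * ennreal (exp (- c * (\<Sum>i\<in>J. (x i)\<^sup>2))) \<partial>Pi\<^sub>M J (\<lambda>_. lborel)) =
      (\<integral>\<^sup>+t. F (c * t) * ennreal (exp (- c * t))
        \<partial>distr (Pi\<^sub>M J (\<lambda>_. lborel)) borel (\<lambda>x. \<Sum>i\<in>J. (x i)\<^sup>2))"
    by (subst nn_integral_distr) auto
  also have "\<dots> = (\<integral>\<^sup>+t. F (c * t) * ennreal (exp (- c * t)) \<partial>density lborel (\<lambda>t. ennreal (p t)))"
    unfolding distr_sum_squares[OF J] a_def[symmetric] p_def ..
  also have "\<dots> = (\<integral>\<^sup>+t. ennreal (p t) * (F (c * t) * ennreal (exp (- c * t))) \<partial>lborel)"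
    by (subst nn_integral_density) auto
  also have "\<dots> = ennreal \<bar>1 / c\<bar> * (\<integral>\<^sup>+t. ennreal (p (0 + 1 / c * t)) *
      (F (c * (0 + 1 / c * t)) * ennreal (exp (- c * (0 + 1 / c * t)))) \<partial>lborel)"
    using c by (intro nn_integral_real_affine) auto
  also have "\<dots> = (\<integral>\<^sup>+t. ennreal (1 / c) * (ennreal (p (t / c)) * (F t * ennreal (exp (- t)))) \<partial>lborel)"
    using c by (subst nn_integral_cmult) auto
  also have "\<dots> = (\<integral>\<^sup>+t. ennreal ((pi / c) powr a) * (F t * ennreal (gamma_density a t)) \<partial>lborel)"
  proof (rule nn_integral_cong)
    fix t :: real
    have "1 / c * (p (t / c) * exp (- t)) = (pi / c) powr a * gamma_density a t"
      using c by (auto simp: p_def gamma_density_def powr_divide zero_less_divide_iff powr_diff field_simps)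
    then have "ennreal (1 / c) * (ennreal (p (t / c)) * ennreal (exp (- t))) =
        ennreal ((pi / c) powr a) * ennreal (gamma_density a t)"
      using c p a by (simp add: ennreal_mult[symmetric] gamma_density_nonneg)
    then show "ennreal (1 / c) * (ennreal (p (t / c)) * (F t * ennreal (exp (- t)))) =
        ennreal ((pi / c) powr a) * (F t * ennreal (gamma_density a t))"
      by (metis (no_types, lifting) mult.assoc mult.commute)
  qed
  also have "\<dots> = ennreal ((pi / c) powr a) * (\<integral>\<^sup>+t. F t * ennreal (gamma_density a t) \<partial>lborel)"
    by (rule nn_integral_cmult) auto
  finally show ?thesis .
qed

section \<open>Lebesgue measure on vectors and matrices as a product measure\<close>

lemma borel_measurable_vecI:
  fixes f :: "'b \<Rightarrow> 'a::euclidean_space ^ 'n"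
  assumes [measurable]: "\<And>i. (\<lambda>x. f x $ i) \<in> borel_measurable M"
  shows "f \<in> borel_measurable M"
proof (rule borel_measurable_euclidean_space[THEN iffD2], rule ballI)
  fix b :: "'a^'n" assume "b \<in> Basis"
  then obtain i u where "b = axis i u"
    by (auto simp: Basis_vec_def)
  then show "(\<lambda>x. f x \<bullet> b) \<in> borel_measurable M"
    by (simp add: inner_axis)
qed

lemma measurable_vec_lambda_PiM [measurable]:
  "vec_lambda \<in> borel_measurable (Pi\<^sub>M UNIV (\<lambda>_::'n::finite. lborel :: 'a::euclidean_space measure))"
  by (intro borel_measurable_vecI) simp

text \<open>Both measures agree on boxes. The entries may lie in any Euclidean space, so one
  statement covers vectors of reals and matrices seen as families of rows.\<close>

lemma lborel_vec_eq_distr_PiM: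
  "(lborel :: ('a::euclidean_space ^ 'n) measure) = distr (Pi\<^sub>M UNIV (\<lambda>_. lborel)) borel vec_lambda"
proof (rule lborel_eqI)
  interpret product_sigma_finite "\<lambda>_::'n. lborel :: 'a measure" ..
  fix l u :: "'a^'n"
  assume le: "\<And>b. b \<in> Basis \<Longrightarrow> l \<bullet> b \<le> u \<bullet> b"
  have le': "l $ i \<bullet> b \<le> u $ i \<bullet> b" if "b \<in> Basis" for i b
    using le[of "axis i b"] that by (auto simp: Basis_vec_def inner_axis)
  have "emeasure (distr (Pi\<^sub>M UNIV (\<lambda>_. lborel)) borel vec_lambda) (box l u) =
      emeasure (Pi\<^sub>M UNIV (\<lambda>_. lborel)) (Pi\<^sub>E UNIV (\<lambda>i. box (l $ i) (u $ i)))"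
    by (subst emeasure_distr)
      (auto simp: Basis_vec_def mem_box inner_axis space_PiM PiE_iff intro!: arg_cong2[where f = emeasure])
  also have "\<dots> = (\<Prod>i\<in>UNIV. ennreal (\<Prod>b\<in>Basis. (u $ i - l $ i) \<bullet> b))"
    using le' by (subst emeasure_PiM) auto
  also have "\<dots> = ennreal (\<Prod>i\<in>UNIV. \<Prod>b\<in>Basis. (u $ i - l $ i) \<bullet> b)"
    using le' by (intro prod_ennreal prod_nonneg) (auto simp: inner_diff_left)
  also have "(\<Prod>i\<in>UNIV. \<Prod>b\<in>Basis. (u $ i - l $ i) \<bullet> b) = (\<Prod>(i, b)\<in>UNIV \<times> Basis. (u - l) \<bullet> axis i b)"
    by (simp add: prod.cartesian_product inner_axis)
  also have "\<dots> = (\<Prod>b\<in>(\<lambda>(i, b). axis i b) ` (UNIV \<times> Basis). (u - l) \<bullet> b)"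
    by (subst prod.reindex) (auto simp: inj_on_def axis_eq_axis case_prod_unfold nonzero_Basis)
  also have "(\<lambda>(i, b). axis i b) ` (UNIV \<times> Basis) = (Basis :: ('a^'n) set)"
    by (auto simp: Basis_vec_def)
  finally show "emeasure (distr (Pi\<^sub>M UNIV (\<lambda>_. lborel)) borel vec_lambda) (box l u) =
      ennreal (\<Prod>b\<in>Basis. (u - l) \<bullet> b)" .
qed simp

lemma nn_integral_vec_eq_PiM:
  fixes \<Phi> :: "'a::euclidean_space ^ 'n \<Rightarrow> ennreal"
  assumes [measurable]: "\<Phi> \<in> borel_measurable borel"
  shows "(\<integral>\<^sup>+g. \<Phi> g \<partial>lborel) = (\<integral>\<^sup>+f. \<Phi> (vec_lambda f) \<partial>Pi\<^sub>M UNIV (\<lambda>_. lborel))"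
  by (subst lborel_vec_eq_distr_PiM, subst nn_integral_distr) auto

lemma nn_integral_vec_component:
  fixes \<Phi> :: "'a::euclidean_space ^ 'n \<Rightarrow> ennreal"
  assumes [measurable]: "\<Phi> \<in> borel_measurable borel"
  shows "(\<integral>\<^sup>+g. \<Phi> g \<partial>lborel) =
    (\<integral>\<^sup>+f. \<integral>\<^sup>+x. \<Phi> (vec_lambda (f(i := x))) \<partial>lborel \<partial>Pi\<^sub>M (- {i}) (\<lambda>_. lborel))"
proof -
  interpret product_sigma_finite "\<lambda>_::'n. lborel :: 'a measure" ..
  have UNIV: "UNIV = insert i (- {i})" by auto
  have "(\<integral>\<^sup>+g. \<Phi> g \<partial>lborel) = (\<integral>\<^sup>+f. \<Phi> (vec_lambda f) \<partial>Pi\<^sub>M (insert i (- {i})) (\<lambda>_. lborel))"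
    unfolding UNIV[symmetric] by (rule nn_integral_vec_eq_PiM) simp
  also have "\<dots> = (\<integral>\<^sup>+f. \<integral>\<^sup>+x. \<Phi> (vec_lambda (f(i := x))) \<partial>lborel \<partial>Pi\<^sub>M (- {i}) (\<lambda>_. lborel))"
  proof (rule product_nn_integral_insert)
    show "(\<lambda>f. \<Phi> (vec_lambda f)) \<in> borel_measurable (Pi\<^sub>M (insert i (- {i})) (\<lambda>_. lborel))"
      unfolding UNIV[symmetric] by measurable
  qed auto
  finally show ?thesis .
qed

lemma power2_norm_vec: "(norm x)\<^sup>2 = (\<Sum>i\<in>UNIV. (norm (x $ i))\<^sup>2)"
  by (simp add: norm_vec_def L2_set_def sum_nonneg)

text \<open>The coordinates outside \<open>J\<close> separate and contribute pure Gaussian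
  integrals, so only the constant sees the full dimension; the gamma shape sees
  \<open>card J\<close>.\<close>

lemma nn_integral_gaussian_coordinates:
  fixes F :: "real \<Rightarrow> ennreal" and J :: "'n::finite set"
  assumes J: "J \<noteq> {}" and c: "c > 0" and [measurable]: "F \<in> borel_measurable borel"
  shows "(\<integral>\<^sup>+x. F (c * (\<Sum>i\<in>J. (x $ i)\<^sup>2)) * ennreal (exp (- c * (norm x)\<^sup>2)) \<partial>lborel) =
    ennreal ((pi / c) powr (real CARD('n) / 2)) * (\<integral>\<^sup>+t. F t * ennreal (gamma_density (card J / 2) t) \<partial>lborel)"
    (is "?lhs = _ * ?I")
proof -
  interpret product_sigma_finite "\<lambda>_::'n. lborel :: real measure" ..
  let ?q = "\<lambda>A x. \<Sum>i\<in>A. (x i)\<^sup>2 :: real"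
  have [measurable]: "(\<lambda>x. ?q A x) \<in> borel_measurable (Pi\<^sub>M B (\<lambda>_. lborel :: real measure))"
    if "A \<subseteq> B" for A B :: "'n set"
    using that by (intro borel_measurable_sum borel_measurable_power) (auto intro!: measurable_component_singleton)
  have UNIV: "J \<union> - J = UNIV" by auto
  have gauss: "(\<integral>\<^sup>+y. ennreal (exp (- c * ?q A y)) \<partial>Pi\<^sub>M A (\<lambda>_. lborel)) = ennreal ((pi / c) powr (real (card A) / 2))"
    for A :: "'n set"
  proof (cases "A = {}")
    case True
    then show ?thesis using c by (simp add: nn_integral_empty space_PiM)
  next
    case False
    have "(\<integral>\<^sup>+y. 1 * ennreal (exp (- c * ?q A y)) \<partial>Pi\<^sub>M A (\<lambda>_. lborel)) =
        ennreal ((pi / c) powr (real (card A) / 2)) * (\<integral>\<^sup>+t. 1 * ennreal (gamma_density (card A / 2) t) \<partial>lborel)"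
      using False c by (intro nn_integral_gaussian_sum_squares[where F = "\<lambda>_. 1"]) auto
    then show ?thesis
      using False by (simp add: nn_integral_gamma_density card_gt_0_iff)
  qed
  have "?lhs = (\<integral>\<^sup>+x. F (c * ?q J x) * ennreal (exp (- c * ?q UNIV x)) \<partial>Pi\<^sub>M (J \<union> - J) (\<lambda>_. lborel))"
    unfolding UNIV by (subst nn_integral_vec_eq_PiM) (auto simp: power2_norm_vec)
  also have "\<dots> = (\<integral>\<^sup>+x. \<integral>\<^sup>+y. F (c * ?q J (merge J (- J) (x, y))) *
      ennreal (exp (- c * ?q UNIV (merge J (- J) (x, y)))) \<partial>Pi\<^sub>M (- J) (\<lambda>_. lborel) \<partial>Pi\<^sub>M J (\<lambda>_. lborel))"
    by (rule product_nn_integral_fold) (auto simp: UNIV)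
  also have "\<dots> = (\<integral>\<^sup>+x. \<integral>\<^sup>+y. F (c * ?q J x) * ennreal (exp (- c * ?q J x)) *
      ennreal (exp (- c * ?q (- J) y)) \<partial>Pi\<^sub>M (- J) (\<lambda>_. lborel) \<partial>Pi\<^sub>M J (\<lambda>_. lborel))"
  proof (intro nn_integral_cong)
    fix x y
    have 1: "?q J (merge J (- J) (x, y)) = ?q J x" by simp
    have 2: "?q (- J) (merge J (- J) (x, y)) = ?q (- J) y" by simp
    have "?q UNIV (merge J (- J) (x, y)) = ?q J x + ?q (- J) y"
      unfolding UNIV[symmetric] by (subst sum.union_disjoint) (auto simp only: 1 2, auto)
    then show "F (c * ?q J (merge J (- J) (x, y))) * ennreal (exp (- c * ?q UNIV (merge J (- J) (x, y)))) =
        F (c * ?q J x) * ennreal (exp (- c * ?q J x)) * ennreal (exp (- c * ?q (- J) y))"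
      unfolding 1 by (simp add: ring_distribs exp_diff exp_minus ennreal_mult[symmetric] mult.assoc divide_inverse)
  qed
  also have "\<dots> = (\<integral>\<^sup>+x. F (c * ?q J x) * ennreal (exp (- c * ?q J x)) *
      ennreal ((pi / c) powr (real (card (- J)) / 2)) \<partial>Pi\<^sub>M J (\<lambda>_. lborel))"
    by (intro nn_integral_cong, subst nn_integral_cmult) (auto simp only: gauss, auto)
  also have "\<dots> = (\<integral>\<^sup>+x. F (c * ?q J x) * ennreal (exp (- c * ?q J x)) \<partial>Pi\<^sub>M J (\<lambda>_. lborel)) *
      ennreal ((pi / c) powr (real (card (- J)) / 2))"
    by (rule nn_integral_multc) auto
  also have "\<dots> = ennreal ((pi / c) powr (real (card J) / 2)) * ?I * ennreal ((pi / c) powr (real (card (- J)) / 2))"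
    using J c by (subst nn_integral_gaussian_sum_squares) auto
  also have "\<dots> = ennreal ((pi / c) powr (real (card J) / 2) * (pi / c) powr (real (card (- J)) / 2)) * ?I"
    by (simp add: ennreal_mult mult_ac)
  also have "(pi / c) powr (real (card J) / 2) * (pi / c) powr (real (card (- J)) / 2) =
      (pi / c) powr (real CARD('n) / 2)"
  proof -
    have "real (card J) / 2 + real (card (- J)) / 2 = real CARD('n) / 2"
      using card_Un_disjoint[of J "- J"] by (simp add: UNIV flip: of_nat_add add_divide_distrib)
    then show ?thesis by (simp only: powr_add[symmetric])
  qed
  finally show ?thesis .
qed

text \<open>While an index is missing, the chosen vectors span a proper subspace, and a unit vector
  orthogonal to it can be added. The vectors indexed by \<open>A\<close> are kept, so that the
  resulting rotation straightens exactly those.\<close>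

lemma orthonormal_family_extend:
  fixes q :: "'n::finite \<Rightarrow> real^'n"
  assumes "\<And>j k. j \<in> A \<Longrightarrow> k \<in> A \<Longrightarrow> q j \<bullet> q k = (if j = k then 1 else 0)"
  obtains p where "\<And>k. k \<in> A \<Longrightarrow> p k = q k" "\<And>j k. p j \<bullet> p k = (if j = k then 1 else 0 :: real)"
proof -
  have "\<exists>p. (\<forall>k\<in>A. p k = q k) \<and> (\<forall>j\<in>A \<union> B. \<forall>k\<in>A \<union> B. p j \<bullet> p k = (if j = k then 1 else 0))"
    for B
    using finite[of B]
  proof (induction B)
    case empty
    then show ?case using assms by (intro exI[of _ q]) auto
  next
    case (insert b B)
    then obtain p where p: "\<And>k. k \<in> A \<Longrightarrow> p k = q k"
      "\<And>j k. j \<in> A \<union> B \<Longrightarrow> k \<in> A \<union> B \<Longrightarrow> p j \<bullet> p k = (if j = k then 1 else 0)"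
      by auto
    show ?case
    proof (cases "b \<in> A \<union> B")
      case True
      then have eq: "A \<union> insert b B = A \<union> B" by auto
      show ?thesis unfolding eq using p by (intro exI[of _ p]) auto
    next
      case False
      have "dim (p ` (A \<union> B)) \<le> card (p ` (A \<union> B))"
        by (intro dim_le_card') auto
      also have "\<dots> \<le> card (A \<union> B)"
        by (intro card_image_le) auto
      also have "\<dots> < CARD('n)"
        using False by (intro psubset_card_mono) auto
      finally obtain x where x: "x \<noteq> 0" "\<And>y. y \<in> span (p ` (A \<union> B)) \<Longrightarrow> orthogonal x y"
        using orthogonal_to_subspace_exists[of "p ` (A \<union> B)"] by auto
      define v where "v = x /\<^sub>R norm x"
      have v: "v \<bullet> v = 1"
        using x(1) by (simp add: v_def dot_square_norm power2_eq_square)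
      have vp: "v \<bullet> p k = 0" "p k \<bullet> v = 0" if "k \<in> A \<union> B" for k
        using x(2)[OF span_base, of "p k"] that
        by (auto simp: v_def orthogonal_def inner_commute)
      show ?thesis
        using False p v vp by (intro exI[of _ "p(b := v)"]) auto
    qed
  qed
  from this[of UNIV] that show ?thesis by auto
qed

text \<open>Complete the earlier Gram-Schmidt vectors to an orthonormal basis and take it as the
  rows of a rotation \<open>T\<close>. In the new coordinates the residual consists of the entries k
  \<ge> i, and their number gives the shape of the gamma law.\<close>

lemma nn_integral_gaussian_residual:
  fixes g :: "('n::{finite,linorder}) rmat" and F :: "real \<Rightarrow> ennreal"
  assumes c: "c > 0" and [measurable]: "F \<in> borel_measurable borel"
    and g: "\<And>k. k < i \<Longrightarrow> gs_residual g k \<noteq> 0"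
  shows "(\<integral>\<^sup>+x. F (c * (norm (x - (\<Sum>k | k < i. (x \<bullet> gs g k) *\<^sub>R gs g k)))\<^sup>2) *
      ennreal (exp (- c * (norm x)\<^sup>2)) \<partial>lborel) =
    ennreal ((pi / c) powr (real CARD('n) / 2)) *
      (\<integral>\<^sup>+t. F t * ennreal (gamma_density (card {k. i \<le> k} / 2) t) \<partial>lborel)"
proof -
  obtain p where p: "\<And>k. k < i \<Longrightarrow> p k = gs g k" "\<And>j k. p j \<bullet> p k = (if j = k then 1 else 0)"
    by (rule orthonormal_family_extend[of "{k. k < i}" "gs g"]) (use g in \<open>auto simp: inner_gs\<close>)
  define T where "T = (\<chi> k. p k)"
  have "orthogonal_matrix T"
    unfolding orthogonal_matrix_orthonormal_rows T_def
    by (auto simp: row_def orthogonal_def p(2) norm_eq_1)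
  then have T: "orthogonal_transformation ((*v) T)"
    by (simp add: orthogonal_transformation_matrix)
  have [measurable]: "(*v) T \<in> borel_measurable borel"
    by (intro borel_measurable_continuous_onI matrix_vector_mult_linear_continuous_on)
  have T_nth: "(T *v x) $ k = x \<bullet> p k" for x k
    by (simp add: T_def matrix_vector_mult_def inner_vec_def mult.commute)
  have residual: "(norm (x - (\<Sum>k | k < i. (x \<bullet> gs g k) *\<^sub>R gs g k)))\<^sup>2 = (\<Sum>k | i \<le> k. ((T *v x) $ k)\<^sup>2)" for x
  proof -
    let ?y = "x - (\<Sum>k | k < i. (x \<bullet> gs g k) *\<^sub>R gs g k)"
    have y: "(T *v ?y) $ k = (if i \<le> k then (T *v x) $ k else 0)" for k
    proof -
      have "(T *v ?y) $ k = x \<bullet> p k - (\<Sum>k' | k' < i. (x \<bullet> p k') * (p k' \<bullet> p k))"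
        by (simp add: T_nth inner_diff_left inner_sum_left p(1))
      also have "(\<Sum>k' | k' < i. (x \<bullet> p k') * (p k' \<bullet> p k)) = (\<Sum>k' | k' < i. if k' = k then x \<bullet> p k else 0)"
        by (intro sum.cong) (auto simp: p(2))
      finally show ?thesis by (auto simp: T_nth)
    qed
    have "(norm ?y)\<^sup>2 = (norm (T *v ?y))\<^sup>2"
      using orthogonal_transformation_norm[OF T] by simp
    also have "\<dots> = (\<Sum>k\<in>UNIV. if i \<le> k then ((T *v x) $ k)\<^sup>2 else 0)"
      unfolding power2_norm_vec y by (intro sum.cong) auto
    also have "\<dots> = (\<Sum>k | i \<le> k. ((T *v x) $ k)\<^sup>2)"
      by (simp add: sum.If_cases)
    finally show ?thesis .
  qed
  have [measurable]: "(\<lambda>x :: 'n rvec. \<Sum>k | i \<le> k. (x $ k)\<^sup>2) \<in> borel_measurable borel"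
    by (intro borel_measurable_continuous_onI continuous_intros)
  have "(\<integral>\<^sup>+x. F (c * (norm (x - (\<Sum>k | k < i. (x \<bullet> gs g k) *\<^sub>R gs g k)))\<^sup>2) *
      ennreal (exp (- c * (norm x)\<^sup>2)) \<partial>lborel) =
    (\<integral>\<^sup>+x. F (c * (\<Sum>k | i \<le> k. ((T *v x) $ k)\<^sup>2)) * ennreal (exp (- c * (norm (T *v x))\<^sup>2)) \<partial>lborel)"
    unfolding residual by (simp add: orthogonal_transformation_norm[OF T])
  also have "\<dots> = (\<integral>\<^sup>+x. F (c * (\<Sum>k | i \<le> k. (x $ k)\<^sup>2)) * ennreal (exp (- c * (norm x)\<^sup>2))
      \<partial>distr lborel borel ((*v) T))"
    by (subst nn_integral_distr) auto
  also have "\<dots> = ennreal ((pi / c) powr (real CARD('n) / 2)) *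
      (\<integral>\<^sup>+t. F t * ennreal (gamma_density (card {k. i \<le> k} / 2) t) \<partial>lborel)"
    unfolding lborel_distr_orthogonal_transformation[OF T]
    using c by (intro nn_integral_gaussian_coordinates) auto
  finally show ?thesis .
qed

section \<open>Gram-Schmidt residuals of a Gaussian matrix\<close>

lemma borel_measurable_vec_nth [measurable]:
  "(\<lambda>x :: 'a::real_normed_vector ^ 'n. x $ i) \<in> borel_measurable borel"
  by (intro borel_measurable_continuous_onI continuous_intros)

lemma nn_integral_gaussian_matrix:
  assumes c: "c > 0"
  shows "(\<integral>\<^sup>+g. ennreal (exp (- c * (norm (g :: real^'n^'m))\<^sup>2)) \<partial>lborel) =
    ennreal ((pi / c) powr (real (CARD('m) * CARD('n)) / 2))"
proof -
  interpret product_sigma_finite "\<lambda>_::'m. lborel :: (real^'n) measure" ..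
  have row: "(\<integral>\<^sup>+x. ennreal (exp (- c * (norm (x :: real^'n))\<^sup>2)) \<partial>lborel) = ennreal ((pi / c) powr (real CARD('n) / 2))"
    using nn_integral_gaussian_coordinates[of "UNIV :: 'n set" c "\<lambda>_. 1"] c
    by (simp add: nn_integral_gamma_density)
  have "(\<integral>\<^sup>+g. ennreal (exp (- c * (norm (g :: real^'n^'m))\<^sup>2)) \<partial>lborel) =
      (\<integral>\<^sup>+f. (\<Prod>i\<in>UNIV. ennreal (exp (- c * (norm (f i))\<^sup>2))) \<partial>Pi\<^sub>M (UNIV :: 'm set) (\<lambda>_. lborel :: (real^'n) measure))"
    by (subst nn_integral_vec_eq_PiM)
      (auto simp: power2_norm_vec[of "vec_lambda _"] prod_ennreal exp_sum[symmetric] sum_distrib_left sum_negf)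
  also have "\<dots> = (\<Prod>i\<in>(UNIV :: 'm set). \<integral>\<^sup>+x. ennreal (exp (- c * (norm (x :: real^'n))\<^sup>2)) \<partial>lborel)"
    by (rule product_nn_integral_prod) auto
  also have "\<dots> = (\<Prod>i\<in>(UNIV :: 'm set). ennreal ((pi / c) powr (real CARD('n) / 2)))"
    unfolding row ..
  also have "\<dots> = ennreal ((pi / c) powr (real (CARD('m) * CARD('n)) / 2))"
    using c by (simp add: ennreal_power powr_realpow[symmetric] powr_powr mult.commute)
  finally show ?thesis .
qed

text \<open>The row with the largest index in the initial segment \<open>D\<close> is integrated
  out: the other factors do not involve it, and the law of its residual is the same for all
  independent earlier rows. Dependent earlier rows are harmless because \<open>F i 0 = 0\<close>
  makes the product vanish there.\<close>

lemma nn_integral_gaussian_residuals_aux: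
  fixes F :: "'n::{finite,linorder} \<Rightarrow> real \<Rightarrow> ennreal"
  assumes c: "c > 0" and F [measurable]: "\<And>i. F i \<in> borel_measurable borel" and F0: "\<And>i. F i 0 = 0"
    and D: "\<And>i j. i \<in> D \<Longrightarrow> j \<le> i \<Longrightarrow> j \<in> D"
  shows "(\<integral>\<^sup>+g. (\<Prod>i\<in>D. F i (c * (norm (gs_residual g i))\<^sup>2)) * ennreal (exp (- c * (norm g)\<^sup>2)) \<partial>lborel) =
    ennreal ((pi / c) powr (real (CARD('n) * CARD('n)) / 2)) *
      (\<Prod>i\<in>D. \<integral>\<^sup>+t. F i t * ennreal (gamma_density (card {k. i \<le> k} / 2) t) \<partial>lborel)"
  using finite[of D] D
proof (induction D rule: finite_linorder_max_induct)
  case empty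
  then show ?case using nn_integral_gaussian_matrix[OF c] by simp
next
  case (insert i D)
  have "k \<in> D" if "k < i" for k
    using insert.prems[OF insertI1 less_imp_le[OF that]] that by auto
  then have D: "D = {k. k < i}"
    using insert.hyps by auto
  have iD: "i \<notin> D" by (simp add: D)
  have ins: "(\<Prod>k\<in>insert i D. G k) = G i * (\<Prod>k\<in>D. G k)" for G :: "'n \<Rightarrow> ennreal"
    using iD by simp
  let ?I = "\<integral>\<^sup>+t. F i t * ennreal (gamma_density (card {k. i \<le> k} / 2) t) \<partial>lborel"
  let ?P = "\<lambda>g. \<Prod>k\<in>D. F k (c * (norm (gs_residual g k))\<^sup>2)"
  let ?E = "\<lambda>g :: 'n rmat. ennreal (exp (- c * (norm g)\<^sup>2))"
  let ?C = "ennreal ((pi / c) powr (real CARD('n) / 2))"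
  \<comment> \<open>Overwriting row \<open>i\<close> by 0 names the part of each expression that is
    free of the integration variable.\<close>
  have norm_upd: "(norm (vec_lambda (f(i := x))))\<^sup>2 = (norm (vec_lambda (f(i := 0))))\<^sup>2 + (norm x)\<^sup>2"
    for f and x :: "'n rvec"
    unfolding power2_norm_vec[of "vec_lambda _"]
    by (simp add: sum.remove[of UNIV i])
  have E_upd: "?E (vec_lambda (f(i := x))) = ?E (vec_lambda (f(i := 0))) * ennreal (exp (- c * (norm x)\<^sup>2))"
    for f and x :: "'n rvec"
    by (simp add: norm_upd[of f x] ring_distribs exp_diff exp_minus ennreal_mult[symmetric] divide_inverse)
  have P_upd: "?P (vec_lambda (f(i := x))) = ?P (vec_lambda (f(i := 0)))" for f and x :: "'n rvec"
  proof (intro prod.cong refl)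
    fix k assume "k \<in> D"
    then have "gs_residual (vec_lambda (f(i := x))) k = gs_residual (vec_lambda (f(i := 0))) k"
      by (intro gs_residual_cong) (auto simp: D)
    then show "F k (c * (norm (gs_residual (vec_lambda (f(i := x))) k))\<^sup>2) =
        F k (c * (norm (gs_residual (vec_lambda (f(i := 0))) k))\<^sup>2)" by simp
  qed
  have gauss: "(\<integral>\<^sup>+x. ennreal (exp (- c * (norm (x :: 'n rvec))\<^sup>2)) \<partial>lborel) = ?C"
    using nn_integral_gaussian_coordinates[of "UNIV :: 'n set" c "\<lambda>_. 1"] c
    by (simp add: nn_integral_gamma_density)
  have row: "(\<integral>\<^sup>+x. F i (c * (norm (gs_residual (vec_lambda (f(i := x))) i))\<^sup>2) * ennreal (exp (- c * (norm x)\<^sup>2)) \<partial>lborel) =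
      ?C * ?I" if "?P (vec_lambda (f(i := 0))) \<noteq> 0" for f
  proof -
    have nz: "gs_residual (vec_lambda (f(i := 0))) k \<noteq> 0" if "k < i" for k
    proof
      assume "gs_residual (vec_lambda (f(i := 0))) k = 0"
      then have "?P (vec_lambda (f(i := 0))) = 0"
        using that by (intro prod_zero bexI[of _ k]) (auto simp: F0 D)
      then show False using \<open>?P (vec_lambda (f(i := 0))) \<noteq> 0\<close> by simp
    qed
    have gs: "gs (vec_lambda (f(i := x))) k = gs (vec_lambda (f(i := 0))) k" if "k < i" for k x
      using that by (intro gs_cong) auto
    have "gs_residual (vec_lambda (f(i := x))) i =
        x - (\<Sum>k | k < i. (x \<bullet> gs (vec_lambda (f(i := 0))) k) *\<^sub>R gs (vec_lambda (f(i := 0))) k)" for x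
      unfolding gs_residual_def using gs[of _ x] by (intro arg_cong2[where f = "(-)"] sum.cong) auto
    then show ?thesis
      using nn_integral_gaussian_residual[OF c F nz] by simp
  qed
  have "(\<integral>\<^sup>+g. (\<Prod>k\<in>insert i D. F k (c * (norm (gs_residual g k))\<^sup>2)) * ?E g \<partial>lborel) =
      (\<integral>\<^sup>+f. \<integral>\<^sup>+x. (?P (vec_lambda (f(i := 0))) * ?E (vec_lambda (f(i := 0)))) *
        (F i (c * (norm (gs_residual (vec_lambda (f(i := x))) i))\<^sup>2) * ennreal (exp (- c * (norm x)\<^sup>2)))
        \<partial>lborel \<partial>Pi\<^sub>M (- {i}) (\<lambda>_. lborel))"
  proof (subst nn_integral_vec_component[where i = i], simp, intro nn_integral_cong)
    fix f :: "'n \<Rightarrow> 'n rvec" and x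
    show "(\<Prod>k\<in>insert i D. F k (c * (norm (gs_residual (vec_lambda (f(i := x))) k))\<^sup>2)) * ?E (vec_lambda (f(i := x))) =
        (?P (vec_lambda (f(i := 0))) * ?E (vec_lambda (f(i := 0)))) *
        (F i (c * (norm (gs_residual (vec_lambda (f(i := x))) i))\<^sup>2) * ennreal (exp (- c * (norm x)\<^sup>2)))"
      unfolding E_upd[of f x] ins P_upd[of f x] by (simp only: mult_ac)
  qed
  also have "\<dots> = (\<integral>\<^sup>+f. ?P (vec_lambda (f(i := 0))) * ?E (vec_lambda (f(i := 0))) * (?C * ?I)
      \<partial>Pi\<^sub>M (- {i}) (\<lambda>_. lborel))"
  proof (rule nn_integral_cong)
    fix f :: "'n \<Rightarrow> 'n rvec" assume f: "f \<in> space (Pi\<^sub>M (- {i}) (\<lambda>_. lborel))"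
    have [measurable]: "(\<lambda>x. vec_lambda (f(i := x))) \<in> borel_measurable borel"
    proof (intro borel_measurable_continuous_onI continuous_on_vec_lambda)
      show "continuous_on UNIV (\<lambda>x. (f(i := x)) j)" for j
        by (cases "j = i") auto
    qed
    show "(\<integral>\<^sup>+x. (?P (vec_lambda (f(i := 0))) * ?E (vec_lambda (f(i := 0)))) *
        (F i (c * (norm (gs_residual (vec_lambda (f(i := x))) i))\<^sup>2) * ennreal (exp (- c * (norm x)\<^sup>2))) \<partial>lborel) =
      ?P (vec_lambda (f(i := 0))) * ?E (vec_lambda (f(i := 0))) * (?C * ?I)"
    proof (cases "?P (vec_lambda (f(i := 0))) = 0")
      case True
      show ?thesis unfolding True by simp
    next
      case False
      show ?thesis
        by (subst nn_integral_cmult, simp, subst row[OF False], rule refl)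
    qed
  qed
  \<comment> \<open>The constant \<open>?C\<close> is written again as a Gaussian integral over row
    \<open>i\<close>. The integral is then over whole matrices, which is the form of the induction
    hypothesis, and the overall constant is the same for every \<open>D\<close>.\<close>
  also have "\<dots> = (\<integral>\<^sup>+f. \<integral>\<^sup>+x. ?I * (?P (vec_lambda (f(i := x))) * ?E (vec_lambda (f(i := x)))) \<partial>lborel
      \<partial>Pi\<^sub>M (- {i}) (\<lambda>_. lborel))"
  proof (rule nn_integral_cong)
    fix f :: "'n \<Rightarrow> 'n rvec"
    have "(\<integral>\<^sup>+x. ?I * (?P (vec_lambda (f(i := x))) * ?E (vec_lambda (f(i := x)))) \<partial>lborel) =
        (\<integral>\<^sup>+x. ?I * (?P (vec_lambda (f(i := 0))) * ?E (vec_lambda (f(i := 0)))) * ennreal (exp (- c * (norm (x :: 'n rvec))\<^sup>2)) \<partial>lborel)"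
    proof (rule nn_integral_cong)
      fix x
      show "?I * (?P (vec_lambda (f(i := x))) * ?E (vec_lambda (f(i := x)))) =
          ?I * (?P (vec_lambda (f(i := 0))) * ?E (vec_lambda (f(i := 0)))) * ennreal (exp (- c * (norm x)\<^sup>2))"
        unfolding E_upd[of f x] P_upd[of f x] by (simp only: mult_ac)
    qed
    also have "\<dots> = ?I * (?P (vec_lambda (f(i := 0))) * ?E (vec_lambda (f(i := 0)))) * ?C"
      by (subst nn_integral_cmult) (simp, simp only: gauss)
    finally show "?P (vec_lambda (f(i := 0))) * ?E (vec_lambda (f(i := 0))) * (?C * ?I) =
        (\<integral>\<^sup>+x. ?I * (?P (vec_lambda (f(i := x))) * ?E (vec_lambda (f(i := x)))) \<partial>lborel)"
      by (simp only: mult_ac)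
  qed
  also have "\<dots> = (\<integral>\<^sup>+g. ?I * (?P g * ?E g) \<partial>lborel)"
    by (subst nn_integral_vec_component[where i = i]) auto
  also have "\<dots> = ?I * (\<integral>\<^sup>+g. ?P g * ?E g \<partial>lborel)"
    by (rule nn_integral_cmult) auto
  also have "(\<integral>\<^sup>+g. ?P g * ?E g \<partial>lborel) = ennreal ((pi / c) powr (real (CARD('n) * CARD('n)) / 2)) *
      (\<Prod>i\<in>D. \<integral>\<^sup>+t. F i t * ennreal (gamma_density (card {k. i \<le> k} / 2) t) \<partial>lborel)"
    by (rule insert.IH) (auto simp: D)
  finally show ?case
    using iD by (simp add: mult_ac)
qed

lemma sets_invertible [measurable]: "{g :: ('n::{finite,linorder}) rmat. invertible g} \<in> sets borel"
proof -
  have "{g :: 'n rmat. invertible g} = (\<Inter>i. {g. gs_residual g i \<noteq> 0})"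
    by (auto simp: invertible_iff_gs_residual)
  also have "\<dots> \<in> sets borel"
    by (intro sets.countable_INT'') auto
  finally show ?thesis .
qed

text \<open>Agreement on product sets suffices, and there the factorization just proved gives
  independence and the marginal laws at once. \<open>C\<close> is the total Gaussian mass.\<close>

lemma distr_gaussian_residuals:
  fixes c :: real
  assumes c: "c > 0"
  defines "C \<equiv> (pi / c) powr (real (CARD('n::{finite,linorder}) * CARD('n)) / 2)"
  shows "distr (density lborel (\<lambda>g :: 'n rmat. ennreal (exp (- c * (norm g)\<^sup>2) / C) * indicator {g. invertible g} g))
      (Pi\<^sub>M UNIV (\<lambda>_. borel)) (\<lambda>g i. c * (norm (gs_residual g i))\<^sup>2) =
    Pi\<^sub>M UNIV (\<lambda>i. density lborel (\<lambda>t. ennreal (gamma_density (card {k. i \<le> k} / 2) t)))"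
proof -
  have C: "C > 0" using c by (simp add: C_def)
  let ?M = "\<lambda>i :: 'n. density lborel (\<lambda>t. ennreal (gamma_density (card {k. i \<le> k} / 2) t))"
  have card_pos: "card {k. i \<le> k} > 0" for i :: 'n
    by (subst card_gt_0_iff) auto
  have "finite_measure (?M i)" for i
    using card_pos[of i] by (intro finite_measureI) (simp add: emeasure_density nn_integral_gamma_density)
  then interpret product_sigma_finite ?M
    by (intro product_sigma_finite.intro) (simp add: finite_measure_def)
  let ?X = "\<lambda>(g :: 'n rmat) i. c * (norm (gs_residual g i))\<^sup>2"
  have X [measurable]: "?X \<in> measurable borel (Pi\<^sub>M UNIV (\<lambda>_. borel))"
    by (rule measurable_PiM_single') auto
  show ?thesis
  proof (rule PiM_eqI)
    fix A :: "'n \<Rightarrow> real set"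
    assume "\<And>i. i \<in> UNIV \<Longrightarrow> A i \<in> sets (?M i)"
    then have A [measurable]: "A i \<in> sets borel" for i by simp
    \<comment> \<open>The cut at 0 secures \<open>F i 0 = 0\<close>. It changes neither side:
      invertible matrices have nonzero residuals, and \<open>gamma_density\<close> vanishes for t
      \<le> 0.\<close>
    define F :: "'n \<Rightarrow> real \<Rightarrow> ennreal" where "F i = indicator (A i \<inter> {0<..})" for i
    have [measurable]: "F i \<in> borel_measurable borel" for i
      unfolding F_def by measurable
    have PiE [measurable]: "Pi\<^sub>E UNIV A \<in> sets (Pi\<^sub>M UNIV (\<lambda>_. borel))"
      by (rule sets_PiM_I_finite) auto
    have "emeasure (distr (density lborel (\<lambda>g. ennreal (exp (- c * (norm g)\<^sup>2) / C) * indicator {g. invertible g} g))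
        (Pi\<^sub>M UNIV (\<lambda>_. borel)) ?X) (Pi\<^sub>E UNIV A) =
      (\<integral>\<^sup>+g. ennreal (exp (- c * (norm g)\<^sup>2) / C) * indicator {g. invertible g} g * indicator (?X -` Pi\<^sub>E UNIV A) g \<partial>lborel)"
      using measurable_sets[OF X PiE] by (subst emeasure_distr) (auto simp: emeasure_density)
    also have "\<dots> = (\<integral>\<^sup>+g. ennreal (1 / C) *
        ((\<Prod>i\<in>UNIV. F i (c * (norm (gs_residual g i))\<^sup>2)) * ennreal (exp (- c * (norm g)\<^sup>2))) \<partial>lborel)"
    proof (rule nn_integral_cong)
      fix g :: "'n rmat"
      have "(\<Prod>i\<in>UNIV. F i (c * (norm (gs_residual g i))\<^sup>2)) =
          (if invertible g \<and> (\<forall>i. ?X g i \<in> A i) then 1 else 0)"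
      proof (cases "invertible g \<and> (\<forall>i. ?X g i \<in> A i)")
        case True
        then show ?thesis using c
          by (auto simp: F_def invertible_iff_gs_residual intro!: prod.neutral)
      next
        case False
        then obtain i where "gs_residual g i = 0 \<or> ?X g i \<notin> A i"
          by (auto simp: invertible_iff_gs_residual)
        then have "F i (c * (norm (gs_residual g i))\<^sup>2) = 0"
          by (auto simp: F_def)
        then show ?thesis using False by (auto intro!: prod_zero)
      qed
      then show "ennreal (exp (- c * (norm g)\<^sup>2) / C) * indicator {g. invertible g} g * indicator (?X -` Pi\<^sub>E UNIV A) g =
          ennreal (1 / C) * ((\<Prod>i\<in>UNIV. F i (c * (norm (gs_residual g i))\<^sup>2)) * ennreal (exp (- c * (norm g)\<^sup>2)))"
        using C by (auto simp: PiE_iff ennreal_mult[symmetric] split: split_indicator)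
    qed
    also have "\<dots> = ennreal (1 / C) * (\<integral>\<^sup>+g. (\<Prod>i\<in>UNIV. F i (c * (norm (gs_residual g i))\<^sup>2)) *
        ennreal (exp (- c * (norm g)\<^sup>2)) \<partial>lborel)"
      by (rule nn_integral_cmult) auto
    also have "\<dots> = ennreal (1 / C) * (ennreal C * (\<Prod>i\<in>UNIV. \<integral>\<^sup>+t. F i t * ennreal (gamma_density (card {k. i \<le> k} / 2) t) \<partial>lborel))"
      using c by (subst nn_integral_gaussian_residuals_aux) (auto simp: C_def F_def)
    also have "\<dots> = (\<Prod>i\<in>UNIV. \<integral>\<^sup>+t. F i t * ennreal (gamma_density (card {k. i \<le> k} / 2) t) \<partial>lborel)"
      using C by (simp add: mult.assoc[symmetric] ennreal_mult[symmetric])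
    also have "\<dots> = (\<Prod>i\<in>UNIV. emeasure (?M i) (A i))"
    proof (intro prod.cong refl)
      fix i
      have "emeasure (?M i) (A i) = (\<integral>\<^sup>+t. ennreal (gamma_density (card {k. i \<le> k} / 2) t) * indicator (A i) t \<partial>lborel)"
        by (rule emeasure_density) auto
      then show "(\<integral>\<^sup>+t. F i t * ennreal (gamma_density (card {k. i \<le> k} / 2) t) \<partial>lborel) = emeasure (?M i) (A i)"
        by (simp, intro nn_integral_cong) (auto simp: F_def gamma_density_def split: split_indicator)
    qed
    finally show "emeasure (distr (density lborel (\<lambda>g. ennreal (exp (- c * (norm g)\<^sup>2) / C) * indicator {g. invertible g} g))
        (Pi\<^sub>M UNIV (\<lambda>_. borel)) ?X) (Pi\<^sub>E UNIV A) = (\<Prod>i\<in>UNIV. emeasure (?M i) (A i))" .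
  qed (auto cong: sets_PiM_cong)
qed

section \<open>Complex moments of the gamma law\<close>

lemma borel_measurable_of_real_powr:
  "(\<lambda>t. if 0 < t then complex_of_real t powr z else 0) \<in> borel_measurable borel"
proof -
  have "(\<lambda>t. if t \<in> {0<..} then complex_of_real t powr z else 0) \<in> borel_measurable borel"
    by (intro borel_measurable_continuous_on_if continuous_intros) auto
  then show ?thesis by simp
qed

text \<open>Euler's integral at (z + m) / 2: the density supplies the exponent m / 2 - 1 and
  \<open>f\<close> supplies z / 2. With t = c r^2, the base sqrt (t / c) is the residual norm
  r.\<close>

lemma gamma_density_integral:
  fixes z :: complex and m :: nat
  assumes m: "m > 0" and z: "Re z + real m > 0" and c: "c > 0"
  defines "f \<equiv> \<lambda>t. (if t > 0 then of_real (sqrt (t / c)) powr z else 0) :: complex"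
    and "M \<equiv> density lborel (\<lambda>t. ennreal (gamma_density (real m / 2) t))"
  shows "integrable M f" "integral\<^sup>L M f = of_real c powr (- z / 2) * Gamma ((z + of_nat m) / 2) / Gamma (of_nat m / 2)"
proof -
  let ?w = "(z + of_nat m) / 2"
  let ?K = "of_real c powr (- z / 2) / Gamma (of_nat m / 2) :: complex"
  let ?h = "\<lambda>t. of_real t powr (?w - 1) / of_real (exp t) :: complex"
  have w: "Re ?w > 0" using z by simp
  have eq: "gamma_density (real m / 2) t *\<^sub>R f t = ?K * (indicator {0<..} t *\<^sub>R ?h t)" for t
  proof (cases "t > 0")
    case True
    have 1: "complex_of_real (sqrt (t / c)) powr z = of_real t powr (z / 2) * of_real c powr (- z / 2)"
      using True c
      by (simp add: powr_def ln_sqrt ln_div Ln_of_real exp_add[symmetric] field_simps flip: of_real_sqrt)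
    have 2: "complex_of_real (t powr (real m / 2 - 1)) = of_real t powr (of_nat m / 2 - 1)"
      using True by (simp add: powr_of_real[symmetric])
    have 3: "of_real t powr (?w - 1) = of_real t powr (z / 2) * of_real t powr (of_nat m / 2 - 1 :: complex)"
      by (simp add: powr_add[symmetric] add_divide_distrib add_diff_eq)
    have 4: "complex_of_real (Gamma (real m / 2)) = Gamma (of_nat m / 2)"
      by (simp add: Gamma_complex_of_real[symmetric])
    have "gamma_density (real m / 2) t *\<^sub>R f t = complex_of_real (t powr (real m / 2 - 1)) * of_real (exp (- t)) /
        complex_of_real (Gamma (real m / 2)) * complex_of_real (sqrt (t / c)) powr z"
      using True by (simp add: f_def gamma_density_def scaleR_conv_of_real)
    also have "\<dots> = ?K * (1 *\<^sub>R ?h t)"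
      unfolding 1 2 3 4 exp_minus of_real_inverse scaleR_one by (simp only: divide_inverse mult_ac)
    finally show ?thesis using True by simp
  qed (simp add: gamma_density_def)
  have [measurable]: "f \<in> borel_measurable borel"
  proof -
    have "(\<lambda>t. if 0 < sqrt (t / c) then complex_of_real (sqrt (t / c)) powr z else 0) \<in> borel_measurable borel"
      by (rule measurable_compose[OF _ borel_measurable_of_real_powr]) measurable
    then show ?thesis using c by (simp add: f_def zero_less_divide_iff)
  qed
  have pos: "gamma_density (real m / 2) t \<ge> 0" for t
    using m by (intro gamma_density_nonneg) auto
  have int: "set_integrable lebesgue {0<..} ?h"
    by (rule absolutely_integrable_Gamma_integral'[OF w])
  have meas: "(\<lambda>t. indicator {0<..} t *\<^sub>R ?h t) \<in> borel_measurable borel"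
    by (intro borel_measurable_continuous_on_indicator continuous_intros) auto
  \<comment> \<open>Euler's integral lives on the completed measure; Borel measurability of the
    integrand brings it down to \<open>lborel\<close>.\<close>
  have int': "integrable lborel (\<lambda>t. indicator {0<..} t *\<^sub>R ?h t)"
    using int meas by (simp add: set_integrable_def integrable_completion)
  have "integrable lborel (\<lambda>t. gamma_density (real m / 2) t *\<^sub>R f t)"
    unfolding eq by (rule integrable_mult_right[OF int'])
  then show "integrable M f"
    unfolding M_def by (subst integrable_density) (auto simp: pos)
  have "integral\<^sup>L M f = (\<integral>t. gamma_density (real m / 2) t *\<^sub>R f t \<partial>lborel)"
    unfolding M_def by (rule integral_density) (auto simp: pos)
  also have "\<dots> = ?K * (\<integral>t. indicator {0<..} t *\<^sub>R ?h t \<partial>lborel)"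
    unfolding eq by (rule integral_mult_right_zero)
  also have "(\<integral>t. indicator {0<..} t *\<^sub>R ?h t \<partial>lborel) = (\<integral>t. indicator {0<..} t *\<^sub>R ?h t \<partial>lebesgue)"
    using meas by (simp add: integral_completion)
  also have "\<dots> = integral {0<..} ?h"
    using set_lebesgue_integral_eq_integral(2)[OF int] by (simp add: set_lebesgue_integral_def)
  also have "\<dots> = Gamma ?w"
    using Gamma_integral_complex'[OF w] by (rule integral_unique)
  finally show "integral\<^sup>L M f = of_real c powr (- z / 2) * Gamma ((z + of_nat m) / 2) / Gamma (of_nat m / 2)"
    by simp
qed

section \<open>Iwasawa decomposition\<close>

lemma lower_pos_mult:
  assumes "a \<in> lower_pos" "b \<in> lower_pos"
  shows "a ** b \<in> lower_pos" "(a ** b) $ i $ i = a $ i $ i * b $ i $ i"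
proof -
  have above: "(a ** b) $ i $ j = 0" if "i < j" for i j
  proof -
    have "a $ i $ k * b $ k $ j = 0" for k
      using assms that by (cases "i < k") (auto simp: lower_pos_def)
    then show ?thesis
      unfolding matrix_matrix_mult_def vec_lambda_beta by (intro sum.neutral ballI)
  qed
  have diag: "(a ** b) $ i $ i = a $ i $ i * b $ i $ i" for i
  proof -
    have "(a ** b) $ i $ i = (\<Sum>k\<in>UNIV. if k = i then a $ i $ i * b $ i $ i else 0)"
      unfolding matrix_matrix_mult_def vec_lambda_beta
    proof (intro sum.cong refl)
      fix k show "a $ i $ k * b $ k $ i = (if k = i then a $ i $ i * b $ i $ i else 0)"
        using assms by (cases k i rule: linorder_cases) (auto simp: lower_pos_def)
    qed
    then show ?thesis by simp
  qed
  show "a ** b \<in> lower_pos"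
    using assms above diag by (auto simp: lower_pos_def)
  show "(a ** b) $ i $ i = a $ i $ i * b $ i $ i" by (rule diag)
qed

text \<open>Once the earlier rows are known to be basis vectors, orthogonality to them clears row
  \<open>i\<close> left of the diagonal; the unit norm and the positive sign fix the diagonal entry.
  This is the uniqueness in the Iwasawa decomposition.\<close>

lemma orthogonal_lower_pos:
  assumes o: "orthogonal_matrix b" and b: "b \<in> lower_pos"
  shows "b = mat 1"
proof -
  have "b $ i = axis i 1" for i
  proof (induction i rule: finite_linorder_less_induct)
    case (less i)
    have "b $ i $ k = 0" if "k \<noteq> i" for k
    proof (cases "k < i")
      case True
      have "orthogonal (b $ i) (b $ k)"
        using o True by (simp add: orthogonal_matrix_orthonormal_rows row_def)
      then show ?thesis
        using less[OF True] by (simp add: orthogonal_def inner_axis)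
    qed (use b that in \<open>auto simp: lower_pos_def\<close>)
    then have eq: "b $ i = b $ i $ i *\<^sub>R axis i 1"
      by (auto simp: vec_eq_iff axis_def)
    have "norm (b $ i) = 1"
      using o by (simp add: orthogonal_matrix_orthonormal_rows row_def)
    then have "\<bar>b $ i $ i\<bar> = 1"
      by (subst (asm) eq) simp
    moreover have "b $ i $ i > 0" using b by (simp add: lower_pos_def)
    ultimately show ?case using eq by simp
  qed
  then show ?thesis
    by (auto simp: vec_eq_iff mat_def axis_def)
qed

lemma invertible_lower_pos: "b \<in> lower_pos \<Longrightarrow> invertible b"
  unfolding invertible_det_nz by (subst det_lower_triangular) (auto simp: lower_pos_def prod_zero_iff less_le)

lemma matrix_inv:
  fixes a :: "'a::semiring_1^'n^'m"
  assumes "invertible a"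
  shows "matrix_inv a ** a = mat 1" "a ** matrix_inv a = mat 1"
  using someI_ex[OF assms[unfolded invertible_def]] by (simp_all add: matrix_inv_def)

lemma matrix_inv_mult:
  fixes a b :: "real^'n^'n"
  assumes "invertible a" "invertible b"
  shows "matrix_inv (a ** b) = matrix_inv b ** matrix_inv a"
proof -
  have "(matrix_inv b ** matrix_inv a) ** (a ** b) = matrix_inv b ** (matrix_inv a ** a) ** b"
    by (simp only: matrix_mul_assoc)
  also have "\<dots> = mat 1"
    using assms by (simp add: matrix_inv)
  finally have "(matrix_inv b ** matrix_inv a) ** (a ** b) = mat 1" .
  moreover have "(a ** b) ** matrix_inv (a ** b) = mat 1"
    using assms by (intro matrix_inv invertible_mult)
  ultimately show ?thesis
    by (metis matrix_mul_assoc matrix_mul_lid matrix_mul_rid)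
qed

lemma matrix_inv_eqI:
  fixes a b :: "real^'n^'n"
  assumes "b ** a = mat 1"
  shows "matrix_inv a = b"
proof -
  have "invertible a"
    using assms by (metis invertible_left_inverse)
  then show ?thesis
    by (metis assms matrix_inv(2) matrix_mul_assoc matrix_mul_lid matrix_mul_rid)
qed

lemma matrix_inv_orthogonal: "orthogonal_matrix k \<Longrightarrow> matrix_inv k = transpose k"
  for k :: "real^'n^'n"
  by (rule matrix_inv_eqI) (simp add: orthogonal_matrix_def)

lemma invertible_orthogonal: "orthogonal_matrix k \<Longrightarrow> invertible k"
  for k :: "real^'n^'n"
  by (auto simp: orthogonal_matrix_def invertible_def)

text \<open>Apply Gram-Schmidt to the inverse. Then \<open>b\<close> times its triangular factor is
  both orthogonal and in \<open>lower_pos\<close>, hence the identity, so the orthogonal factor is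
  trivial and the inverse is its own triangular factor.\<close>

lemma lower_pos_matrix_inv:
  fixes b :: "('n::{finite,linorder}) rmat"
  assumes b: "b \<in> lower_pos"
  shows "matrix_inv b \<in> lower_pos" "matrix_inv b $ i $ i = 1 / b $ i $ i"
proof -
  let ?g = "matrix_inv b"
  have inv: "invertible b" using b by (rule invertible_lower_pos)
  then have g: "invertible ?g"
    by (metis invertible_def matrix_inv)
  have one: "b ** gs_l ?g ** gs_q ?g = mat 1"
    using matrix_inv(2)[OF inv] by (simp add: matrix_mul_assoc[symmetric] gs_l_mult_gs_q)
  have q: "orthogonal_matrix (gs_q ?g)" by (rule orthogonal_gs_q'[OF g])
  have "b ** gs_l ?g = b ** gs_l ?g ** (gs_q ?g ** transpose (gs_q ?g))"
    using q by (simp add: orthogonal_matrix_def)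
  also have "\<dots> = transpose (gs_q ?g)"
    by (simp add: matrix_mul_assoc one)
  finally have eq: "b ** gs_l ?g = transpose (gs_q ?g)" .
  have "transpose (gs_q ?g) = mat 1"
  proof (rule orthogonal_lower_pos)
    show "orthogonal_matrix (transpose (gs_q ?g))"
      using q by (simp add: orthogonal_matrix_transpose)
    show "transpose (gs_q ?g) \<in> lower_pos"
      unfolding eq[symmetric] using b g by (intro lower_pos_mult gs_l_lower_pos)
  qed
  then have "gs_q ?g = mat 1"
    by (metis transpose_mat transpose_transpose)
  then have "gs_l ?g = ?g"
    using gs_l_mult_gs_q[of ?g] by simp
  then show *: "?g \<in> lower_pos"
    using gs_l_lower_pos[OF g] by simp
  have "b $ i $ i * ?g $ i $ i = 1"
    using lower_pos_mult(2)[OF b *, of i] matrix_inv(2)[OF inv] by (simp add: mat_def)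
  then show "?g $ i $ i = 1 / b $ i $ i"
    by (metis div_by_0 mult_cancel_left1 nonzero_eq_divide_eq mult.commute mult_zero_left)
qed

text \<open>Splitting the diagonal off \<open>b\<close> gives existence. For uniqueness, the
  quotient of two orthogonal parts equals a quotient of triangular parts, so it is the identity by
  \<open>orthogonal_lower_pos\<close>.\<close>

lemma iwasawa_eq:
  fixes k b :: "('n::{finite,linorder}) rmat"
  assumes k: "orthogonal_matrix k" and b: "b \<in> lower_pos"
  shows "iwasawa (k ** b) = (k, diag_mat (\<lambda>i. b $ i $ i), diag_mat (\<lambda>i. 1 / b $ i $ i) ** b)"
  unfolding iwasawa_def
proof (rule the_equality)
  let ?a = "diag_mat (\<lambda>i. b $ i $ i)" and ?n = "diag_mat (\<lambda>i. 1 / b $ i $ i) ** b"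
  have diag: "(diag_mat d ** m) $ i $ j = d i * m $ i $ j" for d and m :: "'n rmat" and i j
    by (simp add: matrix_matrix_mult_def diag_mat_def if_distrib[of "\<lambda>x. x * _"] cong: if_cong)
  have pos: "b $ i $ i > 0" "b $ i $ i \<noteq> 0" for i
    using b by (auto simp: lower_pos_def less_le)
  have "?a ** ?n = b"
    using pos by (simp add: vec_eq_iff diag)
  then have "k ** b = k ** ?a ** ?n"
    by (simp add: matrix_mul_assoc[symmetric])
  moreover have "?a \<in> posdiag"
    using pos by (auto simp: posdiag_def diag_mat_def)
  moreover have "?n \<in> lower_unipotent"
    using b pos by (auto simp: lower_unipotent_def lower_pos_def diag)
  ultimately show "case (k, ?a, ?n) of (k', a, n) \<Rightarrow>
      orthogonal_matrix k' \<and> a \<in> posdiag \<and> n \<in> lower_unipotent \<and> k ** b = k' ** a ** n"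
    using k by simp
  fix p :: "'n rmat \<times> 'n rmat \<times> 'n rmat"
  assume "case p of (k', a, n) \<Rightarrow>
      orthogonal_matrix k' \<and> a \<in> posdiag \<and> n \<in> lower_unipotent \<and> k ** b = k' ** a ** n"
  then obtain k' a n where p: "p = (k', a, n)" and k': "orthogonal_matrix k'" and a: "a \<in> posdiag"
    and n: "n \<in> lower_unipotent" and eq: "k ** b = k' ** a ** n"
    by (cases p) auto
  have a': "a = diag_mat (\<lambda>i. a $ i $ i)"
    using a by (auto simp: posdiag_def diag_mat_def vec_eq_iff)
  have an: "(a ** n) $ i $ j = a $ i $ i * n $ i $ j" for i j
    by (subst a') (rule diag)
  have b': "a ** n \<in> lower_pos"
    using a n by (auto simp: lower_pos_def an posdiag_def lower_unipotent_def)
  have "transpose k' ** k = transpose k' ** (k ** b) ** matrix_inv b"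
    using matrix_inv(2)[OF invertible_lower_pos[OF b]] by (simp add: matrix_mul_assoc[symmetric])
  also have "\<dots> = (transpose k' ** k') ** (a ** n) ** matrix_inv b"
    unfolding eq by (simp only: matrix_mul_assoc)
  also have "\<dots> = (a ** n) ** matrix_inv b"
    using k' by (simp add: orthogonal_matrix_def)
  finally have "transpose k' ** k = (a ** n) ** matrix_inv b" .
  moreover have "orthogonal_matrix (transpose k' ** k)"
    using k k' by (intro orthogonal_matrix_mul) (simp_all add: orthogonal_matrix_transpose)
  moreover have "(a ** n) ** matrix_inv b \<in> lower_pos"
    by (rule lower_pos_mult(1)[OF b' lower_pos_matrix_inv(1)[OF b]])
  ultimately have one: "transpose k' ** k = mat 1"
    by (metis orthogonal_lower_pos)
  have "k = k' ** (transpose k' ** k)"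
    using k' by (simp add: matrix_mul_assoc orthogonal_matrix_def)
  then have kk: "k = k'" by (simp add: one)
  have "b = transpose k ** (k ** b)"
    using k by (simp add: matrix_mul_assoc orthogonal_matrix_def)
  also have "\<dots> = transpose k ** (k' ** a ** n)"
    by (simp only: eq)
  also have "\<dots> = (transpose k ** k) ** (a ** n)"
    by (simp only: kk matrix_mul_assoc)
  finally have ban: "b = a ** n"
    using k by (simp add: orthogonal_matrix_def)
  have bij: "b $ i $ j = a $ i $ i * n $ i $ j" for i j
    by (simp add: ban an)
  have n1: "n $ i $ i = 1" for i
    using n by (simp add: lower_unipotent_def)
  have "a = ?a"
    by (subst a') (simp add: bij n1)
  moreover have "n = ?n"
  proof -
    have "a $ i $ i \<noteq> 0" for i using a by (auto simp: posdiag_def less_le)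
    then show ?thesis
      by (simp add: vec_eq_iff diag bij n1)
  qed
  ultimately show "p = (k, ?a, ?n)"
    using kk p by simp
qed

lemma spherical_vec_eq:
  fixes k b :: "('n::{finite,linorder}) rmat"
  assumes "orthogonal_matrix k" "b \<in> lower_pos"
  shows "spherical_vec \<epsilon> \<gamma> (k ** b) = minor k {i. \<epsilon> i = 1} {i. \<epsilon> i = 1} *
    (\<Prod>j\<in>UNIV. of_real (b $ j $ j) powr (\<i> * of_real (\<gamma> $ j) + of_real (rho j)))"
  unfolding spherical_vec_def iwasawa_eq[OF assms]
  by (simp add: ext_inner_piW_basis_vec chi_B_def diag_mat_def)

text \<open>Row orthogonalization puts the triangular factor on the left. Applying it to the inverse
  of \<open>h\<close> and inverting again yields the required order.\<close>

lemma iwasawa_exists: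
  fixes h :: "('n::{finite,linorder}) rmat"
  assumes "invertible h"
  obtains k b where "orthogonal_matrix k" "b \<in> lower_pos" "h = k ** b"
proof -
  let ?g = "matrix_inv h"
  have g: "invertible ?g"
    by (metis assms invertible_def matrix_inv)
  have "h = matrix_inv ?g"
    by (rule matrix_inv_eqI[symmetric]) (rule matrix_inv[OF assms])
  also have "\<dots> = matrix_inv (gs_l ?g ** gs_q ?g)"
    by (simp add: gs_l_mult_gs_q)
  also have "\<dots> = transpose (gs_q ?g) ** matrix_inv (gs_l ?g)"
    by (simp add: matrix_inv_mult invertible_lower_pos gs_l_lower_pos g orthogonal_gs_q'
        invertible_orthogonal matrix_inv_orthogonal)
  finally show ?thesis
    using that orthogonal_gs_q'[OF g] lower_pos_matrix_inv[OF gs_l_lower_pos[OF g]]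
    by (metis orthogonal_matrix_transpose)
qed

lemma spherical_vec_inverse_mult:
  fixes g b :: "('n::{finite,linorder}) rmat"
  assumes g: "invertible g" and b: "b \<in> lower_pos"
  shows "spherical_vec \<epsilon> \<gamma> (matrix_inv g ** b) = minor (transpose (gs_q g)) {i. \<epsilon> i = 1} {i. \<epsilon> i = 1} *
    (\<Prod>j\<in>UNIV. of_real (b $ j $ j / norm (gs_residual g j)) powr (\<i> * of_real (\<gamma> $ j) + of_real (rho j)))"
proof -
  have l: "gs_l g \<in> lower_pos" and q: "orthogonal_matrix (gs_q g)"
    using g by (simp_all add: gs_l_lower_pos orthogonal_gs_q')
  have "matrix_inv g = matrix_inv (gs_l g ** gs_q g)"
    by (simp add: gs_l_mult_gs_q)
  also have "\<dots> = transpose (gs_q g) ** matrix_inv (gs_l g)"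
    using l q by (simp add: matrix_inv_mult invertible_lower_pos invertible_orthogonal matrix_inv_orthogonal)
  finally have "matrix_inv g ** b = transpose (gs_q g) ** (matrix_inv (gs_l g) ** b)"
    by (simp add: matrix_mul_assoc)
  moreover have "(matrix_inv (gs_l g) ** b) $ j $ j = b $ j $ j / norm (gs_residual g j)" for j
    using lower_pos_mult(2)[OF lower_pos_matrix_inv(1)[OF l] b] lower_pos_matrix_inv(2)[OF l]
    by (simp add: gs_l_diag)
  moreover have "matrix_inv (gs_l g) ** b \<in> lower_pos"
    using l b by (intro lower_pos_mult lower_pos_matrix_inv)
  ultimately show ?thesis
    using q by (simp add: spherical_vec_eq orthogonal_matrix_transpose)
qed

section \<open>Bounds and orthogonal invariance\<close>

lemma card_upper_pos: "card {k :: 'n::{finite,linorder}. i \<le> k} > 0"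
  by (subst card_gt_0_iff) auto

text \<open>The residuals are transported to independent gamma variables, where the integral of a
  product of powers factors. The cutoff to invertible matrices in \<open>q\<close> costs nothing,
  since the integrand vanishes at the others.\<close>

lemma gaussian_residual_moments:
  fixes w :: "'n::{finite,linorder} \<Rightarrow> complex" and c :: real
  assumes c: "c > 0" and w: "\<And>i. Re (w i) + real (card {k. i \<le> k}) > 0"
  defines "f \<equiv> \<lambda>g :: 'n rmat. (\<Prod>i\<in>UNIV. of_real (norm (gs_residual g i)) powr w i) *
    complex_of_real (exp (- c * (norm g)\<^sup>2))"
  shows "integrable lborel f"
    "integral\<^sup>L lborel f = of_real ((pi / c) powr (real (CARD('n) * CARD('n)) / 2)) *
      (\<Prod>i\<in>UNIV. of_real c powr (- w i / 2) * Gamma ((w i + of_nat (card {k. i \<le> k})) / 2) /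
        Gamma (of_nat (card {k. i \<le> k}) / 2))"
proof -
  define C where "C = (pi / c) powr (real (CARD('n) * CARD('n)) / 2)"
  have C: "C > 0" using c by (simp add: C_def)
  define m where "m i = card {k. i \<le> k}" for i :: 'n
  have m: "m i > 0" for i by (simp add: m_def card_upper_pos)
  let ?M = "\<lambda>i :: 'n. density lborel (\<lambda>t. ennreal (gamma_density (real (m i) / 2) t))"
  define q where "q g = exp (- c * (norm g)\<^sup>2) / C * indicator {g. invertible g} g" for g :: "'n rmat"
  have q: "q g \<ge> 0" for g using C by (simp add: q_def)
  have [measurable]: "q \<in> borel_measurable borel" unfolding q_def by measurable
  let ?X = "\<lambda>(g :: 'n rmat) i. c * (norm (gs_residual g i))\<^sup>2"
  have X [measurable]: "?X \<in> measurable borel (Pi\<^sub>M UNIV (\<lambda>_. borel))"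
    by (rule measurable_PiM_single') auto
  have "finite_measure (?M i)" for i
    using m[of i] by (intro finite_measureI) (simp add: emeasure_density nn_integral_gamma_density)
  then interpret product_sigma_finite ?M
    by (intro product_sigma_finite.intro) (simp add: finite_measure_def)
  have distr: "distr (density lborel (\<lambda>g. ennreal (q g))) (Pi\<^sub>M UNIV (\<lambda>_. borel)) ?X = Pi\<^sub>M UNIV ?M"
  proof -
    have "ennreal (q g) = ennreal (exp (- c * (norm g)\<^sup>2) / C) * indicator {g. invertible g} g" for g :: "'n rmat"
      by (auto simp: q_def split: split_indicator)
    then show ?thesis
      using distr_gaussian_residuals[OF c, where 'n = 'n] by (simp add: C_def m_def)
  qed
  define \<phi> where "\<phi> i t = (if t > 0 then of_real (sqrt (t / c)) powr w i else 0 :: complex)" for i t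
  have \<phi>: "integrable (?M i) (\<phi> i)" "integral\<^sup>L (?M i) (\<phi> i) =
      of_real c powr (- w i / 2) * Gamma ((w i + of_nat (m i)) / 2) / Gamma (of_nat (m i) / 2)" for i
    unfolding \<phi>_def[abs_def] using m[of i] w[of i] c
    by (intro gamma_density_integral; simp add: m_def)+
  let ?G = "\<lambda>x. \<Prod>i\<in>UNIV. \<phi> i (x i)"
  have G_int: "integrable (Pi\<^sub>M UNIV ?M) ?G"
    by (rule product_integrable_prod) (auto intro: \<phi>)
  have G_eq: "integral\<^sup>L (Pi\<^sub>M UNIV ?M) ?G = (\<Prod>i\<in>UNIV. integral\<^sup>L (?M i) (\<phi> i))"
    by (rule product_integral_prod) (auto intro: \<phi>)
  have G_meas [measurable]: "?G \<in> borel_measurable (Pi\<^sub>M UNIV (\<lambda>_. borel))"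
    using borel_measurable_integrable[OF G_int] unfolding distr[symmetric] by simp
  have f: "q g *\<^sub>R ?G (?X g) = f g / of_real C" for g
  proof (cases "invertible g")
    case True
    then have "\<phi> i (?X g i) = of_real (norm (gs_residual g i)) powr w i" for i
      using c by (simp add: \<phi>_def invertible_iff_gs_residual)
    then show ?thesis
      using True by (simp add: q_def f_def scaleR_conv_of_real)
  next
    \<comment> \<open>Some residual is 0, and \<open>0 powr w i = 0\<close> for every
      exponent.\<close>
    case False
    then have "(\<Prod>i\<in>UNIV. complex_of_real (norm (gs_residual g i)) powr w i) = 0"
      by (auto simp: invertible_iff_gs_residual prod_zero_iff)
    then show ?thesis
      using False by (simp add: q_def f_def)
  qed
  have int1: "integrable (density lborel (\<lambda>g. ennreal (q g))) (\<lambda>g. ?G (?X g))"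
    using G_int unfolding distr[symmetric] by (subst (asm) integrable_distr_eq) auto
  have meas1: "(\<lambda>g. ?G (?X g)) \<in> borel_measurable borel"
    by (rule measurable_compose[OF X G_meas])
  have "integrable lborel (\<lambda>g. f g / of_real C)"
    using int1 meas1 by (subst (asm) integrable_density) (auto simp: q f)
  from integrable_mult_right[OF this, of "of_real C"] show "integrable lborel f"
    using C by simp
  have "integral\<^sup>L (Pi\<^sub>M UNIV ?M) ?G = (\<integral>g. ?G (?X g) \<partial>density lborel (\<lambda>g. ennreal (q g)))"
    unfolding distr[symmetric] by (rule integral_distr) auto
  also have "\<dots> = (\<integral>g. q g *\<^sub>R ?G (?X g) \<partial>lborel)"
    using meas1 by (intro integral_density) (auto simp: q)
  also have "\<dots> = integral\<^sup>L lborel f / of_real C"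
    unfolding f by simp
  finally have "integral\<^sup>L lborel f = of_real C * (\<Prod>i\<in>UNIV. integral\<^sup>L (?M i) (\<phi> i))"
    using C by (simp add: G_eq field_simps)
  note this[unfolded \<phi>(2)]
  then show "integral\<^sup>L lborel f = of_real ((pi / c) powr (real (CARD('n) * CARD('n)) / 2)) *
      (\<Prod>i\<in>UNIV. of_real c powr (- w i / 2) * Gamma ((w i + of_nat (card {k. i \<le> k})) / 2) /
        Gamma (of_nat (card {k. i \<le> k}) / 2))"
    by (simp only: C_def m_def)
qed

section \<open>The Frobenius norm, orthogonal invariance and Gaussian bounds\<close>

lemma power2_norm_matrix: "(norm (g :: real^'n^'m))\<^sup>2 = trace (transpose g ** g)"
proof -
  have "(norm g)\<^sup>2 = (\<Sum>i\<in>UNIV. \<Sum>j\<in>UNIV. (g $ i $ j)\<^sup>2)"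
    by (simp add: power2_norm_vec)
  also have "\<dots> = (\<Sum>j\<in>UNIV. \<Sum>i\<in>UNIV. (g $ i $ j)\<^sup>2)"
    by (rule sum.swap)
  finally show ?thesis
    by (simp add: trace_def matrix_matrix_mult_def transpose_def power2_eq_square)
qed

lemma norm_orthogonal_matrix_mult:
  fixes g :: "real^'n^'n"
  assumes "orthogonal_matrix k"
  shows "norm (k ** g) = norm g" "norm (g ** k) = norm g"
proof -
  have "transpose (k ** g) ** (k ** g) = transpose g ** (transpose k ** k) ** g"
    by (simp add: matrix_transpose_mul matrix_mul_assoc)
  then have "(norm (k ** g))\<^sup>2 = (norm g)\<^sup>2"
    using assms by (simp add: power2_norm_matrix orthogonal_matrix_def)
  then show "norm (k ** g) = norm g" by simp
  have "trace (transpose k ** (transpose g ** g ** k)) = trace ((transpose g ** g ** k) ** transpose k)"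
    by (rule trace_mul_sym)
  also have "(transpose g ** g ** k) ** transpose k = transpose g ** g"
    using assms by (simp add: matrix_mul_assoc[symmetric] orthogonal_matrix_def)
  also have "transpose k ** (transpose g ** g ** k) = transpose (g ** k) ** (g ** k)"
    by (simp add: matrix_transpose_mul matrix_mul_assoc)
  finally have "(norm (g ** k))\<^sup>2 = (norm g)\<^sup>2"
    by (simp only: power2_norm_matrix)
  then show "norm (g ** k) = norm g" by simp
qed

lemma orthogonal_transformation_matrix_mult:
  fixes a b :: "real^'n^'n"
  assumes "orthogonal_matrix a" "orthogonal_matrix b"
  shows "orthogonal_transformation (\<lambda>g. a ** g ** b)"
  unfolding orthogonal_transformation
proof
  show "linear (\<lambda>g. a ** g ** b)"
    by (rule linearI)
      (simp_all add: vec_eq_iff matrix_matrix_mult_def ring_distribs sum.distrib sum_distrib_left sum_distrib_right mult_ac)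
qed (use assms in \<open>simp add: norm_orthogonal_matrix_mult\<close>)

lemma lborel_integral_orthogonal:
  fixes f :: "'a::euclidean_space \<Rightarrow> 'b::{banach,second_countable_topology}"
    and T :: "'a \<Rightarrow> 'a"
  assumes T: "orthogonal_transformation T" and [measurable]: "f \<in> borel_measurable borel"
  shows "(\<integral>x. f (T x) \<partial>lborel) = (\<integral>x. f x \<partial>lborel)"
    "integrable lborel (\<lambda>x. f (T x)) \<longleftrightarrow> integrable lborel f"
proof -
  have "linear T" using T by (rule orthogonal_transformation_linear)
  then have [measurable]: "T \<in> borel_measurable borel"
    by (intro borel_measurable_continuous_onI linear_continuous_on) (simp add: linear_conv_bounded_linear)
  note eq = lborel_distr_orthogonal_transformation[OF T]
  show "(\<integral>x. f (T x) \<partial>lborel) = (\<integral>x. f x \<partial>lborel)"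
    by (subst (2) eq[symmetric], subst integral_distr) auto
  show "integrable lborel (\<lambda>x. f (T x)) \<longleftrightarrow> integrable lborel f"
    by (subst (2) eq[symmetric], subst integrable_distr_eq) auto
qed

text \<open>Since x^j \<le> 1 + x^(2 j), it suffices to bound y^j by j^j exp y for y = a x^2, which
  is the j-th power of y / j \<le> exp (y / j).\<close>

lemma power_times_gaussian_le:
  fixes x a :: real
  assumes "a > 0" "x \<ge> 0"
  shows "x ^ j * exp (- a * x\<^sup>2) \<le> 1 + (real j / a) ^ j"
proof -
  have "x ^ j \<le> 1 + (x\<^sup>2) ^ j"
  proof (cases "x \<le> 1")
    case True
    then have "x ^ j \<le> 1" using assms by (intro power_le_one) auto
    then show ?thesis by (simp add: add_increasing2)
  next
    case False
    then have "x ^ j \<le> x ^ (2 * j)" by (intro power_increasing) auto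
    then show ?thesis by (simp add: power_mult)
  qed
  moreover have "(x\<^sup>2) ^ j \<le> (real j / a) ^ j * exp (a * x\<^sup>2)"
  proof (cases "j = 0")
    case False
    have "a * x\<^sup>2 / j \<le> exp (a * x\<^sup>2 / j)"
      using exp_ge_add_one_self[of "a * x\<^sup>2 / j"] by linarith
    then have "(a * x\<^sup>2 / j) ^ j \<le> exp (a * x\<^sup>2 / j) ^ j"
      using assms by (intro power_mono) auto
    also have "\<dots> = exp (a * x\<^sup>2)"
      using False by (simp add: exp_of_nat_mult[symmetric])
    finally show ?thesis
      using assms False by (simp add: power_mult_distrib power_divide field_simps)
  qed (use assms in simp)
  ultimately have "x ^ j \<le> 1 + (real j / a) ^ j * exp (a * x\<^sup>2)" by linarith
  also have "\<dots> \<le> (1 + (real j / a) ^ j) * exp (a * x\<^sup>2)"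
    using assms by (simp add: ring_distribs)
  finally show ?thesis
    by (simp add: exp_minus field_simps)
qed

lemma abs_entry_le_norm: "\<bar>g $ i $ j\<bar> \<le> norm (g :: real^'n^'m)"
  using component_le_norm_cart[of "g $ i" j] Finite_Cartesian_Product.norm_nth_le[of g i] by linarith

lemma Delta_W_gaussian_bound:
  assumes "a > 0"
  obtains B where "B \<ge> 0"
    "\<And>g :: ('n::{finite,linorder}) rmat. norm (Delta_W g) * exp (- a * (norm g)\<^sup>2) \<le> B"
proof
  let ?N = "real CARD('n)"
  let ?B = "\<Sum>J\<in>(UNIV :: 'n set set). real (CARD('n) choose card J) * (?N ^ card J * (1 + (real (card J) / a) ^ card J))"
  show "?B \<ge> 0" using assms by (intro sum_nonneg) auto
  fix g :: "'n rmat"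
  have "norm (Delta_W g) \<le> (\<Sum>J\<in>(UNIV :: 'n set set). real (CARD('n) choose card J) * norm (minor g J J))"
    unfolding Delta_W_eq by (rule order.trans[OF norm_sum]) (simp add: norm_mult)
  also have "\<dots> \<le> (\<Sum>J\<in>(UNIV :: 'n set set). real (CARD('n) choose card J) * (?N * norm g) ^ card J)"
    by (intro sum_mono mult_left_mono norm_minor_le abs_entry_le_norm) auto
  finally have "norm (Delta_W g) * exp (- a * (norm g)\<^sup>2) \<le>
      (\<Sum>J\<in>(UNIV :: 'n set set). real (CARD('n) choose card J) * (?N * norm g) ^ card J) * exp (- a * (norm g)\<^sup>2)"
    by (intro mult_right_mono) auto
  also have "\<dots> = (\<Sum>J\<in>(UNIV :: 'n set set). real (CARD('n) choose card J) *
      (?N ^ card J * (norm g ^ card J * exp (- a * (norm g)\<^sup>2))))"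
    by (simp add: sum_distrib_right power_mult_distrib mult.assoc)
  also have "\<dots> \<le> ?B"
    using assms by (intro sum_mono mult_left_mono power_times_gaussian_le) auto
  finally show "norm (Delta_W g) * exp (- a * (norm g)\<^sup>2) \<le> ?B" .
qed

section \<open>The integral over the general linear group\<close>

text \<open>Also true at r = 0, where both sides are 0 by the convention for \<open>powr\<close>,
  even for m = 0. Residual norms can therefore absorb the shift by \<epsilon> without a case
  split.\<close>

lemma of_real_powr_add_nat:
  assumes "r \<ge> 0"
  shows "complex_of_real r powr z * of_real r ^ m = of_real r powr (z + of_nat m)"
proof (cases "r = 0")
  case False
  then show ?thesis by (simp add: powr_add powr_nat')
qed auto

lemma prod_of_real_powr:
  assumes "\<And>i. i \<in> I \<Longrightarrow> r i > 0"
  shows "complex_of_real (\<Prod>i\<in>I. r i) powr z = (\<Prod>i\<in>I. of_real (r i) powr z)"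
  using assms
proof (induction I rule: infinite_finite_induct)
  case (insert i I)
  then have "r i > 0" "(\<Prod>i\<in>I. r i) > 0"
    by (auto intro!: prod_pos)
  then have "complex_of_real (r i * (\<Prod>i\<in>I. r i)) powr z = of_real (r i) powr z * of_real (\<Prod>i\<in>I. r i) powr z"
    by (simp add: powr_times_real less_imp_le del: of_real_prod)
  then show ?case using insert by simp
qed auto

lemma of_real_divide_powr:
  assumes "x > 0" "y > 0"
  shows "complex_of_real (x / y) powr z = of_real x powr z / of_real y powr z"
  using assms by (simp add: powr_def Ln_of_real ln_div exp_diff ring_distribs flip: of_real_divide)

lemma borel_measurable_of_real_powr_nonneg:
  assumes [measurable]: "r \<in> borel_measurable M" and "\<And>x. r x \<ge> 0"
  shows "(\<lambda>x. complex_of_real (r x) powr z) \<in> borel_measurable M"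
proof -
  have "(\<lambda>x. if 0 < r x then complex_of_real (r x) powr z else 0) \<in> borel_measurable M"
    by (rule measurable_compose[OF _ borel_measurable_of_real_powr]) simp
  also have "(\<lambda>x. if 0 < r x then complex_of_real (r x) powr z else 0) = (\<lambda>x. complex_of_real (r x) powr z)"
    using assms(2) by (auto simp: fun_eq_iff less_le)
  finally show ?thesis .
qed

lemma norm_vector_matrix_orthogonal:
  fixes x :: "real^'n"
  assumes "orthogonal_matrix w"
  shows "norm (x v* w) = norm x"
proof -
  have "orthogonal_transformation ((*v) (transpose w))"
    using assms by (simp add: orthogonal_transformation_matrix orthogonal_matrix_transpose)
  then show ?thesis
    using orthogonal_transformation_norm[of "(*v) (transpose w)" x] by simp
qed

text \<open>This vanishes at singular \<open>g\<close>, because \<open>0 powr z = 0\<close>; so it can be integrated over all matrices.\<close>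

definition reduced_integrand ::
  "real \<Rightarrow> ('n \<Rightarrow> complex) \<Rightarrow> 'n set \<Rightarrow> ('n::{finite,linorder}) rmat \<Rightarrow> 'n rmat \<Rightarrow> complex" where
  "reduced_integrand c z I k g = Delta_W (k ** g) * minor (transpose (gs_q g)) I I *
     ((\<Prod>j\<in>UNIV. of_real (norm (gs_residual g j)) powr z j) * of_real (exp (- c * (norm g)\<^sup>2)))"

lemma borel_measurable_reduced_integrand [measurable]:
  "reduced_integrand c z I k \<in> borel_measurable borel"
proof -
  have [measurable]: "(\<lambda>g. k ** g) \<in> borel_measurable borel"
    by (intro borel_measurable_vecI, unfold matrix_matrix_mult_def vec_lambda_beta, measurable)
  have [measurable]: "(\<lambda>g. transpose (gs_q g)) \<in> borel_measurable borel"
    by (intro borel_measurable_vecI) (simp add: transpose_def gs_q_def)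
  have [measurable]: "(\<lambda>g. \<Prod>j\<in>UNIV. complex_of_real (norm (gs_residual g j)) powr z j) \<in> borel_measurable borel"
    by (intro borel_measurable_prod borel_measurable_of_real_powr_nonneg) auto
  show ?thesis
    unfolding reduced_integrand_def[abs_def] by measurable
qed

lemma norm_minor_gs_q_le: "norm (minor (transpose (gs_q g)) I I) \<le> real CARD('n) ^ card I"
  for g :: "('n::{finite,linorder}) rmat"
proof -
  have "norm (gs g j) \<le> 1" for j
    using norm_gs[of g j] gs_eq_0[of g j] by (cases "gs_residual g j = 0") auto
  then have "\<bar>gs g j $ i\<bar> \<le> 1" for i j
    using component_le_norm_cart[of "gs g j" i] by (meson order_trans)
  then have "norm (minor (transpose (gs_q g)) I I) \<le> (real CARD('n) * 1) ^ card I"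
    by (intro norm_minor_le) (simp add: transpose_def gs_q_def)
  then show ?thesis by simp
qed

text \<open>Half of the Gaussian bounds \<open>Delta_W\<close>, and the other half leaves an
  absolutely convergent moment at c / 2. The minor of \<open>gs_q\<close> is bounded because its
  rows have norm at most 1.\<close>

lemma integrable_reduced_integrand:
  fixes z :: "'n::{finite,linorder} \<Rightarrow> complex" and k :: "'n rmat"
  assumes c: "c > 0" and z: "\<And>j. Re (z j) + real (card {i. j \<le> i}) > 0" and k: "orthogonal_matrix k"
  shows "integrable lborel (reduced_integrand c z I k)"
proof -
  obtain B where B: "B \<ge> 0" "\<And>g :: 'n rmat. norm (Delta_W g) * exp (- (c / 2) * (norm g)\<^sup>2) \<le> B"
    using Delta_W_gaussian_bound[of "c / 2"] c by auto
  define P where "P g = (\<Prod>j\<in>UNIV. complex_of_real (norm (gs_residual g j)) powr z j)" for g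
  define K where "K = B * real CARD('n) ^ card I"
  have K: "K \<ge> 0" using B(1) by (simp add: K_def)
  have "integrable lborel (\<lambda>g :: 'n rmat. of_real K * (P g * of_real (exp (- (c / 2) * (norm g)\<^sup>2))))"
    using gaussian_residual_moments(1)[of "c / 2" z] c z
    unfolding P_def by (intro integrable_mult_right) auto
  then show ?thesis
  proof (rule Bochner_Integration.integrable_bound)
    show "AE g in lborel. norm (reduced_integrand c z I k g) \<le>
        norm (of_real K * (P g * of_real (exp (- (c / 2) * (norm g)\<^sup>2))))"
    proof (rule AE_I2)
      fix g :: "'n rmat"
      have e: "exp (- c * (norm g)\<^sup>2) = exp (- (c / 2) * (norm g)\<^sup>2) * exp (- (c / 2) * (norm g)\<^sup>2)"
        by (simp add: exp_add[symmetric])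
      have "norm (reduced_integrand c z I k g) =
          (norm (Delta_W (k ** g)) * exp (- (c / 2) * (norm (k ** g))\<^sup>2)) * norm (minor (transpose (gs_q g)) I I) *
          (norm (P g) * exp (- (c / 2) * (norm g)\<^sup>2))"
        unfolding reduced_integrand_def P_def[symmetric] e norm_orthogonal_matrix_mult(1)[OF k]
        by (simp only: norm_mult norm_of_real abs_exp_cancel abs_mult mult_ac)
      also have "\<dots> \<le> B * real CARD('n) ^ card I * (norm (P g) * exp (- (c / 2) * (norm g)\<^sup>2))"
        using B by (intro mult_right_mono mult_mono norm_minor_gs_q_le) auto
      also have "\<dots> = norm (of_real K * (P g * of_real (exp (- (c / 2) * (norm g)\<^sup>2))))"
        using K by (simp add: norm_mult K_def[symmetric])
      finally show "norm (reduced_integrand c z I k g) \<le>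
          norm (of_real K * (P g * of_real (exp (- (c / 2) * (norm g)\<^sup>2))))" .
    qed
  qed simp
qed

lemma orthogonal_diag_mat_signs: "d \<in> signs \<Longrightarrow> orthogonal_matrix (diag_mat d)"
proof -
  assume "d \<in> signs"
  then have "d i * d i = 1" for i
    by (auto simp: signs_def PiE_iff dest: spec[of _ i])
  then have "diag_mat d ** diag_mat d = mat 1"
    by (simp add: vec_eq_iff matrix_matrix_mult_def diag_mat_def mat_def
        if_distrib[of "\<lambda>x. x * _"] cong: if_cong)
  then show ?thesis by (simp add: orthogonal_matrix_def)
qed

lemma orthogonal_perm_mat: "bij \<sigma> \<Longrightarrow> orthogonal_matrix (perm_mat \<sigma>)"
  by (simp add: orthogonal_matrix transpose_perm_mat_mult bij_is_inj)

lemma integral_reduced_integrand: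
  fixes z :: "'n::{finite,linorder} \<Rightarrow> complex" and k :: "'n rmat"
  assumes c: "c > 0" and z: "\<And>j. Re (z j) + real (card {i. j \<le> i}) > 0" and k: "orthogonal_matrix k"
  shows "integral\<^sup>L lborel (reduced_integrand c z I k) = minor k I I *
    (of_real ((pi / c) powr (real (CARD('n) * CARD('n)) / 2)) *
      (\<Prod>j\<in>UNIV. of_real c powr (- (z j + of_bool (j \<in> I)) / 2) *
        Gamma ((z j + of_bool (j \<in> I) + of_nat (card {i. j \<le> i})) / 2) / Gamma (of_nat (card {i. j \<le> i}) / 2)))"
proof -
  let ?R = "reduced_integrand c z I k"
  let ?S = "{\<sigma> :: 'n \<Rightarrow> 'n. bij \<sigma>}"
  define w where "w d \<sigma> = diag_mat d ** perm_mat \<sigma>" for d and \<sigma> :: "'n \<Rightarrow> 'n"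
  \<comment> \<open>The number of triples of two sign vectors and a permutation.\<close>
  define N :: complex where "N = (2 ^ CARD('n)) ^ 2 * fact CARD('n)"
  have N: "N \<noteq> 0" by (simp add: N_def)
  define f where "f g = (\<Prod>j\<in>UNIV. complex_of_real (norm (gs_residual g j)) powr (z j + of_bool (j \<in> I))) *
    of_real (exp (- c * (norm g)\<^sup>2))" for g :: "'n rmat"
  have w: "orthogonal_matrix (w d \<sigma>)" if "d \<in> signs" "bij \<sigma>" for d \<sigma>
    unfolding w_def using that by (intro orthogonal_matrix_mul orthogonal_diag_mat_signs orthogonal_perm_mat)
  have T: "orthogonal_transformation (\<lambda>g. diag_mat d ** g ** w d' \<sigma>)"
    if "d \<in> signs" "d' \<in> signs" "bij \<sigma>" for d d' :: "'n \<Rightarrow> real" and \<sigma>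
    using that by (intro orthogonal_transformation_matrix_mult orthogonal_diag_mat_signs w)
  have int: "integrable lborel ?R"
    using assms by (rule integrable_reduced_integrand)
  \<comment> \<open>The transformation leaves all residual norms and the norm of \<open>g\<close>
    unchanged, so \<open>E\<close> factors out of the sum and the purely algebraic average applies
    pointwise.\<close>
  have avg: "(\<Sum>d\<in>signs. \<Sum>d'\<in>signs. \<Sum>\<sigma>\<in>?S. ?R (diag_mat d ** g ** w d' \<sigma>)) = N * minor k I I * f g" for g
  proof -
    define E where "E = (\<Prod>j\<in>UNIV. complex_of_real (norm (gs_residual g j)) powr z j) * of_real (exp (- c * (norm g)\<^sup>2))"
    have R: "?R (diag_mat d ** g ** w d' \<sigma>) = Delta_W (k ** (diag_mat d ** g ** w d' \<sigma>)) *
        minor (transpose (diag_mat d ** gs_q g ** w d' \<sigma>)) I I * E"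
      if d: "d \<in> signs" "d' \<in> signs" "bij \<sigma>" for d d' \<sigma>
    proof -
      have d1: "d i = 1 \<or> d i = -1" for i
        using d(1) by (auto simp: signs_def PiE_iff)
      have row: "(diag_mat d ** M ** w d' \<sigma>) $ i = d i *\<^sub>R (M $ i v* w d' \<sigma>)" for M :: "'n rmat" and i
      proof -
        have "(diag_mat d ** M ** w d' \<sigma>) $ i = (diag_mat d ** M) $ i v* w d' \<sigma>"
          by (simp add: vec_eq_iff matrix_matrix_mult_def vector_matrix_mult_def mult.commute)
        also have "(diag_mat d ** M) $ i = d i *\<^sub>R M $ i"
          by (simp add: vec_eq_iff matrix_matrix_mult_def diag_mat_def if_distrib[of "\<lambda>x. x * _"] cong: if_cong)
        also have "(d i *\<^sub>R M $ i) v* w d' \<sigma> = d i *\<^sub>R (M $ i v* w d' \<sigma>)"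
          by (simp add: vec_eq_iff vector_matrix_mult_def sum_distrib_left mult_ac)
        finally show ?thesis .
      qed
      have q: "gs_q (diag_mat d ** g ** w d' \<sigma>) = diag_mat d ** gs_q g ** w d' \<sigma>"
      proof (subst vec_eq_iff, rule allI)
        fix i
        show "gs_q (diag_mat d ** g ** w d' \<sigma>) $ i = (diag_mat d ** gs_q g ** w d' \<sigma>) $ i"
          unfolding row using gs_transform(1)[OF d1 w[OF d(2,3)], where g = g and j = i] by (simp add: gs_q_def)
      qed
      have r: "norm (gs_residual (diag_mat d ** g ** w d' \<sigma>) j) = norm (gs_residual g j)" for j
        using d1[of j] unfolding gs_transform(2)[OF d1 w[OF d(2,3)], where g = g and j = j]
        by (auto simp: norm_vector_matrix_orthogonal[OF w[OF d(2,3)]])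
      have n: "norm (diag_mat d ** g ** w d' \<sigma>) = norm g"
        using orthogonal_transformation_norm[OF T[OF d]] .
      show ?thesis
        unfolding reduced_integrand_def q r n E_def by (simp only: mult.assoc)
    qed
    show ?thesis
    proof (cases "invertible g")
      case True
      then have "(\<Sum>d\<in>signs. \<Sum>d'\<in>signs. \<Sum>\<sigma>\<in>?S. ?R (diag_mat d ** g ** w d' \<sigma>)) =
          (\<Sum>d\<in>signs. \<Sum>d'\<in>signs. \<Sum>\<sigma>\<in>?S. Delta_W (k ** (diag_mat d ** (gs_l g ** gs_q g) ** w d' \<sigma>)) *
            minor (transpose (diag_mat d ** gs_q g ** w d' \<sigma>)) I I) * E"
        by (simp add: R sum_distrib_right gs_l_mult_gs_q)
      also have "\<dots> = N * (minor k I I * minor (gs_l g) I I) * E"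
        unfolding w_def N_def by (subst sum_Delta_W_minor[OF orthogonal_gs_q'[OF True]]) (rule refl)
      \<comment> \<open>Here the \<epsilon>-dependence of the eigenvalue arises: the minor raises
        the exponent of the residual norm by 1 exactly at the indices in \<open>I\<close>.\<close>
      also have "minor (gs_l g) I I = (\<Prod>j\<in>UNIV. of_real (norm (gs_residual g j)) ^ of_bool (j \<in> I))"
        by (subst minor_lower_triangular) (auto simp: gs_l_above gs_l_diag of_bool_def prod.If_cases if_distrib cong: if_cong)
      also have "N * (minor k I I * (\<Prod>j\<in>UNIV. of_real (norm (gs_residual g j)) ^ of_bool (j \<in> I))) * E = N * minor k I I * f g"
        unfolding E_def f_def
        by (simp add: of_real_powr_add_nat[symmetric, of _ _ "of_bool _", simplified] prod.distrib mult_ac)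
      finally show ?thesis .
    next
      case False
      then have "E = 0" "f g = 0"
        by (auto simp: E_def f_def invertible_iff_gs_residual prod_zero_iff)
      then show ?thesis by (simp add: R)
    qed
  qed
  have "N * integral\<^sup>L lborel ?R = (\<Sum>d\<in>(signs :: ('n \<Rightarrow> real) set). \<Sum>d'\<in>(signs :: ('n \<Rightarrow> real) set). \<Sum>\<sigma>\<in>?S. integral\<^sup>L lborel ?R)"
  proof -
    have "card ?S = fact CARD('n)"
      using card_permutations[of "UNIV :: 'n set" "CARD('n)"] by (simp add: permutes_univ bij_iff)
    then show ?thesis
      by (simp add: N_def card_signs power2_eq_square)
  qed
  also have "\<dots> = (\<Sum>d\<in>signs. \<Sum>d'\<in>signs. \<Sum>\<sigma>\<in>?S. \<integral>g. ?R (diag_mat d ** g ** w d' \<sigma>) \<partial>lborel)"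
    by (intro sum.cong refl lborel_integral_orthogonal(1)[symmetric] T) auto
  also have "\<dots> = (\<integral>g. (\<Sum>d\<in>signs. \<Sum>d'\<in>signs. \<Sum>\<sigma>\<in>?S. ?R (diag_mat d ** g ** w d' \<sigma>)) \<partial>lborel)"
  proof -
    have intT: "integrable lborel (\<lambda>g. ?R (diag_mat d ** g ** w d' \<sigma>))"
      if "d \<in> signs" "d' \<in> signs" "bij \<sigma>" for d d' \<sigma>
      using lborel_integral_orthogonal(2)[OF T[OF that], of ?R] int by simp
    have "(\<integral>g. (\<Sum>d\<in>signs. \<Sum>d'\<in>signs. \<Sum>\<sigma>\<in>?S. ?R (diag_mat d ** g ** w d' \<sigma>)) \<partial>lborel) =
        (\<Sum>d\<in>signs. \<integral>g. (\<Sum>d'\<in>signs. \<Sum>\<sigma>\<in>?S. ?R (diag_mat d ** g ** w d' \<sigma>)) \<partial>lborel)"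
      by (rule Bochner_Integration.integral_sum) (auto intro!: Bochner_Integration.integrable_sum intT)
    also have "\<dots> = (\<Sum>d\<in>signs. \<Sum>d'\<in>signs. \<integral>g. (\<Sum>\<sigma>\<in>?S. ?R (diag_mat d ** g ** w d' \<sigma>)) \<partial>lborel)"
      by (intro sum.cong refl Bochner_Integration.integral_sum) (auto intro!: Bochner_Integration.integrable_sum intT)
    also have "\<dots> = (\<Sum>d\<in>signs. \<Sum>d'\<in>signs. \<Sum>\<sigma>\<in>?S. \<integral>g. ?R (diag_mat d ** g ** w d' \<sigma>) \<partial>lborel)"
      by (intro sum.cong refl Bochner_Integration.integral_sum) (auto intro!: intT)
    finally show ?thesis by simp
  qed
  also have "\<dots> = N * (minor k I I * integral\<^sup>L lborel f)"
    unfolding avg by (simp add: mult.assoc)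
  finally have "integral\<^sup>L lborel ?R = minor k I I * integral\<^sup>L lborel f"
    using N by simp
  also have "integral\<^sup>L lborel f = of_real ((pi / c) powr (real (CARD('n) * CARD('n)) / 2)) *
      (\<Prod>j\<in>UNIV. of_real c powr (- (z j + of_bool (j \<in> I)) / 2) *
        Gamma ((z j + of_bool (j \<in> I) + of_nat (card {i. j \<le> i})) / 2) / Gamma (of_nat (card {i. j \<le> i}) / 2))"
    unfolding f_def
  proof (rule gaussian_residual_moments(2)[OF c])
    show "Re (z j + of_bool (j \<in> I)) + real (card {i. j \<le> i}) > 0" for j
      using z[of j] by (cases "j \<in> I") auto
  qed
  finally show ?thesis .
qed

section \<open>Bookkeeping of exponents and constants\<close>

lemma card_upper: "real (card {i. j \<le> i}) = real CARD('n) + 1 - real (position j)"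
  for j :: "'n::{finite,linorder}"
proof -
  have "card {i. j \<le> i} + card {i. i \<le> j} = card ({i. j \<le> i} \<union> {i. i \<le> j}) + card ({i. j \<le> i} \<inter> {i. i \<le> j})"
    by (rule card_Un_Int) auto
  also have "{i. j \<le> i} \<union> {i. i \<le> j} = UNIV" by auto
  also have "{i. j \<le> i} \<inter> {i. i \<le> j} = {j}" by auto
  finally show ?thesis by (simp add: position_def)
qed

text \<open>Counting from the top of the order numbers the indices by 1 to \<open>CARD('n)\<close>,
  which matches the gamma shapes with the product in \<open>haar_GL\<close>.\<close>

lemma prod_card_upper:
  "(\<Prod>j\<in>(UNIV :: 'n::{finite,linorder} set). f (card {i. j \<le> i})) = (\<Prod>i = 1..CARD('n). f i)"
proof (rule prod.reindex_bij_betw)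
  have inj: "inj (\<lambda>j :: 'n. card {i. j \<le> i})"
  proof (rule linorder_injI)
    fix j k :: 'n assume "j < k"
    then have "{i. k \<le> i} \<subseteq> {i. j \<le> i}" "j \<in> {i. j \<le> i}" "j \<notin> {i. k \<le> i}"
      by auto
    then have "card {i. k \<le> i} < card {i. j \<le> i}"
      by (intro psubset_card_mono finite) blast
    then show "card {i. j \<le> i} \<noteq> card {i. k \<le> i}" by simp
  qed
  have "card {i. j \<le> i} \<in> {1..CARD('n)}" for j :: 'n
    using card_upper_pos[of j] card_mono[of UNIV "{i. j \<le> i}"] by simp
  then have "range (\<lambda>j :: 'n. card {i. j \<le> i}) \<subseteq> {1..CARD('n)}"
    by blast
  then have "range (\<lambda>j :: 'n. card {i. j \<le> i}) = {1..CARD('n)}"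
    using inj by (intro card_subset_eq) (auto simp: card_image)
  with inj show "bij_betw (\<lambda>j :: 'n. card {i. j \<le> i}) UNIV {1..CARD('n)}"
    by (simp add: bij_betw_def)
qed

text \<open>The values of \<Gamma> cancel in pairs. With n = \<open>CARD('n)\<close>, the exponents
  of c / pi are n (n + 1) / 4 from the Haar scale together with the gamma laws, n (n - 1) / 4 from
  the prefactor of \<open>Q_hat\<close>, and - n^2 / 2 from the Gaussian mass.\<close>

lemma haar_constant:
  assumes c: "c > 0"
  shows "(\<Prod>j = 1..CARD('n::{finite,linorder}). Gamma (real j / 2) / pi powr (real j / 2)) *
      (c / pi) powr (real (ell TYPE('n) * (ell TYPE('n) + 1)) / 4) *
      (pi / c) powr (real (CARD('n) * CARD('n)) / 2) *
      (\<Prod>j\<in>(UNIV :: 'n set). c powr (real (card {i. j \<le> i}) / 2) / Gamma (real (card {i. j \<le> i}) / 2)) = 1"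
proof -
  let ?n = "CARD('n)"
  let ?x = "c / pi"
  have x: "?x > 0" using c by simp
  have "(\<Prod>j = 1..?n. Gamma (real j / 2) / pi powr (real j / 2)) *
      (\<Prod>j\<in>(UNIV :: 'n set). c powr (real (card {i. j \<le> i}) / 2) / Gamma (real (card {i. j \<le> i}) / 2)) =
    (\<Prod>j = 1..?n. ?x powr (real j / 2))"
    unfolding prod_card_upper[of "\<lambda>m. c powr (real m / 2) / Gamma (real m / 2)"] prod.distrib[symmetric]
  proof (intro prod.cong refl)
    fix j assume "j \<in> {1..?n}"
    then have "Gamma (real j / 2) > 0" by (intro Gamma_real_pos) auto
    then have "Gamma (real j / 2) \<noteq> 0" by linarith
    then show "Gamma (real j / 2) / pi powr (real j / 2) * (c powr (real j / 2) / Gamma (real j / 2)) = ?x powr (real j / 2)"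
      using c by (simp add: powr_divide)
  qed
  also have "\<dots> = ?x powr (\<Sum>j = 1..?n. real j / 2)"
    using x by (subst powr_sum) auto
  also have "(\<Sum>j = 1..?n. real j / 2) = real ?n * (real ?n + 1) / 4"
  proof -
    have "(\<Sum>j = 1..N. real j / 2) = real N * (real N + 1) / 4" for N
      by (induction N) (simp_all add: field_simps)
    then show ?thesis .
  qed
  finally have "(\<Prod>j = 1..?n. Gamma (real j / 2) / pi powr (real j / 2)) *
      (\<Prod>j\<in>(UNIV :: 'n set). c powr (real (card {i. j \<le> i}) / 2) / Gamma (real (card {i. j \<le> i}) / 2)) =
    ?x powr (real ?n * (real ?n + 1) / 4)" .
  moreover have "(pi / c) powr (real (?n * ?n) / 2) = ?x powr (- (real (?n * ?n) / 2))"
    using c by (simp add: powr_minus powr_divide)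
  moreover have "real (ell TYPE('n) * (ell TYPE('n) + 1)) = (real ?n - 1) * real ?n"
  proof -
    have "?n > 0" by simp
    then have "real (ell TYPE('n)) = real ?n - 1"
      by (simp add: ell_def of_nat_diff Suc_le_eq)
    then show ?thesis by (simp only: of_nat_mult of_nat_add of_nat_1 diff_add_cancel)
  qed
  ultimately have "(\<Prod>j = 1..?n. Gamma (real j / 2) / pi powr (real j / 2)) *
      (c / pi) powr (real (ell TYPE('n) * (ell TYPE('n) + 1)) / 4) *
      (pi / c) powr (real (?n * ?n) / 2) *
      (\<Prod>j\<in>(UNIV :: 'n set). c powr (real (card {i. j \<le> i}) / 2) / Gamma (real (card {i. j \<le> i}) / 2)) =
    ?x powr (real ?n * (real ?n + 1) / 4) * ?x powr ((real ?n - 1) * real ?n / 4) * ?x powr (- (real (?n * ?n) / 2))"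
    by (simp only: mult_ac)
  also have "\<dots> = ?x powr (real ?n * (real ?n + 1) / 4 + (real ?n - 1) * real ?n / 4 + - (real (?n * ?n) / 2))"
    by (simp only: powr_add)
  also have "real ?n * (real ?n + 1) / 4 + (real ?n - 1) * real ?n / 4 + - (real (?n * ?n) / 2) = 0"
    by (simp add: field_simps)
  also have "?x powr 0 = 1" using c by simp
  finally show ?thesis .
qed

lemma abs_det_orthogonal_mult: "orthogonal_matrix k \<Longrightarrow> \<bar>det (k ** g)\<bar> = \<bar>det g\<bar>"
  for k g :: "real^'n^'n"
  using det_orthogonal_matrix[of k] by (auto simp: det_mul abs_mult)

text \<open>Substituting \<open>k ** g\<close> cancels \<open>k\<close> in the argument of the
  spherical vector. The exponent of each residual norm collects s + \<ell> / 2 from the determinant,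
  - \<open>CARD('n)\<close> from the Haar density and - e_j from the spherical vector at the
  inverse; the powers of the diagonal of \<open>b\<close> come out as a constant.\<close>

lemma convolution_integrand_eq:
  fixes k b g :: "('n::{finite,linorder}) rmat" and \<gamma> :: "'n rvec"
  assumes k: "orthogonal_matrix k" and b: "b \<in> lower_pos" and g: "invertible g"
  defines "e \<equiv> \<lambda>j. \<i> * of_real (\<gamma> $ j) + of_real (rho j)"
  shows "convolution_integrand (Q_hat c s) (spherical_vec \<epsilon> \<gamma>) (k ** b) (k ** g) / of_real (\<bar>det g\<bar> ^ CARD('n)) =
    of_real ((c / pi) powr (real (ell TYPE('n) * (ell TYPE('n) + 1)) / 4)) * (\<Prod>j\<in>UNIV. of_real (b $ j $ j) powr e j) *
    reduced_integrand c (\<lambda>j. s + of_nat (ell TYPE('n)) / 2 - of_nat CARD('n) - e j) {i. \<epsilon> i = 1} k g"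
proof -
  let ?r = "\<lambda>j. norm (gs_residual g j)"
  let ?s = "s + of_nat (ell TYPE('n)) / 2"
  have r: "?r j > 0" for j
    using g by (simp add: invertible_iff_gs_residual)
  have det: "\<bar>det g\<bar> = (\<Prod>j\<in>UNIV. ?r j)"
    using g by (rule abs_det_eq_gs_residual)
  have bpos: "b $ j $ j > 0" for j
    using b by (simp add: lower_pos_def)
  have "matrix_inv (k ** g) ** (k ** b) = matrix_inv g ** (transpose k ** k) ** b"
    using k g by (simp add: matrix_inv_mult invertible_orthogonal matrix_inv_orthogonal matrix_mul_assoc)
  then have inv: "matrix_inv (k ** g) ** (k ** b) = matrix_inv g ** b"
    using k by (simp add: orthogonal_matrix_def)
  have tr: "trace (transpose (k ** g) ** (k ** g)) = (norm g)\<^sup>2"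
    by (simp only: power2_norm_matrix[symmetric] norm_orthogonal_matrix_mult(1)[OF k])
  have "of_real \<bar>det g\<bar> powr ?s * (\<Prod>j\<in>UNIV. of_real (b $ j $ j / ?r j) powr e j) / of_real (\<bar>det g\<bar> ^ CARD('n)) =
      (\<Prod>j\<in>UNIV. of_real (?r j) powr ?s) * (\<Prod>j\<in>UNIV. of_real (b $ j $ j / ?r j) powr e j) / (\<Prod>j\<in>UNIV. of_real (?r j) ^ CARD('n))"
    unfolding det using r by (simp add: prod_of_real_powr prod_power_distrib del: of_real_prod) simp
  also have "\<dots> = (\<Prod>j\<in>UNIV. of_real (b $ j $ j) powr e j * of_real (?r j) powr (?s - of_nat CARD('n) - e j))"
    unfolding prod.distrib[symmetric] prod_dividef[symmetric]
  proof (intro prod.cong refl)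
    fix j
    have "complex_of_real (?r j) \<noteq> 0" using r[of j] by simp
    then have X: "complex_of_real (?r j) powr (?s - of_nat CARD('n) - e j) =
        of_real (?r j) powr ?s / of_real (?r j) ^ CARD('n) / of_real (?r j) powr e j"
      by (simp add: powr_diff powr_nat')
    show "of_real (?r j) powr ?s * of_real (b $ j $ j / ?r j) powr e j / of_real (?r j) ^ CARD('n) =
        of_real (b $ j $ j) powr e j * of_real (?r j) powr (?s - of_nat CARD('n) - e j)"
      unfolding of_real_divide_powr[OF bpos r] X by (simp only: divide_inverse mult_ac)
  qed
  finally have main: "of_real \<bar>det g\<bar> powr ?s * (\<Prod>j\<in>UNIV. of_real (b $ j $ j / ?r j) powr e j) / of_real (\<bar>det g\<bar> ^ CARD('n)) =
      (\<Prod>j\<in>UNIV. of_real (b $ j $ j) powr e j) * (\<Prod>j\<in>UNIV. of_real (?r j) powr (?s - of_nat CARD('n) - e j))"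
    by (simp add: prod.distrib)
  have "convolution_integrand (Q_hat c s) (spherical_vec \<epsilon> \<gamma>) (k ** b) (k ** g) / of_real (\<bar>det g\<bar> ^ CARD('n)) =
    of_real ((c / pi) powr (real (ell TYPE('n) * (ell TYPE('n) + 1)) / 4)) *
      (Delta_W (k ** g) * minor (transpose (gs_q g)) {i. \<epsilon> i = 1} {i. \<epsilon> i = 1}) * of_real (exp (- c * (norm g)\<^sup>2)) *
      (of_real \<bar>det g\<bar> powr ?s * (\<Prod>j\<in>UNIV. of_real (b $ j $ j / ?r j) powr e j) / of_real (\<bar>det g\<bar> ^ CARD('n)))"
    unfolding convolution_integrand_def inv spherical_vec_inverse_mult[OF g b] Q_hat_def tr
      abs_det_orthogonal_mult[OF k] e_def
    by (simp only: mult_ac divide_inverse)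
  then show ?thesis
    unfolding main reduced_integrand_def by (simp only: mult_ac)
qed

text \<open>Scale and density combine into one real weight. As \<open>R\<close> vanishes at singular
  matrices, the integrals over \<open>GL\<close> and over all matrices coincide.\<close>

lemma haar_GL_integral:
  fixes F R :: "('n::{finite,linorder}) rmat \<Rightarrow> complex"
  assumes R: "integrable lborel R" and eq: "\<And>g. invertible g \<Longrightarrow> F g / of_real (\<bar>det g\<bar> ^ CARD('n)) = R g"
    and R0: "\<And>g. \<not> invertible g \<Longrightarrow> R g = 0"
  shows "integrable haar_GL F"
    "integral\<^sup>L haar_GL F = of_real (\<Prod>j = 1..CARD('n). Gamma (real j / 2) / pi powr (real j / 2)) * integral\<^sup>L lborel R"
proof -
  define K where "K = (\<Prod>j = 1..CARD('n). Gamma (real j / 2) / pi powr (real j / 2))"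
  have K: "K \<ge> 0" unfolding K_def by (intro prod_nonneg) (auto intro!: divide_nonneg_nonneg less_imp_le Gamma_real_pos)
  have GL [measurable]: "GL \<in> sets (borel :: 'n rmat measure)"
    unfolding GL_def by (rule sets_invertible)
  let ?L = "restrict_space lborel GL :: 'n rmat measure"
  have [measurable]: "R \<in> borel_measurable borel"
    using borel_measurable_integrable[OF R] by simp
  have det: "\<bar>det g\<bar> = (\<Prod>i\<in>UNIV. norm (gs_residual g i))" for g :: "'n rmat"
  proof (cases "invertible g")
    case False
    then have "det g = 0"
      by (simp add: invertible_det_nz)
    moreover have "(\<Prod>i\<in>UNIV. norm (gs_residual g i)) = 0"
      using False by (auto simp: invertible_iff_gs_residual prod_zero_iff)
    ultimately show ?thesis by simp
  qed (rule abs_det_eq_gs_residual)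
  have det_meas [measurable]: "(\<lambda>g :: 'n rmat. \<bar>det g\<bar>) \<in> borel_measurable borel"
    unfolding det by measurable
  \<comment> \<open>Measurability of \<open>F\<close> is not assumed; on \<open>GL\<close> it is
    inherited from \<open>R\<close>.\<close>
  have F: "F g = \<bar>det g\<bar> ^ CARD('n) *\<^sub>R R g" if "g \<in> GL" for g
    using eq[of g] that by (auto simp: GL_def invertible_det_nz scaleR_conv_of_real field_simps)
  have meas: "F \<in> borel_measurable ?L"
  proof -
    have "(\<lambda>g. \<bar>det g\<bar> ^ CARD('n) *\<^sub>R R g) \<in> borel_measurable ?L"
      by (rule measurable_restrict_space1) measurable
    moreover have "F \<in> borel_measurable ?L \<longleftrightarrow> (\<lambda>g. \<bar>det g\<bar> ^ CARD('n) *\<^sub>R R g) \<in> borel_measurable ?L"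
      by (rule measurable_cong) (simp add: space_restrict_space F)
    ultimately show ?thesis by blast
  qed
  have dmeas: "(\<lambda>g :: 'n rmat. 1 / \<bar>det g\<bar> ^ CARD('n)) \<in> borel_measurable ?L"
    by (rule measurable_restrict_space1) measurable
  have kmeas: "(\<lambda>g :: 'n rmat. K * (1 / \<bar>det g\<bar> ^ CARD('n))) \<in> borel_measurable ?L"
    by (intro borel_measurable_times borel_measurable_const dmeas)
  have haar: "haar_GL = density ?L (\<lambda>g. ennreal (K * (1 / \<bar>det g\<bar> ^ CARD('n))))"
  proof (rule measure_eqI)
    fix X assume "X \<in> sets (haar_GL :: 'n rmat measure)"
    then have X [measurable]: "X \<in> sets ?L"
      by (simp add: haar_GL_def haar_lebesgue_def)
    note dmeas [measurable]
    have "emeasure haar_GL X = ennreal K * (\<integral>\<^sup>+g. ennreal (1 / \<bar>det g\<bar> ^ CARD('n)) * indicator X g \<partial>?L)"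
      unfolding haar_GL_def haar_lebesgue_def K_def[symmetric] by (simp add: emeasure_density)
    also have "\<dots> = (\<integral>\<^sup>+g. ennreal (K * (1 / \<bar>det g\<bar> ^ CARD('n))) * indicator X g \<partial>?L)"
      unfolding ennreal_mult'[OF K] mult.assoc by (rule nn_integral_cmult[symmetric]) measurable
    also have "\<dots> = emeasure (density ?L (\<lambda>g. ennreal (K * (1 / \<bar>det g\<bar> ^ CARD('n))))) X"
      by (rule emeasure_density[symmetric]) measurable
    finally show "emeasure haar_GL X = emeasure (density ?L (\<lambda>g. ennreal (K * (1 / \<bar>det g\<bar> ^ CARD('n))))) X" .
  qed (simp add: haar_GL_def haar_lebesgue_def)
  have ind: "indicator GL g *\<^sub>R ((K * (1 / \<bar>det g\<bar> ^ CARD('n))) *\<^sub>R F g) = of_real K * R g" for g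
  proof (cases "invertible g")
    case True
    then show ?thesis
      unfolding eq[OF True, symmetric] by (simp add: GL_def scaleR_conv_of_real)
  qed (simp add: GL_def R0)
  have "integrable haar_GL F \<longleftrightarrow> integrable lborel (\<lambda>g. indicator GL g *\<^sub>R ((K * (1 / \<bar>det g\<bar> ^ CARD('n))) *\<^sub>R F g))"
    unfolding haar using meas kmeas K
    by (subst integrable_density) (auto simp: integrable_restrict_space)
  then show "integrable haar_GL F"
    unfolding ind using R by simp
  have "integral\<^sup>L haar_GL F = (\<integral>g. (K * (1 / \<bar>det g\<bar> ^ CARD('n))) *\<^sub>R F g \<partial>?L)"
    unfolding haar using meas kmeas K by (intro integral_density) auto
  also have "\<dots> = (\<integral>g. indicator GL g *\<^sub>R ((K * (1 / \<bar>det g\<bar> ^ CARD('n))) *\<^sub>R F g) \<partial>lborel)"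
    by (rule integral_restrict_space) simp
  also have "\<dots> = of_real K * integral\<^sup>L lborel R"
    unfolding ind by simp
  finally show "integral\<^sup>L haar_GL F =
      of_real (\<Prod>j = 1..CARD('n). Gamma (real j / 2) / pi powr (real j / 2)) * integral\<^sup>L lborel R"
    unfolding K_def .
qed

theorem theorem5p1:
  fixes c :: real and s :: complex
    and \<gamma> :: "('n::{finite,linorder}) rvec" and \<epsilon> :: "'n \<Rightarrow> nat"
    and h :: "'n rmat"
  assumes "0 < c" and "0 < Re s" and "\<epsilon> \<in> sign_vectors" and "h \<in> GL"
  shows "integrable haar_GL (convolution_integrand (Q_hat c s) (spherical_vec \<epsilon> \<gamma>) h) \<and>
    convolution (Q_hat c s) (spherical_vec \<epsilon> \<gamma>) h = L_factor c s \<epsilon> \<gamma> * spherical_vec \<epsilon> \<gamma> h"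
proof -
  obtain k b where k: "orthogonal_matrix k" and b: "b \<in> lower_pos" and h: "h = k ** b"
    using iwasawa_exists[of h] assms(4) by (auto simp: GL_def)
  define I where "I = {i. \<epsilon> i = 1}"
  define e where "e j = \<i> * of_real (\<gamma> $ j) + of_real (rho j)" for j
  define z where "z j = s + of_nat (ell TYPE('n)) / 2 - of_nat CARD('n) - e j" for j
  define m where "m j = card {i. j \<le> i}" for j :: 'n
  define A where "A = complex_of_real ((c / pi) powr (real (ell TYPE('n) * (ell TYPE('n) + 1)) / 4))"
  define B where "B = (\<Prod>j\<in>UNIV. complex_of_real (b $ j $ j) powr e j)"
  define F where "F = convolution_integrand (Q_hat c s) (spherical_vec \<epsilon> \<gamma>) h"
  \<comment> \<open>The reduced integrand pulled back along left multiplication by the transpose of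
    \<open>k\<close>, which preserves Lebesgue measure.\<close>
  define R where "R g = A * B * reduced_integrand c z I k (transpose k ** g)" for g
  have kt: "orthogonal_matrix (transpose k)"
    using k by (simp add: orthogonal_matrix_transpose)
  \<comment> \<open>The shift in \<open>rho\<close> is exactly compensated by the gamma shape: the
    terms in \<ell>, \<open>CARD('n)\<close> and \<open>position j\<close> all cancel.\<close>
  have zm: "z j + of_nat (m j) = s - \<i> * of_real (\<gamma> $ j)" for j
  proof -
    have "real (ell TYPE('n)) / 2 - real CARD('n) - rho j + real (m j) = 0"
      by (simp add: m_def card_upper rho_def)
    then have "complex_of_real (real (ell TYPE('n)) / 2 - real CARD('n) - rho j + real (m j)) = 0"
      by (simp only: of_real_0)
    then show ?thesis by (simp add: z_def e_def algebra_simps)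
  qed
  have zpos: "Re (z j) + real (card {i. j \<le> i}) > 0" for j
    using arg_cong[OF zm[of j], of Re] assms(2) by (simp add: m_def)
  have T: "orthogonal_transformation (\<lambda>g :: 'n rmat. transpose k ** g)"
    using orthogonal_transformation_matrix_mult[OF kt orthogonal_matrix_id] by simp
  have int: "integrable lborel (reduced_integrand c z I k)"
    using assms(1) zpos k by (rule integrable_reduced_integrand)
  have R_int: "integrable lborel R"
    unfolding R_def using lborel_integral_orthogonal(2)[OF T, of "reduced_integrand c z I k"] int by simp
  have "integral\<^sup>L lborel R = A * B * integral\<^sup>L lborel (reduced_integrand c z I k)"
    unfolding R_def using lborel_integral_orthogonal(1)[OF T, of "reduced_integrand c z I k"] by simp
  note R_eq = this[unfolded integral_reduced_integrand[OF assms(1) zpos k]]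
  have kkt: "k ** (transpose k ** g) = g" for g :: "'n rmat"
    using k by (simp add: matrix_mul_assoc orthogonal_matrix_def)
  have inv: "invertible (transpose k ** g) \<longleftrightarrow> invertible g" for g :: "'n rmat"
    using k kkt[of g] by (metis invertible_mult invertible_orthogonal kt)
  have FR: "F g / of_real (\<bar>det g\<bar> ^ CARD('n)) = R g" if "invertible g" for g
    using convolution_integrand_eq[OF k b, of "transpose k ** g" c s \<epsilon> \<gamma>] that inv[of g]
    by (simp add: F_def R_def h kkt abs_det_orthogonal_mult[OF kt] A_def B_def z_def[abs_def] e_def[abs_def] I_def)
  have R0: "R g = 0" if "\<not> invertible g" for g
  proof -
    have "\<not> invertible (transpose k ** g)" using that inv by simp
    then have "(\<Prod>j\<in>UNIV. complex_of_real (norm (gs_residual (transpose k ** g) j)) powr z j) = 0"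
      by (auto simp: invertible_iff_gs_residual prod_zero_iff)
    then show ?thesis by (simp add: R_def reduced_integrand_def)
  qed
  define K where "K = (\<Prod>j = 1..CARD('n). Gamma (real j / 2) / pi powr (real j / 2))"
  have haar: "integrable haar_GL F" "integral\<^sup>L haar_GL F = of_real K * integral\<^sup>L lborel R"
    unfolding K_def by (rule haar_GL_integral[OF R_int]; fact FR R0)+
  define C where "C = (pi / c) powr (real (CARD('n) * CARD('n)) / 2)"
  define M where "M = (\<Prod>j\<in>(UNIV :: 'n set). c powr (real (m j) / 2) / Gamma (real (m j) / 2))"
  have const: "of_real K * A * of_real C * of_real M = (1 :: complex)"
    unfolding A_def K_def C_def M_def m_def
    using arg_cong[OF haar_constant[OF assms(1), where 'n = 'n], of complex_of_real]
    by (simp only: of_real_mult of_real_1)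
  have \<epsilon>: "of_nat (\<epsilon> j) = (of_bool (j \<in> I) :: complex)" for j
    using assms(3) by (auto simp: sign_vectors_def I_def Pi_iff)
  \<comment> \<open>By \<open>zm\<close> the arguments of \<Gamma> become those of the L-factor.
    Each power of \<open>c\<close> leaves a surplus \<open>c powr (m j / 2)\<close>, which is
    gathered with the normalization of the gamma law in \<open>M\<close>.\<close>
  have factor: "of_real c powr (- (z j + of_bool (j \<in> I)) / 2) *
      Gamma ((z j + of_bool (j \<in> I) + of_nat (card {i. j \<le> i})) / 2) / Gamma (of_nat (card {i. j \<le> i}) / 2) =
      of_real (c powr (real (m j) / 2) / Gamma (real (m j) / 2)) *
      (of_real c powr (- ((s + of_nat (\<epsilon> j) - \<i> * of_real (\<gamma> $ j)) / 2)) *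
        Gamma ((s + of_nat (\<epsilon> j) - \<i> * of_real (\<gamma> $ j)) / 2))" for j
  proof -
    let ?w = "s + of_nat (\<epsilon> j) - \<i> * of_real (\<gamma> $ j)"
    have w: "z j + of_bool (j \<in> I) + of_nat (card {i. j \<le> i}) = ?w"
      using zm[of j] by (simp add: \<epsilon> m_def algebra_simps)
    have "- (x - of_nat l) / 2 = of_real (real l / 2) + - (x / 2)" for x :: complex and l
      by (simp add: field_simps)
    moreover have "z j + of_bool (j \<in> I) = ?w - of_nat (m j)"
      using w by (simp only: eq_diff_eq m_def)
    ultimately have "- (z j + of_bool (j \<in> I)) / 2 = of_real (real (m j) / 2) + - (?w / 2)"
      by (simp only:)
    then have "of_real c powr (- (z j + of_bool (j \<in> I)) / 2) =
        of_real (c powr (real (m j) / 2)) * complex_of_real c powr (- (?w / 2))"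
      using assms(1) by (simp only: powr_add) (simp add: powr_of_real[symmetric])
    then show ?thesis
      unfolding w by (simp add: m_def Gamma_complex_of_real[symmetric])
  qed
  have "convolution (Q_hat c s) (spherical_vec \<epsilon> \<gamma>) h = integral\<^sup>L haar_GL F"
    by (simp add: convolution_def F_def)
  also have "\<dots> = of_real K * (A * B * (minor k I I * (of_real C * (of_real M * L_factor c s \<epsilon> \<gamma>))))"
    unfolding haar(2) R_eq factor C_def M_def L_factor_def prod.distrib of_real_prod
    by (simp only: mult_ac)
  also have "\<dots> = (of_real K * A * of_real C * of_real M) * (L_factor c s \<epsilon> \<gamma> * (minor k I I * B))"
    by (simp only: mult_ac)
  also have "minor k I I * B = spherical_vec \<epsilon> \<gamma> h"
    unfolding h spherical_vec_eq[OF k b] by (simp add: I_def B_def e_def)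
  finally show ?thesis
    using haar(1) by (simp add: const F_def)
qed

end
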